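(* Let $A,B,C_1,\dots,C_p,D_1,\dots,D_q$ be matrices in $\mathbb{C}^{r\times r}$ and $\mu\in\mathbb{C}$ such that $D_iD_j=D_jD_i$ for all $1\le i,j\le q$ and $\Re(\mu)>0$. Then, for each $1\le j\le q$ and $z>0$, the fractional derivative of order $\mu$ satisfies $$\mathbf{D}^\mu\left[{}_pR_q(A,B;z)\,z^{D_j-I}\right]={}_pR_q\left(\begin{array}{c}C_1,\dots,C_p\\ D_1,\dots,D_{j-1},D_j-\mu I,D_{j+1},\dots,D_q\end{array}\mid A,B;z\right)z^{D_j-(\mu+1)I}\,\Gamma(D_j)\,\Gamma^{-1}(D_j-\mu I).$$
   Context: For $x>0$ and $\Re(\nu)>0$, the Riemann–Liouville fractional integral of order $\nu$ (based at $0$) is $(\mathbf{I}^\nu f)(x)=\frac{1}{\Gamma(\nu)}\int_0^x(x-t)^{\nu-1}f(t)\,dt$. For $\Re(\mu)>0$ and $n=\lfloor\Re(\mu)\rfloor+1$, the Riemann–Liouville fractional derivative of order $\mu$ is $(\mathbf{D}^\mu f)(x)=\left(\frac{d}{dx}\right)^n(\mathbf{I}^{n-\mu}f)(x)$. For $x>0$, $x^M=\exp(M\ln x)$. $\Gamma(M)$ is the gamma matrix function (equal to $\int_0^\infty e^{-t}t^{M-I}\,dt$ for matrices $M$ all of whose eigenvalues have positive real part) and $\Gamma^{-1}(M)$ denotes the entire function $1/\Gamma$ applied to $M$. The Pochhammer symbol of $M\in\mathbb{C}^{r\times r}$ is $(M)_0=I$, $(M)_n=M(M+I)\cdots(M+(n-1)I)$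 for $n\ge 1$. For matrices $A,B,C_1,\dots,C_p,D_1,\dots,D_q\in\mathbb{C}^{r\times r}$ such that each $D_j+kI$ is invertible for all integers $k\ge 0$, one defines $${}_pR_q(A,B;z)={}_pR_q\left(\begin{array}{c}C_1,\dots,C_p\\ D_1,\dots,D_q\end{array}\mid A,B;z\right)=\sum_{n\ge 0}\Gamma^{-1}(nA+B)\,(C_1)_n\cdots(C_p)_n\,(D_1)_n^{-1}\cdots(D_q)_n^{-1}\,\frac{z^n}{n!},$$ with products taken in the written order. The invertibility condition in this definition is assumed for the parameters of every function ${}_pR_q$ appearing.
   Formalization: The formal theorem also assumes that the series pRq(A,B;x) converges and that the fractional integral of order n−μ of pRq(A,B;t)t^{D_j−I} exists at every x in an interval (0,ρ) containing z; without this the left side can be undefined (e.g. r=1, p=0, q=1, A=0, B=1, D_1=−1/2). *)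

theory Defs
  imports "HOL-Complex_Analysis.Complex_Analysis"
begin

text \<open>
  Square matrices are \<open>complex^'r^'r\<close>. The product is \<open>**\<close>; the type class operations \<open>*\<close> and \<open>^\<close>
  act entrywise on this type, so powers are defined separately. The scalar matrix \<open>c I\<close> is \<open>mat c\<close>,
  and scalar multiplication by \<open>c\<close> is \<open>mat c ** M\<close>.
\<close>

primrec mpow :: "complex^'r^'r \<Rightarrow> nat \<Rightarrow> complex^'r^'r" where
  "mpow M 0 = mat 1"
| "mpow M (Suc n) = M ** mpow M n"

definition mexp :: "complex^'r^'r \<Rightarrow> complex^'r^'r" where
  "mexp M = (\<Sum>n. (1 / fact n) *\<^sub>R mpow M n)"

definition powm :: "real \<Rightarrow> complex^'r^'r \<Rightarrow> complex^'r^'r" where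
  "powm x M = mexp (ln x *\<^sub>R M)"

definition spectrum :: "complex^'r^'r \<Rightarrow> complex set" where
  "spectrum M = {l. \<not> invertible (mat l - M)}"

text \<open>
  Holomorphic functional calculus: the Dunford integral of \<open>f(z) (zI - M)\<^sup>-\<^sup>1 dz / (2 \<pi> i)\<close> along a
  cycle consisting of one small positively oriented circle around each eigenvalue of \<open>M\<close>. The
  library's \<open>residue\<close> is by definition this normalised integral over a small circle, taken here
  entry by entry. The function \<open>f\<close> has to be holomorphic in a neighbourhood of the spectrum.
\<close>

definition mat_fun :: "(complex \<Rightarrow> complex) \<Rightarrow> complex^'r^'r \<Rightarrow> complex^'r^'r" where
  "mat_fun f M =
     (\<chi> i j. \<Sum>l\<in>spectrum M. residue (\<lambda>z. f z * matrix_inv (mat z - M) $ i $ j) l)"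

text \<open>
  \<open>mGamma M\<close> is meaningful if no eigenvalue of \<open>M\<close> is a pole of \<open>Gamma\<close>, i.e. if \<open>M + kI\<close> is
  invertible for all \<open>k \<ge> 0\<close>; \<open>mrGamma M\<close> is meaningful for all \<open>M\<close>.
\<close>

definition mGamma :: "complex^'r^'r \<Rightarrow> complex^'r^'r" where
  "mGamma M = mat_fun Gamma M"

definition mrGamma :: "complex^'r^'r \<Rightarrow> complex^'r^'r" where
  "mrGamma M = mat_fun rGamma M"

primrec mpochhammer :: "complex^'r^'r \<Rightarrow> nat \<Rightarrow> complex^'r^'r" where
  "mpochhammer M 0 = mat 1"
| "mpochhammer M (Suc n) = mpochhammer M n ** (M + mat (of_nat n))"

primrec mprod_list :: "(complex^'r^'r) list \<Rightarrow> complex^'r^'r" where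
  "mprod_list [] = mat 1"
| "mprod_list (M # Ms) = M ** mprod_list Ms"

text \<open>The parameters \<open>C\<^sub>1, \<dots>, C\<^sub>p\<close> and \<open>D\<^sub>1, \<dots>, D\<^sub>q\<close> are given as lists \<open>Cs\<close> and \<open>Ds\<close>.\<close>

definition pRq_term ::
  "(complex^'r^'r) list \<Rightarrow> (complex^'r^'r) list \<Rightarrow> complex^'r^'r \<Rightarrow> complex^'r^'r
     \<Rightarrow> complex \<Rightarrow> nat \<Rightarrow> complex^'r^'r" where
  "pRq_term Cs Ds A B z n =
     mrGamma (real n *\<^sub>R A + B)
     ** mprod_list (map (\<lambda>C. mpochhammer C n) Cs)
     ** mprod_list (map (\<lambda>D. matrix_inv (mpochhammer D n)) Ds)
     ** mat (z ^ n / fact n)"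

definition pRq_converges ::
  "(complex^'r^'r) list \<Rightarrow> (complex^'r^'r) list \<Rightarrow> complex^'r^'r \<Rightarrow> complex^'r^'r
     \<Rightarrow> complex \<Rightarrow> bool" where
  "pRq_converges Cs Ds A B z \<longleftrightarrow> summable (pRq_term Cs Ds A B z)"

definition pRq ::
  "(complex^'r^'r) list \<Rightarrow> (complex^'r^'r) list \<Rightarrow> complex^'r^'r \<Rightarrow> complex^'r^'r
     \<Rightarrow> complex \<Rightarrow> complex^'r^'r" where
  "pRq Cs Ds A B z = (\<Sum>n. pRq_term Cs Ds A B z n)"

definition RL_integrand ::
  "complex \<Rightarrow> (real \<Rightarrow> complex^'r^'r) \<Rightarrow> real \<Rightarrow> real \<Rightarrow> complex^'r^'r" where
  "RL_integrand \<nu> f x t = mat (complex_of_real (x - t) powr (\<nu> - 1)) ** f t"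

definition RL_integrable :: "complex \<Rightarrow> (real \<Rightarrow> complex^'r^'r) \<Rightarrow> real \<Rightarrow> bool" where
  "RL_integrable \<nu> f x \<longleftrightarrow> set_integrable lborel {0<..<x} (RL_integrand \<nu> f x)"

definition RL_integral ::
  "complex \<Rightarrow> (real \<Rightarrow> complex^'r^'r) \<Rightarrow> real \<Rightarrow> complex^'r^'r" where
  "RL_integral \<nu> f x =
     mat (1 / Gamma \<nu>) ** set_lebesgue_integral lborel {0<..<x} (RL_integrand \<nu> f x)"

primrec nth_vderiv :: "nat \<Rightarrow> (real \<Rightarrow> 'a::real_normed_vector) \<Rightarrow> real \<Rightarrow> 'a" where
  "nth_vderiv 0 g = g"
| "nth_vderiv (Suc n) g = (\<lambda>x. vector_derivative (nth_vderiv n g) (at x))"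

definition RL_order :: "complex \<Rightarrow> nat" where
  "RL_order \<mu> = nat (\<lfloor>Re \<mu>\<rfloor> + 1)"

definition RL_deriv ::
  "complex \<Rightarrow> (real \<Rightarrow> complex^'r^'r) \<Rightarrow> real \<Rightarrow> complex^'r^'r" where
  "RL_deriv \<mu> f =
     nth_vderiv (RL_order \<mu>) (RL_integral (of_nat (RL_order \<mu>) - \<mu>) f)"

text \<open>
  Integrals and derivatives are total functions in HOL, so the existence of the fractional
  derivative at a point is a separate predicate.
\<close>

definition RL_differentiable ::
  "complex \<Rightarrow> (real \<Rightarrow> complex^'r^'r) \<Rightarrow> real \<Rightarrow> bool" where
  "RL_differentiable \<mu> f x \<longleftrightarrow>
     (\<forall>\<^sub>F y in nhds x.
        RL_integrable (of_nat (RL_order \<mu>) - \<mu>) f y \<and>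
        (\<forall>k<RL_order \<mu>.
           nth_vderiv k (RL_integral (of_nat (RL_order \<mu>) - \<mu>) f) differentiable (at y)))"

end

theory Submission
  imports Defs
    "HOL-Computational_Algebra.Fundamental_Theorem_Algebra"
    "HOL-Real_Asymp.Real_Asymp"
begin

text \<open>
  Matrix identities are tested on generalised eigenvectors \<open>v\<close> of \<open>D = D\<^sub>j\<close>, which span the whole
  space. If \<open>v\<close> belongs to the eigenvalue \<open>\<lambda>\<close> and \<open>N = D - \<lambda>\<close>, then \<open>f(D) v\<close> is the finite Taylor sum
  of \<open>f\<^sup>(\<^sup>k\<^sup>)(\<lambda>) / k! N\<^sup>k v\<close>; this holds for the residue calculus and for \<open>t\<^sup>D = exp (D ln t)\<close> alike, so
  all functions of \<open>D\<close> multiply like scalar functions.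

  Expanding \<open>s \<mapsto> \<integral> (x - t)\<^sup>\<nu>\<^sup>-\<^sup>1 t\<^sup>s\<^sup>-\<^sup>1 dt = x\<^sup>\<nu>\<^sup>+\<^sup>s\<^sup>-\<^sup>1 B(\<nu>, s)\<close> in a power series yields the same
  integrals with powers of \<open>ln t\<close>, hence the fractional integral of \<open>t\<^sup>D\<^sup>-\<^sup>1 v\<close> as long as \<open>Re \<lambda> > 0\<close>. In
  \<open>F(t) t\<^sup>D\<^sup>-\<^sup>1 v\<close>, with \<open>F(t) = \<Sum> t\<^sup>n c\<^sub>n\<close>, the terms with \<open>Re \<lambda> + n \<le> 0\<close> are not integrable by
  themselves; integrability of the sum forces their coefficients to annihilate the generalised
  eigenspace. So \<open>F(t) t\<^sup>D\<^sup>-\<^sup>1\<close> may be integrated and then differentiated term by term, and the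
  functional equation of \<open>\<Gamma>\<close> turns \<open>(D)\<^sub>n\<^sup>-\<^sup>1\<close> into \<open>(D - \<mu>)\<^sub>n\<^sup>-\<^sup>1 \<Gamma>(D) \<Gamma>\<^sup>-\<^sup>1(D - \<mu>)\<close>.
\<close>

section \<open>Generalised eigenvectors\<close>

text \<open>The matrices \<open>A\<close>, \<open>B\<close> and the \<open>C\<close>s need not
  commute with \<open>D\<close>, so the coefficients \<open>c n\<close> are arbitrary. The argument
  works because every function of \<open>D\<close> stands to their right and acts first on the test
  vector. The commutation of the \<open>D\<close>s has a single task: carrying the factor that
  changes one parameter past the inverse symbols that follow it.

  The real parts of the eigenvalues of \<open>D\<close> are unrestricted, so integrability at 0 is a
  genuine condition on the coefficients, which has to be exploited rather than proved.

  Convergence of the new series is part of the conclusion. It comes from the quotients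
  \<open>(z)_n / (z + c)_n\<close>: consecutive ones differ by the factor
  \<open>(z + n) / (z + c + n)\<close>, which tends to 1, so multiplying coefficients by them costs
  less than any geometric growth and preserves convergence on an open interval. These quotients
  occur with \<open>c = \<nu>\<close> in the Beta values of the fractional integral and with
  \<open>c = - \<mu>\<close> in the change from \<open>D\<close> to \<open>D - \<mu>\<close>, so one
  estimate serves both the integrated and the final series.\<close>

lemma mat_mult_vec [simp]: "mat c *v v = c *s (v :: complex^'r)"
  by (simp add: vec_eq_iff matrix_vector_mult_def mat_def if_distrib if_distribR cong: if_cong)

lemma scaleR_eq_vector_smult: "a *\<^sub>R v = of_real a *s (v :: complex^'r)"
  by (vector scaleR_vec_def) (simp add: scaleR_conv_of_real)

lemma mpow_Suc_vec: "mpow M (Suc n) *v v = mpow M n *v (M *v v)"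
proof (induction n)
  case (Suc n)
  then show ?case
    by (simp add: matrix_vector_mul_assoc[symmetric])
qed simp

lemma mpow_add_vec: "mpow M (m + n) *v v = mpow M m *v (mpow M n *v v)"
  by (induction m) (simp_all add: matrix_vector_mul_assoc[symmetric])

lemma mult_vec_smult: "A *v (c *s v) = c *s (A *v (v :: complex^'r))"
  by (vector matrix_vector_mult_def sum_distrib_left mult_ac)

lemma mult_vec_sum: "A *v (\<Sum>x\<in>S. g x) = (\<Sum>x\<in>S. A *v (g x :: complex^'r))"
  by (rule vec.linear_sum[OF matrix_vector_mul_linear_gen])

definition gen_eigvec :: "complex^'r^'r \<Rightarrow> complex \<Rightarrow> nat \<Rightarrow> complex^'r \<Rightarrow> bool" where
  "gen_eigvec M l K v \<longleftrightarrow> mpow (M - mat l) K *v v = 0"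

lemma gen_eigvec_mono:
  assumes "gen_eigvec M l K v" "K \<le> k"
  shows "mpow (M - mat l) k *v v = 0"
proof -
  obtain d where "k = d + K" using assms(2) by (metis le_add_diff_inverse2)
  then show ?thesis
    using assms(1) by (simp add: gen_eigvec_def mpow_add_vec)
qed

lemma gen_eigvec_step: "gen_eigvec M l (Suc K) v \<Longrightarrow> gen_eigvec M l K ((M - mat l) *v v)"
  unfolding gen_eigvec_def mpow_Suc_vec .

lemma gen_eigvec_mpow: "gen_eigvec M l K v \<Longrightarrow> gen_eigvec M l K (mpow (M - mat l) k *v v)"
  using gen_eigvec_mono[of M l K v "K + k"] by (simp add: gen_eigvec_def mpow_add_vec)

text \<open>The geometric series for \<open>1 / ((z - l) - N)\<close> with \<open>N = M - l\<close>
  breaks off because \<open>N^K\<close> kills \<open>v\<close>; the product telescopes.\<close>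

lemma resolvent_sum:
  assumes "gen_eigvec M l K v" "z \<noteq> l"
  shows "(mat z - M) *v (\<Sum>k<K. (1 / (z - l) ^ Suc k) *s (mpow (M - mat l) k *v v)) = v"
proof -
  define f where "f k = (1 / (z - l) ^ k) *s (mpow (M - mat l) k *v v)" for k
  have "(mat z - M) *v ((1 / (z - l) ^ Suc k) *s (mpow (M - mat l) k *v v)) = f k - f (Suc k)" for k
  proof -
    have "mat z - M = mat (z - l) - (M - mat l)"
      by (vector mat_def)
    moreover have "(z - l) * (1 / (z - l) ^ Suc k) = 1 / (z - l) ^ k"
      using assms(2) by simp
    ultimately show ?thesis
      unfolding f_def mult_vec_smult \<open>mat z - M = _\<close> matrix_vector_mult_diff_rdistrib mpow.simps
        matrix_vector_mul_assoc[symmetric] mat_mult_vec vec.scale_right_diff_distrib vec.scale_scale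
      by (simp only: mult.commute)
  qed
  then have "(mat z - M) *v (\<Sum>k<K. (1 / (z - l) ^ Suc k) *s (mpow (M - mat l) k *v v))
      = (\<Sum>k<K. f k - f (Suc k))"
    by (simp add: mult_vec_sum)
  also have "\<dots> = f 0 - f K"
    by (rule sum_lessThan_telescope')
  also have "\<dots> = v"
    using assms(1) by (simp add: f_def gen_eigvec_def)
  finally show ?thesis .
qed

lemma gen_eigvec_lincomb:
  assumes "gen_eigvec M l K v" "gen_eigvec M l K w"
  shows "gen_eigvec M l K (a *s v + b *s w)"
  using assms by (simp add: gen_eigvec_def matrix_vector_right_distrib mult_vec_smult)

lemma gen_eigvec_sum:
  assumes "\<And>x. x \<in> S \<Longrightarrow> gen_eigvec M l K (g x)"
  shows "gen_eigvec M l K (\<Sum>x\<in>S. c x *s g x)"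
  using assms by (simp add: gen_eigvec_def mult_vec_smult mult_vec_sum)

abbreviation gen_eigvecs :: "complex^'r^'r \<Rightarrow> (complex^'r) set" where
  "gen_eigvecs M \<equiv> {v. \<exists>l K. gen_eigvec M l K v}"

text \<open>Every \<open>w\<close> in the span splits as \<open>(M - l) u\<close> plus a part on which \<open>M - l\<close> is nilpotent, because
  \<open>M - l\<close> is invertible on the generalised eigenspaces belonging to the other eigenvalues.\<close>

lemma gen_eigvecs_span_split:
  assumes "w \<in> vec.span (gen_eigvecs M)"
  shows "\<exists>u\<in>vec.span (gen_eigvecs M). \<exists>K. gen_eigvec M l K (w - (M - mat l) *v u)"
  using assms
proof (induction rule: vec.span_induct_alt)
  case base
  show ?case
    by (rule bexI[of _ 0]) (auto simp: gen_eigvec_def vec.span_zero)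
next
  case (step c x y)
  then obtain u K where u: "u \<in> vec.span (gen_eigvecs M)" "gen_eigvec M l K (y - (M - mat l) *v u)"
    by blast
  from step obtain m J where x: "gen_eigvec M m J x" by blast
  show ?case
  proof (cases "m = l")
    case True
    have "gen_eigvec M l (max J K) x" "gen_eigvec M l (max J K) (y - (M - mat l) *v u)"
      using gen_eigvec_mono[OF x, of "max J K"] gen_eigvec_mono[OF u(2), of "max J K"] True
      by (simp_all add: gen_eigvec_def)
    then have "gen_eigvec M l (max J K) (c *s x + 1 *s (y - (M - mat l) *v u))"
      by (rule gen_eigvec_lincomb)
    then show ?thesis
      using u(1) by (intro bexI[of _ u] exI[of _ "max J K"]) (simp_all add: algebra_simps)
  next
    case False
    define r where "r = (\<Sum>k<J. (1 / (l - m) ^ Suc k) *s (mpow (M - mat m) k *v x))"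
    have "gen_eigvec M m J r"
      unfolding r_def by (intro gen_eigvec_sum gen_eigvec_mpow x)
    then have r: "r \<in> vec.span (gen_eigvecs M)"
      by (intro vec.span_base) blast
    have "(mat l - M) *v r = x"
      unfolding r_def using x False by (intro resolvent_sum) auto
    then have "(M - mat l) *v r = - x"
      by (metis minus_diff_eq matrix_vector_mult_diff_rdistrib)
    then have "c *s x + y - (M - mat l) *v (u - c *s r) = y - (M - mat l) *v u"
      by (simp add: matrix_vector_mult_diff_distrib mult_vec_smult)
    then have "gen_eigvec M l K (c *s x + y - (M - mat l) *v (u - c *s r))"
      using u(2) by (simp only:)
    then show ?thesis
      using u(1) r by (blast intro: vec.span_diff vec.span_scale)
  qed
qed

text \<open>The split applied to \<open>(M - l) v\<close> leaves a remainder
  \<open>(M - l) (v - u)\<close> killed by a power of \<open>M - l\<close>, so one more power kills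
  \<open>v - u\<close> itself.\<close>

lemma gen_eigvecs_span_step:
  assumes "(M - mat l) *v v \<in> vec.span (gen_eigvecs M)"
  shows "v \<in> vec.span (gen_eigvecs M)"
proof -
  obtain u K where u: "u \<in> vec.span (gen_eigvecs M)"
    "gen_eigvec M l K ((M - mat l) *v v - (M - mat l) *v u)"
    using gen_eigvecs_span_split[OF assms] by blast
  then have "gen_eigvec M l (Suc K) (v - u)"
    by (simp add: gen_eigvec_def mpow_Suc_vec matrix_vector_mult_diff_distrib del: mpow.simps)
  then have "v - u \<in> vec.span (gen_eigvecs M)"
    by (intro vec.span_base) blast
  then show ?thesis
    using vec.span_add[OF _ u(1)] by fastforce
qed

text \<open>A root \<open>l\<close> of \<open>p\<close> gives \<open>p = (X - l) q\<close>, and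
  \<open>q\<close> annihilates \<open>(M - l) v\<close>, which lies in the span by induction on the
  degree. Algebraic closedness of the complex numbers enters here.\<close>

lemma gen_eigvecs_span_poly:
  fixes p :: "complex poly"
  assumes "p \<noteq> 0" "(\<Sum>i\<le>degree p. coeff p i *s (mpow M i *v v)) = 0"
  shows "v \<in> vec.span (gen_eigvecs M)"
  using assms
proof (induction "degree p" arbitrary: p v)
  case 0
  then obtain c where "p = [:c:]" "c \<noteq> 0"
    by (metis degree_eq_zeroE pCons_eq_0_iff)
  with 0 have "v = 0" by simp
  then show ?case by (simp add: vec.span_zero)
next
  case (Suc n)
  obtain l where "poly p l = 0"
    using Suc.hyps(2) by (metis constant_degree fundamental_theorem_of_algebra nat.distinct(1))
  then obtain q where q: "p = [:-l, 1:] * q"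
    by (metis dvdE poly_eq_0_iff_dvd)
  have "q \<noteq> 0" using Suc.prems q by auto
  then have deg: "degree p = Suc (degree q)"
    unfolding q by (subst degree_mult_eq) auto
  have p: "p = smult (-l) q + pCons 0 q"
    by (simp add: q)
  have coeff: "coeff p i = - l * coeff q i + (case i of 0 \<Rightarrow> 0 | Suc j \<Rightarrow> coeff q j)" for i
    unfolding p by (simp add: coeff_pCons split: nat.split)
  let ?m = "\<lambda>i. mpow M i *v v"
  have "(\<Sum>i\<le>degree p. coeff p i *s ?m i)
      = (\<Sum>i\<le>Suc (degree q). (- l * coeff q i) *s ?m i)
        + (\<Sum>i\<le>Suc (degree q). (case i of 0 \<Rightarrow> 0 | Suc j \<Rightarrow> coeff q j) *s ?m i)"
    unfolding deg sum.distrib[symmetric] vec.scale_left_distrib[symmetric] coeff ..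
  also have "(\<Sum>i\<le>Suc (degree q). (- l * coeff q i) *s ?m i)
      = (\<Sum>i\<le>degree q. (- l * coeff q i) *s ?m i)"
    by (simp add: coeff_eq_0)
  also have "(\<Sum>i\<le>Suc (degree q). (case i of 0 \<Rightarrow> 0 | Suc j \<Rightarrow> coeff q j) *s ?m i)
      = (\<Sum>i\<le>degree q. coeff q i *s ?m (Suc i))"
    by (subst sum.atMost_Suc_shift) simp
  also have "(\<Sum>i\<le>degree q. (- l * coeff q i) *s ?m i) + \<dots>
      = (\<Sum>i\<le>degree q. coeff q i *s (mpow M i *v ((M - mat l) *v v)))"
    unfolding sum.distrib[symmetric] mpow_Suc_vec
    by (intro sum.cong)
       (simp_all add: matrix_vector_mult_diff_distrib matrix_vector_mult_diff_rdistrib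
         mult_vec_smult vec.scale_right_diff_distrib mult.commute)
  finally have "(M - mat l) *v v \<in> vec.span (gen_eigvecs M)"
    using Suc.prems deg Suc.hyps \<open>q \<noteq> 0\<close> by (intro Suc.hyps(1)[of q]) auto
  then show ?case by (rule gen_eigvecs_span_step)
qed

lemma annihilating_poly_exists:
  "\<exists>p::complex poly. p \<noteq> 0 \<and> (\<Sum>i\<le>degree p. coeff p i *s (mpow M i *v v)) = 0"
  for M :: "complex^'r^'r"
proof -
  let ?n = "CARD('r)"
  let ?f = "\<lambda>i. mpow M i *v v"
  have "\<exists>c::nat \<Rightarrow> complex. (\<exists>i\<le>?n. c i \<noteq> 0) \<and> (\<Sum>i\<le>?n. c i *s ?f i) = 0"
  \<comment> \<open>The powers of \<open>M\<close> up to \<open>?n\<close> give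
    \<open>?n + 1\<close> vectors in dimension \<open>?n\<close>. Dependence speaks of sets, so a
    repetition among them is a separate case, with the relation
    \<open>?f i - ?f j = 0\<close>.\<close>
  proof (cases "inj_on ?f {..?n}")
    case True
    have "card (?f ` {..?n}) = Suc ?n"
      using True by (simp add: card_image)
    then have "vec.dependent (?f ` {..?n})"
      using vec.independent_card_le_dim[of "?f ` {..?n}" UNIV] vec_dim_card[where 'a=complex and 'n='r]
      by auto
    then obtain u where u: "\<exists>w\<in>?f ` {..?n}. u w \<noteq> 0" "(\<Sum>w\<in>?f ` {..?n}. u w *s w) = 0"
      using vec.dependent_finite[of "?f ` {..?n}"] by auto
    then have "(\<Sum>i\<le>?n. u (?f i) *s ?f i) = 0"
      by (subst (asm) sum.reindex[OF True]) simp
    with u show ?thesis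
      by (intro exI[of _ "u \<circ> ?f"]) auto
  next
    case False
    then obtain i j where ij: "i \<le> ?n" "j \<le> ?n" "i \<noteq> j" "?f i = ?f j"
      unfolding inj_on_def by auto
    let ?c = "\<lambda>k. if k = i then 1 else if k = j then -1 else (0 :: complex)"
    have "(\<Sum>k\<le>?n. ?c k *s ?f k) = (\<Sum>k\<in>{i, j}. ?c k *s ?f k)"
      by (rule sum.mono_neutral_right) (use ij in auto)
    then show ?thesis
      using ij by (intro exI[of _ ?c]) auto
  qed
  then obtain c i where c: "i \<le> ?n" "c i \<noteq> 0" "(\<Sum>i\<le>?n. c i *s ?f i) = 0"
    by blast
  define p where "p = (\<Sum>i\<le>?n. monom (c i) i)"
  have coeff: "coeff p i = (if i \<le> ?n then c i else 0)" for i
    by (simp add: p_def coeff_sum)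
  have deg: "degree p \<le> ?n"
    by (rule degree_le) (auto simp: coeff)
  have "(\<Sum>i\<le>degree p. coeff p i *s ?f i) = (\<Sum>i\<le>?n. coeff p i *s ?f i)"
    using deg by (intro sum.mono_neutral_left) (auto simp: coeff_eq_0)
  also have "\<dots> = 0"
    using c(3) by (simp add: coeff)
  finally show ?thesis
    using c coeff[of i] by (intro exI[of _ p]) auto
qed

lemma span_gen_eigvecs: "vec.span (gen_eigvecs M) = UNIV"
  using annihilating_poly_exists gen_eigvecs_span_poly by blast

text \<open>For properties closed under linear combinations, such as limits, sums, derivatives or
  holomorphy of \<open>X v\<close>, a single generalised eigenvector suffices.\<close>

lemma gen_eigvecs_induct [consumes 0, case_names gen_eigvec zero add smult]:
  assumes "\<And>l K v. gen_eigvec M l K v \<Longrightarrow> P v" "P 0"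
    "\<And>v w. P v \<Longrightarrow> P w \<Longrightarrow> P (v + w)" "\<And>c v. P v \<Longrightarrow> P (c *s v)"
  shows "P v"
proof -
  have "v \<in> vec.span (gen_eigvecs M)" by (simp add: span_gen_eigvecs)
  then show ?thesis
    by (rule vec.span_induct_alt) (use assms in auto)
qed

lemma matrix_eq_gen_eigvecs:
  fixes X Y :: "complex^'r^'r"
  assumes "\<And>l K v. gen_eigvec M l K v \<Longrightarrow> X *v v = Y *v v"
  shows "X = Y"
  unfolding matrix_eq
proof
  fix v show "X *v v = Y *v v"
    by (induction v rule: gen_eigvecs_induct[where M = M])
       (use assms in \<open>auto simp: matrix_vector_right_distrib mult_vec_smult\<close>)
qed

text \<open>The main use is the contrapositive: for \<open>l\<close> outside the spectrum only
  \<open>v = 0\<close> remains, so analytic hypotheses on the spectrum alone are enough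
  below.\<close>

lemma gen_eigvec_in_spectrum:
  assumes "gen_eigvec M l K v" "v \<noteq> 0"
  shows "l \<in> spectrum M"
proof (rule ccontr)
  assume "l \<notin> spectrum M"
  then obtain B where B: "B ** (mat l - M) = mat 1"
    by (auto simp: spectrum_def invertible_def)
  have inj: "w = 0" if "(M - mat l) *v w = 0" for w
  proof -
    have "(mat l - M) *v w = 0"
      using that by (metis matrix_vector_mult_diff_rdistrib right_minus_eq)
    then have "B *v ((mat l - M) *v w) = 0" by simp
    then show ?thesis by (simp add: matrix_vector_mul_assoc B)
  qed
  have "mpow (M - mat l) K *v v \<noteq> 0"
    by (induction K) (use assms(2) inj in \<open>auto simp: matrix_vector_mul_assoc[symmetric]\<close>)
  with assms(1) show False by (simp add: gen_eigvec_def)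
qed

lemma invertible_if_surj:
  fixes A :: "complex^'r^'r"
  assumes "\<And>v. \<exists>w. A *v w = v"
  shows "invertible A"
  using assms unfolding invertible_right_inverse matrix_right_invertible_surjective
  by (metis surjI)

text \<open>A sum over an infinite set is 0 in HOL, so \<open>mat_fun\<close> has content only
  thanks to this. A basis of generalised eigenvectors involves finitely many eigenvalues, and off
  these \<open>resolvent_sum\<close> makes \<open>z - M\<close> surjective.\<close>

lemma finite_spectrum: "finite (spectrum M)"
proof -
  obtain B where B: "B \<subseteq> gen_eigvecs M" "vec.independent B" "gen_eigvecs M \<subseteq> vec.span B"
    using vec.maximal_independent_subset by blast
  then have "vec.span B = UNIV"
    using vec.span_mono[OF B(3)] span_gen_eigvecs[of M] by (simp add: vec.span_span top.extremum_unique)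
  moreover have "finite B"
    using B(2) by (rule vec.finiteI_independent)
  moreover obtain L where L: "\<And>v. v \<in> B \<Longrightarrow> \<exists>K. gen_eigvec M (L v) K v"
  proof -
    have "\<forall>v\<in>B. \<exists>l. \<exists>K. gen_eigvec M l K v"
      using B(1) by blast
    then show ?thesis
      using that unfolding bchoice_iff by blast
  qed
  moreover have "spectrum M \<subseteq> L ` B"
  proof
    fix z assume z: "z \<in> spectrum M"
    show "z \<in> L ` B"
    proof (rule ccontr)
      assume "z \<notin> L ` B"
      have "\<exists>w. (mat z - M) *v w = v" for v
      proof -
        have "v \<in> vec.span B" using calculation(1) by simp
        then show ?thesis
        proof (induction rule: vec.span_induct_alt)
          case base
          show ?case by (rule exI[of _ 0]) simp
        next
          case (step c x y)
          obtain K where "gen_eigvec M (L x) K x" using L step by blast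
          moreover have "z \<noteq> L x" using step \<open>z \<notin> L ` B\<close> by blast
          ultimately obtain w1 where "(mat z - M) *v w1 = x"
            using resolvent_sum by blast
          moreover obtain w2 where "(mat z - M) *v w2 = y" using step by blast
          ultimately show ?case
            by (intro exI[of _ "c *s w1 + w2"])
               (simp add: matrix_vector_right_distrib mult_vec_smult del: mat_mult_vec)
        qed
      qed
      then show False
        using invertible_if_surj z by (auto simp: spectrum_def)
    qed
  qed
  ultimately show ?thesis
    by (meson finite_imageI finite_subset)
qed

lemma resolvent_gen_eigvec:
  assumes "gen_eigvec M l K v" "z \<notin> spectrum M"
  shows "matrix_inv (mat z - M) *v v
    = (\<Sum>k<K. (1 / (z - l) ^ Suc k) *s (mpow (M - mat l) k *v v))"
proof (cases "v = 0")
  case False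
  then have "z \<noteq> l"
    using gen_eigvec_in_spectrum assms by blast
  have "invertible (mat z - M)"
    using assms(2) by (simp add: spectrum_def)
  then have inv: "matrix_inv (mat z - M) ** (mat z - M) = mat 1"
    unfolding invertible_def matrix_inv_def by (rule someI2_ex) simp
  show ?thesis (is "_ = ?s")
  proof -
    have "matrix_inv (mat z - M) *v v = matrix_inv (mat z - M) *v ((mat z - M) *v ?s)"
      using resolvent_sum[OF assms(1) \<open>z \<noteq> l\<close>] by (simp only:)
    also have "\<dots> = ?s"
      unfolding matrix_vector_mul_assoc inv by (rule matrix_vector_mul_lid)
    finally show ?thesis .
  qed
qed simp

section \<open>Functional calculus\<close>

lemma matrix_inv_eqI:
  fixes A B :: "'a::field^'n^'n"
  assumes "A ** B = mat 1"
  shows "invertible A" "matrix_inv A = B"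
proof -
  have BA: "B ** A = mat 1" using assms matrix_left_right_inverse by blast
  then show "invertible A" using assms invertible_def by blast
  have "A ** matrix_inv A = mat 1 \<and> matrix_inv A ** A = mat 1"
    unfolding matrix_inv_def by (rule someI[of _ B]) (simp add: assms BA)
  then have "matrix_inv A = (B ** A) ** matrix_inv A" by (simp add: BA)
  also have "\<dots> = B ** (A ** matrix_inv A)" by (rule matrix_mul_assoc[symmetric])
  finally show "matrix_inv A = B"
    using \<open>A ** matrix_inv A = mat 1 \<and> _\<close> by simp
qed

lemma residue_sum:
  assumes "open s" "z \<in> s" "\<And>i. i \<in> I \<Longrightarrow> f i holomorphic_on s - {z}"
  shows "residue (\<lambda>x. \<Sum>i\<in>I. f i x) z = (\<Sum>i\<in>I. residue (f i) z)"
  using assms(3)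
proof (induction I rule: infinite_finite_induct)
  case (insert i I)
  then have "residue (\<lambda>x. f i x + (\<Sum>i\<in>I. f i x)) z = residue (f i) z + residue (\<lambda>x. \<Sum>i\<in>I. f i x) z"
    by (intro residue_add[OF assms(1,2)] holomorphic_intros) auto
  with insert show ?case by simp
qed (simp_all add: residue_const)

text \<open>On a generalised eigenvector the resolvent is an explicit rational function of
  \<open>z\<close> with its only pole at the eigenvalue.\<close>

lemma resolvent_holomorphic:
  "(\<lambda>z. vec_nth (matrix_inv (mat z - M) *v v) i) holomorphic_on - spectrum M"
proof (induction v rule: gen_eigvecs_induct[where M = M])
  case (gen_eigvec l K v)
  show ?case
  proof (cases "v = 0")
    case False
    then have l: "l \<in> spectrum M" using gen_eigvec gen_eigvec_in_spectrum by blast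
    have "(\<lambda>z. \<Sum>k<K. 1 / (z - l) ^ Suc k * vec_nth (mpow (M - mat l) k *v v) i) holomorphic_on - spectrum M"
      using l by (intro holomorphic_intros) auto
    then show ?thesis
      by (rule holomorphic_transform) (simp add: resolvent_gen_eigvec[OF gen_eigvec])
  qed simp
next
  case (add v w)
  then show ?case by (simp add: matrix_vector_right_distrib holomorphic_on_add)
next
  case (smult c v)
  then show ?case by (simp add: mult_vec_smult holomorphic_on_mult)
qed simp

lemma resolvent_component_holomorphic:
  "(\<lambda>z. vec_nth (vec_nth (matrix_inv (mat z - M)) i) j) holomorphic_on - spectrum M"
  using resolvent_holomorphic[of M "axis j 1" i]
  by (simp add: matrix_vector_mult_def axis_def if_distrib if_distribR cong: if_cong)

lemma spectrum_isolated:
  assumes "f analytic_on spectrum M" "l \<in> spectrum M"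
  obtains s where "open s" "l \<in> s" "f holomorphic_on s" "s - {l} \<subseteq> - spectrum M"
proof -
  obtain e where e: "e > 0" "f holomorphic_on ball l e"
    using assms unfolding analytic_on_def by blast
  show ?thesis
    by (rule that[of "ball l e - (spectrum M - {l})"])
       (use e in \<open>auto intro: holomorphic_on_subset open_Diff finite_imp_closed finite_spectrum\<close>)
qed

text \<open>Passing from entries to vectors uses additivity of residues, which requires holomorphy
  on a punctured neighbourhood; hence the condition on \<open>f\<close> and the isolation of the
  eigenvalues.\<close>

lemma mat_fun_vec_component:
  assumes "f analytic_on spectrum M"
  shows "vec_nth (mat_fun f M *v v) i
    = (\<Sum>l\<in>spectrum M. residue (\<lambda>z. f z * vec_nth (matrix_inv (mat z - M) *v v) i) l)"
proof -
  let ?R = "\<lambda>z j. vec_nth (vec_nth (matrix_inv (mat z - M)) i) j"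
  have "residue (\<lambda>z. f z * vec_nth (matrix_inv (mat z - M) *v v) i) l
      = (\<Sum>j\<in>UNIV. residue (\<lambda>z. f z * ?R z j) l * vec_nth v j)" if l: "l \<in> spectrum M" for l
  proof -
    obtain s where s: "open s" "l \<in> s" "f holomorphic_on s" "s - {l} \<subseteq> - spectrum M"
      using spectrum_isolated[OF assms l] .
    have hol: "(\<lambda>z. f z * ?R z j) holomorphic_on s - {l}" for j
      by (intro holomorphic_on_mult holomorphic_on_subset[OF s(3)]
            holomorphic_on_subset[OF resolvent_component_holomorphic s(4)]) auto
    have "(\<lambda>z. f z * vec_nth (matrix_inv (mat z - M) *v v) i)
        = (\<lambda>z. \<Sum>j\<in>UNIV. f z * ?R z j * vec_nth v j)"
      by (simp add: matrix_vector_mult_def sum_distrib_left mult.assoc)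
    then have "residue (\<lambda>z. f z * vec_nth (matrix_inv (mat z - M) *v v) i) l
        = (\<Sum>j\<in>UNIV. residue (\<lambda>z. f z * ?R z j * vec_nth v j) l)"
      using residue_sum[OF s(1,2), of UNIV "\<lambda>j z. f z * ?R z j * vec_nth v j"] hol
      by (simp add: holomorphic_on_mult)
    then show ?thesis
      using residue_rmul[OF s(1,2) hol] by simp
  qed
  then have "(\<Sum>l\<in>spectrum M. residue (\<lambda>z. f z * vec_nth (matrix_inv (mat z - M) *v v) i) l)
      = (\<Sum>j\<in>UNIV. \<Sum>l\<in>spectrum M. residue (\<lambda>z. f z * ?R z j) l * vec_nth v j)"
    by (subst sum.swap) simp
  then show ?thesis
    by (simp add: matrix_vector_mult_def mat_fun_def sum_distrib_right)
qed

text \<open>Truncating the series is harmless on vectors annihilated by \<open>N\<^sup>K\<close>, the only ones it is applied to.\<close>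

definition fps_act :: "complex fps \<Rightarrow> complex^'r^'r \<Rightarrow> nat \<Rightarrow> complex^'r \<Rightarrow> complex^'r" where
  "fps_act F N K v = (\<Sum>k<K. fps_nth F k *s (mpow N k *v v))"

text \<open>Pairs with \<open>i + j \<ge> K\<close> contribute nothing, which reduces the square of
  indices to a triangle whose diagonals form the Cauchy product.\<close>

lemma fps_act_mult:
  assumes "mpow N K *v v = 0"
  shows "fps_act F N K (fps_act G N K v) = fps_act (F * G) N K v"
proof -
  have zero: "mpow N n *v v = 0" if "n \<ge> K" for n
    using assms that by (metis add.commute le_Suc_ex matrix_vector_mult_0_right mpow_add_vec)
  let ?g = "\<lambda>i j. (fps_nth F i * fps_nth G j) *s (mpow N (i + j) *v v)"
  have "fps_act F N K (fps_act G N K v) = (\<Sum>i<K. \<Sum>j<K. ?g i j)"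
    by (simp add: fps_act_def mult_vec_sum mult_vec_smult vec.scale_sum_right mpow_add_vec)
  also have "\<dots> = (\<Sum>(i,j)\<in>{..<K} \<times> {..<K}. ?g i j)"
    by (rule sum.cartesian_product)
  also have "\<dots> = (\<Sum>(i,j)\<in>{(i,j). i + j < K}. ?g i j)"
    by (rule sum.mono_neutral_right) (auto, metis leI zero)
  also have "\<dots> = (\<Sum>k<K. \<Sum>i\<le>k. ?g i (k - i))"
    by (rule sum.triangle_reindex)
  also have "\<dots> = fps_act (F * G) N K v"
    by (simp add: fps_act_def fps_mult_nth vec.scale_sum_left atLeast0AtMost)
  finally show ?thesis .
qed

text \<open>On \<open>v\<close> the resolvent is the sum of \<open>N^k v / (z - m)^(k+1)\<close>.
  The residue of the \<open>k\<close>-th summand at \<open>m\<close> is the \<open>k\<close>-th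
  Taylor coefficient of \<open>f\<close>, and the other eigenvalues contribute 0 because nothing is
  singular there.\<close>

lemma mat_fun_gen_eigvec:
  assumes f: "f analytic_on spectrum M" and v: "gen_eigvec M m K v"
  shows "mat_fun f M *v v = fps_act (fps_expansion f m) (M - mat m) K v"
proof (cases "v = 0")
  case False
  then have m: "m \<in> spectrum M"
    using v gen_eigvec_in_spectrum by blast
  have "vec_nth (mat_fun f M *v v) i = vec_nth (fps_act (fps_expansion f m) (M - mat m) K v) i" for i
  proof -
    let ?a = "\<lambda>k. vec_nth (mpow (M - mat m) k *v v) i"
    let ?r = "\<lambda>l. residue (\<lambda>z. f z * vec_nth (matrix_inv (mat z - M) *v v) i) l"
    have r: "?r l = (if l = m then \<Sum>k<K. fps_nth (fps_expansion f m) k * ?a k else 0)"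
      if l: "l \<in> spectrum M" for l
    proof -
      obtain s where s: "open s" "l \<in> s" "f holomorphic_on s" "s - {l} \<subseteq> - spectrum M"
        using spectrum_isolated[OF f l] .
      have "\<forall>\<^sub>F z in at l. z \<in> s - {l}"
        using s by (intro eventually_at_in_open) auto
      then have "\<forall>\<^sub>F z in at l. f z * vec_nth (matrix_inv (mat z - M) *v v) i
          = (\<Sum>k<K. f z / (z - m) ^ Suc k * ?a k)"
      proof eventually_elim
        case (elim z)
        then have "z \<notin> spectrum M" using s by auto
        then show ?case
          by (simp add: resolvent_gen_eigvec[OF v] sum_distrib_left)
      qed
      then have "?r l = residue (\<lambda>z. \<Sum>k<K. f z / (z - m) ^ Suc k * ?a k) l"
        by (rule residue_cong) simp
      also have "\<dots> = (if l = m then \<Sum>k<K. fps_nth (fps_expansion f m) k * ?a k else 0)"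
      proof (cases "l = m")
        case True
        have hol: "(\<lambda>z. f z / (z - m) ^ Suc k) holomorphic_on s - {m}" for k
          using s(3) by (intro holomorphic_intros holomorphic_on_subset[OF s(3)]) auto
        have "residue (\<lambda>z. \<Sum>k<K. f z / (z - m) ^ Suc k * ?a k) m
            = (\<Sum>k<K. residue (\<lambda>z. f z / (z - m) ^ Suc k * ?a k) m)"
          using s True by (intro residue_sum[of s] holomorphic_on_mult hol) auto
        also have "\<dots> = (\<Sum>k<K. residue (\<lambda>z. f z / (z - m) ^ Suc k) m * ?a k)"
          using s True by (intro sum.cong refl residue_rmul[of s] hol) auto
        also have "\<dots> = (\<Sum>k<K. fps_nth (fps_expansion f m) k * ?a k)"
          using s True by (intro sum.cong refl)
            (subst residue_holomorphic_over_power[of s]; simp add: fps_expansion_def)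
        finally show ?thesis using True by simp
      next
        case False
        have "(\<lambda>z. \<Sum>k<K. f z / (z - m) ^ Suc k * ?a k) holomorphic_on s"
          using m False s(4) by (intro holomorphic_intros s(3)) auto
        then show ?thesis
          using False s by (simp add: residue_holo)
      qed
      finally show ?thesis .
    qed
    have "vec_nth (mat_fun f M *v v) i = (\<Sum>l\<in>spectrum M. ?r l)"
      by (rule mat_fun_vec_component[OF f])
    also have "\<dots> = (\<Sum>k<K. fps_nth (fps_expansion f m) k * ?a k)"
      by (simp add: r finite_spectrum m)
    finally show ?thesis
      by (simp add: fps_act_def)
  qed
  then show ?thesis by (simp add: vec_eq_iff)
qed (simp add: fps_act_def)

text \<open>Expansions are unique, so any known one at \<open>m\<close> can replace the Taylor
  series. It is asked for only at eigenvalues since otherwise \<open>v = 0\<close>.\<close>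

lemma mat_fun_gen_eigvec':
  assumes "f analytic_on spectrum M" "gen_eigvec M m K v"
    "m \<in> spectrum M \<Longrightarrow> (\<lambda>h. f (m + h)) has_fps_expansion F"
  shows "mat_fun f M *v v = fps_act F (M - mat m) K v"
proof (cases "v = 0")
  case False
  then have "m \<in> spectrum M"
    using assms(2) gen_eigvec_in_spectrum by blast
  with assms(1) have "f analytic_on {m}"
    using analytic_on_subset by blast
  then have "(\<lambda>h. f (m + h)) has_fps_expansion fps_expansion f m"
    by (rule analytic_at_imp_has_fps_expansion)
  with assms(3) have "F = fps_expansion f m"
    using \<open>m \<in> spectrum M\<close> fps_expansion_unique_complex by blast
  then show ?thesis using mat_fun_gen_eigvec[OF assms(1,2)] by simp
qed (simp add: fps_act_def)

text \<open>A residue sees only a punctured neighbourhood, hence \<open>at l\<close>: the functions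
  may differ at the eigenvalue itself, and identities between quotients may be checked away from the
  zeros of denominators.\<close>

lemma mat_fun_cong:
  assumes "\<And>l. l \<in> spectrum M \<Longrightarrow> \<forall>\<^sub>F z in at l. f z = g z"
  shows "mat_fun f M = mat_fun g M"
proof -
  have "residue (\<lambda>z. f z * h z) l = residue (\<lambda>z. g z * h z) l" if "l \<in> spectrum M" for h l
    by (rule residue_cong[OF _ refl]) (use assms[OF that] in eventually_elim, simp)
  then show ?thesis
    unfolding mat_fun_def by simp
qed

lemma gen_eigvec_fps_act:
  assumes "gen_eigvec M l K v"
  shows "gen_eigvec M l K (fps_act F (M - mat l) K v)"
  unfolding fps_act_def by (intro gen_eigvec_sum gen_eigvec_mpow assms)

lemma mat_fun_mult:
  assumes "f analytic_on spectrum M" "g analytic_on spectrum M"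
  shows "mat_fun f M ** mat_fun g M = mat_fun (\<lambda>z. f z * g z) M"
proof (rule matrix_eq_gen_eigvecs[of M])
  fix l K v assume v: "gen_eigvec M l K v"
  have "mat_fun (\<lambda>z. f z * g z) M *v v
      = fps_act (fps_expansion f l * fps_expansion g l) (M - mat l) K v"
  proof (rule mat_fun_gen_eigvec'[OF _ v])
    assume "l \<in> spectrum M"
    then have "f analytic_on {l}" "g analytic_on {l}"
      using assms analytic_on_subset by blast+
    then show "(\<lambda>h. f (l + h) * g (l + h)) has_fps_expansion fps_expansion f l * fps_expansion g l"
      by (intro has_fps_expansion_mult analytic_at_imp_has_fps_expansion)
  qed (intro analytic_on_mult assms)
  also have "\<dots> = fps_act (fps_expansion f l) (M - mat l) K (fps_act (fps_expansion g l) (M - mat l) K v)"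
    using v by (intro fps_act_mult[symmetric]) (simp add: gen_eigvec_def)
  also have "\<dots> = mat_fun f M *v (mat_fun g M *v v)"
    by (simp add: mat_fun_gen_eigvec[OF assms(1) gen_eigvec_fps_act[OF v]] mat_fun_gen_eigvec[OF assms(2) v])
  finally show "(mat_fun f M ** mat_fun g M) *v v = mat_fun (\<lambda>z. f z * g z) M *v v"
    by (simp add: matrix_vector_mul_assoc)
qed

lemma mat_fun_commute:
  assumes "f analytic_on spectrum M" "g analytic_on spectrum M"
  shows "mat_fun f M ** mat_fun g M = mat_fun g M ** mat_fun f M"
  by (simp add: mat_fun_mult assms mult.commute)

lemma mat_fun_const: "mat_fun (\<lambda>_. c) M = mat c"
proof (rule matrix_eq_gen_eigvecs[of M])
  fix l K v assume v: "gen_eigvec M l K v"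
  have "mat_fun (\<lambda>_. c) M *v v = fps_act (fps_const c) (M - mat l) K v"
    by (rule mat_fun_gen_eigvec'[OF _ v]) auto
  also have "\<dots> = c *s v"
  proof (cases K)
    case 0
    then show ?thesis using v by (simp add: fps_act_def gen_eigvec_def)
  next
    case (Suc k)
    then show ?thesis unfolding fps_act_def Suc by (subst sum.lessThan_Suc_shift) simp
  qed
  finally show "mat_fun (\<lambda>_. c) M *v v = mat c *v v" by simp
qed

lemma mat_fun_id: "mat_fun (\<lambda>z. z) M = M"
proof (rule matrix_eq_gen_eigvecs[of M])
  fix l K v assume "gen_eigvec M l K v"
  \<comment> \<open>The larger exponent \<open>K + 2\<close> puts both coefficients of
    \<open>l + X\<close> below the truncation.\<close>
  then have v: "gen_eigvec M l (K + 2) v"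
    using gen_eigvec_mono[of M l K v "K + 2"] by (simp add: gen_eigvec_def)
  have "mat_fun (\<lambda>z. z) M *v v = fps_act (fps_const l + fps_X) (M - mat l) (K + 2) v"
    by (rule mat_fun_gen_eigvec'[OF _ v]) (auto intro!: fps_expansion_intros)
  also have "\<dots> = l *s v + (M - mat l) *v v"
    by (simp add: fps_act_def sum.lessThan_Suc_shift numeral_2_eq_2 del: sum.lessThan_Suc)
  finally show "mat_fun (\<lambda>z. z) M *v v = M *v v"
    by (simp add: matrix_vector_mult_diff_rdistrib)
qed

lemma mat_fun_add:
  assumes "f analytic_on spectrum M" "g analytic_on spectrum M"
  shows "mat_fun (\<lambda>z. f z + g z) M = mat_fun f M + mat_fun g M"
proof (rule matrix_eq_gen_eigvecs[of M])
  fix l K v assume v: "gen_eigvec M l K v"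
  have "mat_fun (\<lambda>z. f z + g z) M *v v
      = fps_act (fps_expansion f l + fps_expansion g l) (M - mat l) K v"
  proof (rule mat_fun_gen_eigvec'[OF _ v])
    assume "l \<in> spectrum M"
    then have "f analytic_on {l}" "g analytic_on {l}"
      using assms analytic_on_subset by blast+
    then show "(\<lambda>h. f (l + h) + g (l + h)) has_fps_expansion fps_expansion f l + fps_expansion g l"
      by (intro has_fps_expansion_add analytic_at_imp_has_fps_expansion)
  qed (intro analytic_on_add assms)
  also have "\<dots> = (mat_fun f M + mat_fun g M) *v v"
    by (simp add: matrix_vector_mult_add_rdistrib mat_fun_gen_eigvec[OF assms(1) v]
        mat_fun_gen_eigvec[OF assms(2) v] fps_act_def
        sum.distrib vec.scale_left_distrib)
  finally show "mat_fun (\<lambda>z. f z + g z) M *v v = (mat_fun f M + mat_fun g M) *v v" .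
qed

lemma mat_fun_linear: "mat_fun (\<lambda>z. z + c) M = M + mat c"
  by (simp add: mat_fun_add mat_fun_id mat_fun_const)

lemma mat_diff_add: "mat (z + c) - (M + mat c) = mat z - (M :: complex^'r^'r)"
  by (simp add: vec_eq_iff mat_def)

lemma spectrum_shift: "spectrum (M + mat c) = (\<lambda>l. l + c) ` spectrum M"
proof -
  have "l \<in> spectrum (M + mat c) \<longleftrightarrow> l - c \<in> spectrum M" for l
    using mat_diff_add[of "l - c" c M] unfolding spectrum_def mem_Collect_eq by (simp only: diff_add_cancel)
  moreover have "l \<in> (\<lambda>l. l + c) ` S \<longleftrightarrow> l - c \<in> S" for l S
    by force
  ultimately show ?thesis by blast
qed

text \<open>Functions of \<open>D + c\<close> become functions of \<open>D\<close>, so that one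
  calculus covers all shifted parameters and exponents.\<close>

lemma mat_fun_shift: "mat_fun f (M + mat c) = mat_fun (\<lambda>z. f (z + c)) M"
proof -
  have "residue (\<lambda>z. f z * vec_nth (vec_nth (matrix_inv (mat z - (M + mat c))) i) j) (l + c)
      = residue (\<lambda>z. f (z + c) * vec_nth (vec_nth (matrix_inv (mat z - M)) i) j) l" for i j l
  proof -
    have "mat (l + c + x) - (M + mat c) = mat (l + x) - M" for x
      using mat_diff_add[of "l + x" c M] by (simp only: add.assoc add.commute[of x c])
    then show ?thesis
      by (subst residue_shift_0, subst (2) residue_shift_0) (simp only: add.assoc add.commute[of _ c])
  qed
  moreover have "inj_on (\<lambda>l. l + c) (spectrum M)" by (simp add: inj_on_def)
  ultimately show ?thesis
    unfolding mat_fun_def spectrum_shift by (simp add: sum.reindex)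
qed

text \<open>Non-vanishing at the eigenvalues persists nearby by continuity, and there
  \<open>f * (1 / f) = 1\<close> holds in the sense of \<open>mat_fun_cong\<close>.\<close>

lemma mat_fun_inverse:
  assumes "f analytic_on spectrum M" "\<And>l. l \<in> spectrum M \<Longrightarrow> f l \<noteq> 0"
  shows "invertible (mat_fun f M)" "matrix_inv (mat_fun f M) = mat_fun (\<lambda>z. inverse (f z)) M"
proof -
  let ?g = "\<lambda>z. inverse (f z)"
  have g: "?g analytic_on spectrum M"
    by (intro analytic_on_inverse assms)
  have "mat_fun f M ** mat_fun ?g M = mat_fun (\<lambda>z. f z * ?g z) M"
    by (rule mat_fun_mult[OF assms(1) g])
  also have "\<dots> = mat_fun (\<lambda>_. 1) M"
  proof (rule mat_fun_cong)
    fix l assume l: "l \<in> spectrum M"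
    then have "isCont f l"
      using assms(1) analytic_on_imp_differentiable_at field_differentiable_imp_continuous_at by blast
    then have "\<forall>\<^sub>F z in at l. f z \<noteq> 0"
      using assms(2)[OF l] isCont_def tendsto_imp_eventually_ne by blast
    then show "\<forall>\<^sub>F z in at l. f z * ?g z = 1"
      by eventually_elim simp
  qed
  finally have 1: "mat_fun f M ** mat_fun ?g M = mat 1"
    by (simp add: mat_fun_const)
  then show "invertible (mat_fun f M)" "matrix_inv (mat_fun f M) = mat_fun ?g M"
    by (rule matrix_inv_eqI)+
qed

section \<open>Matrix powers of a positive real\<close>

lemma scaleR_mult_vec: "(r *\<^sub>R A) *v v = r *\<^sub>R (A *v (v :: complex^'n))"
  by (simp add: vec_eq_iff matrix_vector_mult_def scaleR_sum_right)

lemma matrix_mult_add_left: "(A + B) ** C = A ** C + B ** (C :: complex^'k^'n)"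
  by (simp add: vec_eq_iff matrix_matrix_mult_def sum.distrib ring_distribs)

lemma bounded_bilinear_matrix_vector_mult:
  "bounded_bilinear ((*v) :: complex^'n^'m \<Rightarrow> complex^'n \<Rightarrow> complex^'m)"
  unfolding bilinear_conv_bounded_bilinear[symmetric] bilinear_def
  by (auto intro!: linearI simp: matrix_vector_mult_add_rdistrib matrix_vector_right_distrib
        scaleR_mult_vec matrix_vector_mult_scaleR)

lemma bounded_bilinear_matrix_mult:
  "bounded_bilinear ((**) :: complex^'n^'m \<Rightarrow> complex^'k^'n \<Rightarrow> complex^'k^'m)"
  unfolding bilinear_conv_bounded_bilinear[symmetric] bilinear_def
  by (auto intro!: linearI simp: matrix_add_ldistrib matrix_mult_add_left scalar_matrix_assoc[symmetric] matrix_scalar_ac)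

interpretation mv: bounded_bilinear "(*v) :: complex^'n^'m \<Rightarrow> complex^'n \<Rightarrow> complex^'m"
  by (rule bounded_bilinear_matrix_vector_mult)

interpretation mm: bounded_bilinear "(**) :: complex^'n^'m \<Rightarrow> complex^'k^'n \<Rightarrow> complex^'k^'m"
  by (rule bounded_bilinear_matrix_mult)

lemma bounded_linear_smult_left: "bounded_linear (\<lambda>c. c *s (v :: complex^'n))"
  by (auto intro!: linearI simp: linear_conv_bounded_linear[symmetric] vec.scale_left_distrib
        scaleR_eq_vector_smult scaleR_conv_of_real)

lemma bounded_linear_smult_right: "bounded_linear (\<lambda>v :: complex^'n. c *s v)"
  by (auto intro!: linearI simp: linear_conv_bounded_linear[symmetric] vec.scale_right_distrib
        scaleR_eq_vector_smult mult.commute)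

text \<open>Transfers limits, sums and derivatives from the vectors \<open>X v\<close> back to the
  matrices \<open>X\<close>, by bounded linear maps that reassemble a matrix from its
  columns.\<close>

lemma matrix_from_columns:
  obtains T :: "'n::finite \<Rightarrow> complex^'m \<Rightarrow> complex^'n^'m"
  where "\<And>j. bounded_linear (T j)" "\<And>X. X = (\<Sum>j\<in>UNIV. T j (X *v axis j 1))"
proof
  define T :: "'n \<Rightarrow> complex^'m \<Rightarrow> complex^'n^'m"
    where "T j w = (\<chi> i k. if k = j then vec_nth w i else 0)" for j w
  show "bounded_linear (T j)" for j
    by (auto intro!: linearI simp: linear_conv_bounded_linear[symmetric] T_def vec_eq_iff)
  show "X = (\<Sum>j\<in>UNIV. T j (X *v axis j 1))" for X
    by (simp add: T_def vec_eq_iff matrix_vector_mult_def axis_def if_distrib if_distribR cong: if_cong)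
qed

lemma matrix_tendsto:
  fixes X :: "'a \<Rightarrow> complex^'n^'m"
  assumes "\<And>v. ((\<lambda>x. X x *v v) \<longlongrightarrow> E *v v) F"
  shows "(X \<longlongrightarrow> E) F"
proof -
  obtain T :: "'n::finite \<Rightarrow> complex^'m \<Rightarrow> complex^'n^'m"
    where T: "\<And>j. bounded_linear (T j)" "\<And>X. X = (\<Sum>j\<in>UNIV. T j (X *v axis j 1))"
    using matrix_from_columns by blast
  have "((\<lambda>x. \<Sum>j\<in>UNIV. T j (X x *v axis j 1)) \<longlongrightarrow> (\<Sum>j\<in>UNIV. T j (E *v axis j 1))) F"
    by (intro tendsto_sum bounded_linear.tendsto[OF T(1)] assms)
  then show ?thesis by (simp only: T(2)[symmetric])
qed

lemma matrix_sums:
  fixes X :: "nat \<Rightarrow> complex^'n^'m"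
  assumes "\<And>v. (\<lambda>n. X n *v v) sums (E *v v)"
  shows "X sums E"
  unfolding sums_def
  by (rule matrix_tendsto) (use assms in \<open>simp add: sums_def mv.sum_left\<close>)

lemma matrix_has_vector_derivative:
  fixes X :: "real \<Rightarrow> complex^'n^'m"
  assumes "\<And>v. ((\<lambda>x. X x *v v) has_vector_derivative E *v v) F"
  shows "(X has_vector_derivative E) F"
proof -
  obtain T :: "'n::finite \<Rightarrow> complex^'m \<Rightarrow> complex^'n^'m"
    where T: "\<And>j. bounded_linear (T j)" "\<And>X. X = (\<Sum>j\<in>UNIV. T j (X *v axis j 1))"
    using matrix_from_columns by blast
  have "((\<lambda>x. \<Sum>j\<in>UNIV. T j (X x *v axis j 1)) has_vector_derivative (\<Sum>j\<in>UNIV. T j (E *v axis j 1))) F"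
    by (intro has_vector_derivative_sum bounded_linear.has_vector_derivative[OF T(1)] assms)
  then show ?thesis by (simp only: T(2)[symmetric])
qed

lemma fps_nth_linear_mult:
  "fps_nth ((fps_const c + fps_X) * F) k = c * fps_nth F k + (if k = 0 then 0 else fps_nth F (k - 1))"
  for c :: "'a::comm_ring_1"
  by (simp add: ring_distribs)

lemma fps_nth_shift_power: "fps_nth ((fps_const c + fps_X) ^ n) k = of_nat (n choose k) * c ^ (n - k)"
  for c :: "'a::comm_ring_1"
proof (induction n arbitrary: k)
  case (Suc n)
  have "fps_nth ((fps_const c + fps_X) ^ Suc n) k
      = c * fps_nth ((fps_const c + fps_X) ^ n) k
        + (if k = 0 then 0 else fps_nth ((fps_const c + fps_X) ^ n) (k - 1))"
    unfolding power_Suc by (rule fps_nth_linear_mult)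
  also have "\<dots> = of_nat (Suc n choose k) * c ^ (Suc n - k)"
  proof (cases k)
    case (Suc j)
    show ?thesis
    proof (cases "Suc j \<le> n")
      case True
      then have "n - j = Suc (n - Suc j)" by simp
      then show ?thesis by (simp add: Suc Suc.IH ring_distribs)
    next
      case False
      then show ?thesis by (simp add: Suc Suc.IH binomial_eq_0)
    qed
  qed (simp add: Suc.IH)
  finally show ?case .
next
  case 0
  show ?case by (cases k) simp_all
qed

lemma mat_fun_power: "mat_fun (\<lambda>z. z ^ n) M = mpow M n"
proof (induction n)
  case (Suc n)
  have "mat_fun (\<lambda>z. z) M ** mat_fun (\<lambda>z. z ^ n) M = mat_fun (\<lambda>z. z * z ^ n) M"
    by (intro mat_fun_mult analytic_intros)
  then show ?case by (simp add: Suc mat_fun_id)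
qed (simp add: mat_fun_const)

text \<open>On a generalised eigenvector each partial sum is a combination of the finitely many
  \<open>N^k v\<close>. The coefficient of \<open>N^k v\<close> converges to the sum over
  \<open>n\<close> of \<open>(n choose k) l^(n-k) / n!\<close>, which is
  \<open>exp l / k!\<close>.\<close>

lemma mexp_sums: "(\<lambda>n. (1 / fact n) *\<^sub>R mpow M n) sums mat_fun exp M"
proof (rule matrix_sums)
  fix v
  show "(\<lambda>n. ((1 / fact n) *\<^sub>R mpow M n) *v v) sums (mat_fun exp M *v v)"
  proof (induction v rule: gen_eigvecs_induct[where M = M])
    case (gen_eigvec l K v)
    let ?N = "M - mat l"
    let ?F = "fps_const l + fps_X"
    let ?c = "\<lambda>n k. fps_nth (?F ^ n) k / fact n"
    have "(\<lambda>n. ?c n k) sums (exp l / fact k)" for k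
    proof -
      have "(\<lambda>n. l ^ n /\<^sub>R fact n / fact k) sums (exp l / fact k)"
        by (intro sums_divide exp_converges)
      moreover have "?c (n + k) k = l ^ n /\<^sub>R fact n / fact k" for n
        unfolding fps_nth_shift_power by (simp add: binomial_fact scaleR_conv_of_real field_simps)
      ultimately have "(\<lambda>n. ?c (n + k) k) sums (exp l / fact k)"
        by simp
      moreover have "(\<Sum>i<k. ?c i k) = 0"
        unfolding fps_nth_shift_power by (intro sum.neutral) (simp add: binomial_eq_0)
      ultimately show ?thesis
        using sums_iff_shift[of "\<lambda>n. ?c n k" k "exp l / fact k"] by simp
    qed
    then have "(\<lambda>n. \<Sum>k<K. ?c n k *s (mpow ?N k *v v)) sums (\<Sum>k<K. (exp l / fact k) *s (mpow ?N k *v v))"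
      by (intro sums_sum bounded_linear.sums[OF bounded_linear_smult_left])
    moreover have "((1 / fact n) *\<^sub>R mpow M n) *v v = (\<Sum>k<K. ?c n k *s (mpow ?N k *v v))" for n
    proof -
      have "mpow M n *v v = fps_act (?F ^ n) ?N K v"
        unfolding mat_fun_power[symmetric]
        by (rule mat_fun_gen_eigvec'[OF _ gen_eigvec])
           (auto intro!: fps_expansion_intros analytic_intros)
      then show ?thesis
        by (simp add: scaleR_mult_vec fps_act_def scaleR_eq_vector_smult
            vec.scale_sum_right)
    qed
    moreover have "mat_fun exp M *v v = (\<Sum>k<K. (exp l / fact k) *s (mpow ?N k *v v))"
    proof -
      have "(\<lambda>h. exp l * exp (1 * h)) has_fps_expansion fps_const (exp l) * fps_exp 1"
        by (intro fps_expansion_intros)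
      then have "(\<lambda>h. exp (l + h)) has_fps_expansion fps_const (exp l) * fps_exp 1"
        by (simp add: exp_add)
      then have "mat_fun exp M *v v = fps_act (fps_const (exp l) * fps_exp 1) ?N K v"
        by (intro mat_fun_gen_eigvec'[OF _ gen_eigvec] analytic_intros)
      then show ?thesis by (simp add: fps_act_def)
    qed
    ultimately show ?case by simp
  next
    case (add v w)
    then show ?case by (simp add: matrix_vector_right_distrib sums_add)
  next
    case (smult c v)
    then show ?case
      unfolding mult_vec_smult by (rule bounded_linear.sums[OF bounded_linear_smult_right])
  qed simp
qed

lemma mexp_eq_mat_fun: "mexp M = mat_fun exp M"
  unfolding mexp_def by (rule sums_unique[symmetric, OF mexp_sums])

lemma powr_has_fps_expansion:
  assumes "x > (0::real)"
  shows "(\<lambda>h. complex_of_real x powr (l + h)) has_fps_expansion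
    fps_const (of_real x powr l) * fps_exp (of_real (ln x))"
proof -
  have "(\<lambda>h. complex_of_real x powr l * exp (of_real (ln x) * h)) has_fps_expansion
      fps_const (of_real x powr l) * fps_exp (of_real (ln x))"
    by (intro fps_expansion_intros)
  then show ?thesis
    using assms by (simp add: powr_def exp_add ring_distribs Ln_of_real mult.commute)
qed

lemma powr_analytic [analytic_intros]:
  assumes "x > (0::real)" "f analytic_on S"
  shows "(\<lambda>z. of_real x powr f z) analytic_on S"
  using assms unfolding powr_def by (auto intro!: analytic_intros)

text \<open>The logarithm scales eigenvalue and nilpotent part alike: \<open>v\<close> is a
  generalised eigenvector of \<open>ln x M\<close> for \<open>ln x m\<close>, with nilpotent part
  \<open>ln x N\<close>. The powers of \<open>ln x\<close> become the coefficients of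
  \<open>exp (h ln x)\<close>.\<close>

lemma powm_eq_mat_fun:
  assumes "x > 0"
  shows "powm x M = mat_fun (\<lambda>z. of_real x powr z) M"
proof (rule matrix_eq_gen_eigvecs[of M])
  fix m K v assume v: "gen_eigvec M m K v"
  define c where "c = complex_of_real (ln x)"
  have N: "ln x *\<^sub>R M - mat (c * m) = ln x *\<^sub>R (M - mat m)"
    by (simp add: vec_eq_iff mat_def c_def scaleR_conv_of_real[where 'a=complex] ring_distribs)
  have pow: "mpow (ln x *\<^sub>R (M - mat m)) k *v w = c ^ k *s (mpow (M - mat m) k *v w)" for k w
    by (induction k) (simp_all add: scalar_matrix_assoc[symmetric] matrix_vector_mul_assoc[symmetric]
         scaleR_mult_vec scaleR_eq_vector_smult c_def mult_vec_smult)
  have "gen_eigvec (ln x *\<^sub>R M) (c * m) K v"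
    using v unfolding gen_eigvec_def N pow by simp
  moreover have "(\<lambda>h. exp (c * m) * exp (1 * h)) has_fps_expansion fps_const (exp (c * m)) * fps_exp 1"
    by (intro fps_expansion_intros)
  then have "(\<lambda>h. exp (c * m + h)) has_fps_expansion fps_const (exp (c * m)) * fps_exp 1"
    by (simp add: exp_add)
  ultimately have "powm x M *v v
      = fps_act (fps_const (exp (c * m)) * fps_exp 1) (ln x *\<^sub>R (M - mat m)) K v"
    unfolding powm_def mexp_eq_mat_fun N[symmetric]
    by (intro mat_fun_gen_eigvec' analytic_intros)
  also have "\<dots> = fps_act (fps_const (of_real x powr m) * fps_exp c) (M - mat m) K v"
    unfolding fps_act_def pow using assms
    by (simp add: powr_def Ln_of_real c_def mult.commute)
  also have "\<dots> = mat_fun (\<lambda>z. of_real x powr z) M *v v"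
    unfolding c_def using assms
    by (intro mat_fun_gen_eigvec'[OF _ v, symmetric] powr_has_fps_expansion analytic_intros)
  finally show "powm x M *v v = mat_fun (\<lambda>z. of_real x powr z) M *v v" .
qed

lemma powm_shift:
  assumes "x > 0"
  shows "powm x (M + mat c) = mat_fun (\<lambda>z. of_real x powr (z + c)) M"
  using assms by (simp add: powm_eq_mat_fun mat_fun_shift)

lemma powm_gen_eigvec:
  assumes "x > 0" "gen_eigvec M l K v"
  shows "powm x M *v v
    = (\<Sum>k<K. (of_real x powr l * of_real (ln x) ^ k / fact k) *s (mpow (M - mat l) k *v v))"
proof -
  have "powm x M *v v = fps_act (fps_const (of_real x powr l) * fps_exp (of_real (ln x))) (M - mat l) K v"
    using assms unfolding powm_eq_mat_fun[OF assms(1)]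
    by (intro mat_fun_gen_eigvec' powr_has_fps_expansion analytic_intros)
  then show ?thesis by (simp add: fps_act_def)
qed

lemma has_vector_derivative_powr_complex:
  assumes "x > (0::real)"
  shows "((\<lambda>x. complex_of_real x powr l) has_vector_derivative l * of_real x powr (l - 1)) (at x)"
  using assms by (intro has_vector_derivative_real_field) (auto intro!: derivative_eq_intros)

text \<open>The derivative of \<open>x^l (ln x)^k / k!\<close> is the \<open>k\<close>-th
  coefficient of \<open>(l + X) x^(l-1) exp (X ln x)\<close>, the expansion of
  \<open>z x^(z-1)\<close> at \<open>l\<close>.\<close>

lemma powm_has_vector_derivative:
  assumes "x > 0"
  shows "((\<lambda>x. powm x M) has_vector_derivative M ** powm x (M - mat 1)) (at x)"
proof (rule matrix_has_vector_derivative)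
  fix v
  show "((\<lambda>x. powm x M *v v) has_vector_derivative (M ** powm x (M - mat 1)) *v v) (at x)"
  proof (induction v rule: gen_eigvecs_induct[where M = M])
    case (gen_eigvec l K v)
    let ?N = "M - mat l"
    let ?f = "\<lambda>k x. complex_of_real x powr l * of_real (ln x) ^ k / fact k"
    let ?G = "(fps_const l + fps_X) * (fps_const (of_real x powr (l - 1)) * fps_exp (of_real (ln x)))"
    have deriv: "(?f k has_vector_derivative fps_nth ?G k) (at x)" for k
    proof -
      have "((\<lambda>x. complex_of_real (ln x) ^ k / fact k) has_vector_derivative
          (if k = 0 then 0 else of_real (ln x) ^ (k - 1) / (fact (k - 1) * of_real x))) (at x)"
      proof (cases k)
        case (Suc j)
        have "((\<lambda>x. ln x ^ Suc j / fact (Suc j)) has_field_derivative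
            (1 + of_nat j) * (1 / x * ln x ^ j) / fact (Suc j)) (at x)"
          using assms by (intro DERIV_cdivide DERIV_power_Suc DERIV_ln_divide)
        also have "(1 + real j) * (1 / x * ln x ^ j) / fact (Suc j) = ln x ^ j / (fact j * x)"
        proof -
          have "1 + real j \<noteq> 0" by linarith
          moreover have "fact (Suc j) = (1 + real j) * fact j" by simp
          ultimately show ?thesis by (simp only: mult_divide_mult_cancel_left) simp
        qed
        finally have "((\<lambda>x. complex_of_real (ln x ^ Suc j / fact (Suc j))) has_vector_derivative
            of_real (ln x ^ j / (fact j * x))) (at x)"
          by (rule has_vector_derivative_of_real)
        then show ?thesis by (simp add: Suc)
      qed simp
      from has_vector_derivative_mult[OF has_vector_derivative_powr_complex[OF assms, of l] this]
      have "(?f k has_vector_derivative of_real x powr l *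
          (if k = 0 then 0 else of_real (ln x) ^ (k - 1) / (fact (k - 1) * of_real x))
          + l * of_real x powr (l - 1) * (of_real (ln x) ^ k / fact k)) (at x)"
        by simp
      moreover have "of_real x powr l = of_real x powr (l - 1) * of_real x"
        using assms by (simp add: powr_diff)
      ultimately show ?thesis
        unfolding fps_nth_linear_mult using assms by (cases k) (simp_all add: mult.assoc add.commute del: fact_Suc)
    qed
    have "((\<lambda>x. \<Sum>k<K. ?f k x *s (mpow ?N k *v v)) has_vector_derivative fps_act ?G ?N K v) (at x)"
      unfolding fps_act_def
      by (intro has_vector_derivative_sum
            bounded_linear.has_vector_derivative[OF bounded_linear_smult_left] deriv)
    then have "((\<lambda>x. powm x M *v v) has_vector_derivative fps_act ?G ?N K v) (at x)"
      by (rule has_vector_derivative_transform_within_open[of _ _ _ "{0<..}"])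
         (use assms gen_eigvec in \<open>auto simp: powm_gen_eigvec\<close>)
    moreover have "(M ** powm x (M - mat 1)) *v v = fps_act ?G ?N K v"
    proof -
      have M1: "M - mat 1 = M + mat (-1)"
        by (simp add: vec_eq_iff mat_def)
      have "M ** powm x (M - mat 1) = mat_fun (\<lambda>z. z * of_real x powr (z + -1)) M"
        unfolding M1 powm_shift[OF assms]
        by (subst mat_fun_mult[symmetric]) (use assms in \<open>auto intro!: analytic_intros simp: mat_fun_id\<close>)
      moreover have "\<dots> *v v = fps_act ?G ?N K v"
      proof (rule mat_fun_gen_eigvec'[OF _ gen_eigvec])
        have "(\<lambda>h. (l + h) * complex_of_real x powr (l - 1 + h)) has_fps_expansion ?G"
          by (intro fps_expansion_intros powr_has_fps_expansion assms)
        then show "(\<lambda>h. (l + h) * complex_of_real x powr (l + h + -1)) has_fps_expansion ?G"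
          by (simp add: algebra_simps)
      qed (use assms in \<open>intro analytic_intros\<close>)
      ultimately show ?thesis by simp
    qed
    ultimately show ?case by simp
  next
    case (add v w)
    then show ?case by (simp add: matrix_vector_right_distrib has_vector_derivative_add)
  next
    case (smult c v)
    then show ?case
      unfolding mult_vec_smult
      by (rule bounded_linear.has_vector_derivative[OF bounded_linear_smult_right])
  qed simp
qed

section \<open>The beta integral with logarithms\<close>

lemma power_le_exp_abs:
  assumes "r > (0::real)"
  shows "\<bar>y\<bar> ^ k \<le> fact k / r ^ k * exp (r * \<bar>y\<bar>)"
proof -
  have "(r * \<bar>y\<bar>) ^ k /\<^sub>R fact k \<le> exp (r * \<bar>y\<bar>)"
    unfolding exp_def using assms
    by (intro sum_le_suminf[of _ "{k}", simplified] summable_exp_generic) auto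
  then show ?thesis
    using assms by (simp add: field_simps)
qed

text \<open>The function \<open>norm g * exp (r |y|)\<close> dominates all partial sums of the
  series of \<open>g exp (h y)\<close> for \<open>norm h \<le> r\<close>, which allows the exchange
  of sum and integral; up to a constant it also bounds each single power of
  \<open>y\<close>.\<close>

lemma
  fixes g :: "'a \<Rightarrow> complex" and y :: "'a \<Rightarrow> real"
  assumes [measurable]: "g \<in> borel_measurable M" "y \<in> borel_measurable M"
    and r: "r > 0" and int: "integrable M (\<lambda>t. norm (g t) * exp (r * \<bar>y t\<bar>))"
  shows integrable_mult_power: "integrable M (\<lambda>t. g t * of_real (y t) ^ k)"
    and integral_exp_sums: "norm h \<le> r \<Longrightarrow>
      (\<lambda>k. (\<integral>t. g t * of_real (y t) ^ k \<partial>M) / fact k * h ^ k) sums (\<integral>t. g t * exp (h * of_real (y t)) \<partial>M)"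
proof -
  show pow: "integrable M (\<lambda>t. g t * of_real (y t) ^ k)" for k
  proof (rule Bochner_Integration.integrable_bound)
    show "integrable M (\<lambda>t. fact k / r ^ k * (norm (g t) * exp (r * \<bar>y t\<bar>)))"
      by (intro integrable_mult_right int)
    show "AE t in M. norm (g t * of_real (y t) ^ k)
        \<le> norm (fact k / r ^ k * (norm (g t) * exp (r * \<bar>y t\<bar>)))"
    proof (rule AE_I2)
      fix t
      have "norm (g t) * \<bar>y t\<bar> ^ k \<le> norm (g t) * (fact k / r ^ k * exp (r * \<bar>y t\<bar>))"
        using power_le_exp_abs[OF r] by (intro mult_left_mono) auto
      then show "norm (g t * of_real (y t) ^ k) \<le> norm (fact k / r ^ k * (norm (g t) * exp (r * \<bar>y t\<bar>)))"
        using r by (simp add: norm_mult norm_power mult_ac)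
    qed
  qed measurable
  assume h: "norm h \<le> r"
  let ?f = "\<lambda>k t. h ^ k / fact k * (g t * of_real (y t) ^ k)"
  have sums: "(\<lambda>k. ?f k t) sums (g t * exp (h * of_real (y t)))" for t
  proof -
    have "(\<lambda>k. g t * ((h * of_real (y t)) ^ k /\<^sub>R fact k)) sums (g t * exp (h * of_real (y t)))"
      by (intro sums_mult exp_converges)
    then show ?thesis
      by (simp add: scaleR_conv_of_real power_mult_distrib field_simps)
  qed
  have intf: "integrable M (?f k)" for k
    by (intro integrable_mult_right pow)
  have norm_sums: "(\<lambda>k. norm (?f k t)) sums (norm (g t) * exp (norm h * \<bar>y t\<bar>))" for t
  proof -
    have "(\<lambda>k. norm (g t) * ((norm h * \<bar>y t\<bar>) ^ k /\<^sub>R fact k)) sums (norm (g t) * exp (norm h * \<bar>y t\<bar>))"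
      by (intro sums_mult exp_converges)
    then show ?thesis
      by (simp add: norm_mult norm_divide norm_power power_mult_distrib field_simps)
  qed
  have "(\<lambda>k. integral\<^sup>L M (?f k)) sums (\<integral>t. (\<Sum>k. ?f k t) \<partial>M)"
  proof (rule sums_integral[OF intf])
    show "AE t in M. summable (\<lambda>k. norm (?f k t))"
      using norm_sums by (intro AE_I2) (rule sums_summable)
    show "summable (\<lambda>k. \<integral>t. norm (?f k t) \<partial>M)"
    proof (rule summableI_nonneg_bounded)
      fix n
      have "(\<Sum>k<n. \<integral>t. norm (?f k t) \<partial>M) = (\<integral>t. (\<Sum>k<n. norm (?f k t)) \<partial>M)"
        by (intro Bochner_Integration.integral_sum[symmetric] integrable_norm intf)
      also have "\<dots> \<le> (\<integral>t. norm (g t) * exp (r * \<bar>y t\<bar>) \<partial>M)"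
      proof (rule integral_mono[OF _ int])
        show "integrable M (\<lambda>t. \<Sum>k<n. norm (?f k t))"
          by (intro Bochner_Integration.integrable_sum integrable_norm intf)
        fix t
        have "(\<Sum>k<n. norm (?f k t)) \<le> norm (g t) * exp (norm h * \<bar>y t\<bar>)"
          using norm_sums[of t] sum_le_suminf[OF sums_summable[OF norm_sums], of "{..<n}" t]
          by (simp add: sums_iff)
        also have "\<dots> \<le> norm (g t) * exp (r * \<bar>y t\<bar>)"
          using h by (intro mult_left_mono) (auto intro: mult_right_mono)
        finally show "(\<Sum>k<n. norm (?f k t)) \<le> norm (g t) * exp (r * \<bar>y t\<bar>)" .
      qed
      finally show "(\<Sum>k<n. \<integral>t. norm (?f k t) \<partial>M) \<le> (\<integral>t. norm (g t) * exp (r * \<bar>y t\<bar>) \<partial>M)" .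
    qed (simp add: integral_nonneg_AE)
  qed
  moreover have "(\<Sum>k. ?f k t) = g t * exp (h * of_real (y t))" for t
    using sums by (rule sums_unique[symmetric])
  ultimately show "(\<lambda>k. (\<integral>t. g t * of_real (y t) ^ k \<partial>M) / fact k * h ^ k) sums
      (\<integral>t. g t * exp (h * of_real (y t)) \<partial>M)"
    using pow by (simp add: mult.commute)
qed

lemma integral_exp_has_fps_expansion:
  fixes g :: "'a \<Rightarrow> complex" and y :: "'a \<Rightarrow> real"
  assumes "g \<in> borel_measurable M" "y \<in> borel_measurable M" "r > 0"
    "integrable M (\<lambda>t. norm (g t) * exp (r * \<bar>y t\<bar>))"
  shows "(\<lambda>h. \<integral>t. g t * exp (h * of_real (y t)) \<partial>M) has_fps_expansion
    Abs_fps (\<lambda>k. (\<integral>t. g t * of_real (y t) ^ k \<partial>M) / fact k)"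
proof (rule has_fps_expansionI)
  have "\<forall>\<^sub>F h in nhds 0. h \<in> ball 0 r"
    using assms(3) by (intro eventually_nhds_in_open) auto
  then show "\<forall>\<^sub>F h in nhds 0.
      (\<lambda>k. fps_nth (Abs_fps (\<lambda>k. (\<integral>t. g t * of_real (y t) ^ k \<partial>M) / fact k)) k * h ^ k) sums
      (\<integral>t. g t * exp (h * of_real (y t)) \<partial>M)"
  proof eventually_elim
    case (elim h)
    then show ?case using integral_exp_sums[OF assms, of h] by simp
  qed
qed

lemma measurable_powr_of_real [measurable]:
  fixes f :: "'a \<Rightarrow> real"
  assumes [measurable]: "f \<in> borel_measurable M"
  shows "(\<lambda>t. complex_of_real (f t) powr z) \<in> borel_measurable M"
proof -
  \<comment> \<open>Written out by cases, so that only visibly measurable functions remain; the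
    logarithm of a negative real has imaginary part \<open>pi\<close>.\<close>
  have "(\<lambda>t. complex_of_real (f t) powr z) = (\<lambda>t. if f t = 0 then 0 else
      exp (z * (of_real (ln \<bar>f t\<bar>) + (if f t < 0 then pi else 0) * \<i>)))"
    by (auto simp: powr_def Ln_of_real')
  then show ?thesis by simp
qed

lemma holomorphic_eq_right_half_plane:
  assumes "f holomorphic_on {z. Re z > 0}" "g holomorphic_on {z. Re z > 0}"
    "\<And>x::real. x > 0 \<Longrightarrow> f (of_real x) = g (of_real x)" "Re z > 0"
  shows "f z = g z"
proof -
  have "f z - g z = 0"
  proof (rule analytic_continuation[of "\<lambda>z. f z - g z" "{z. Re z > 0}" "of_real ` {0<..}" 1])
    show "open {z. Re z > 0}" by (rule open_halfspace_Re_gt)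
    show "connected {z. Re z > 0}"
      by (intro convex_connected convex_halfspace_Re_gt)
    show "(1::complex) islimpt of_real ` {0<..}"
    proof (rule islimptI)
      fix T :: "complex set" assume "1 \<in> T" "open T"
      then obtain e where e: "e > 0" "ball 1 e \<subseteq> T"
        by (meson openE)
      then have "complex_of_real (1 + e / 2) \<in> T"
        by (auto simp: dist_norm subset_iff)
      then show "\<exists>y\<in>of_real ` {0<..}. y \<in> T \<and> y \<noteq> (1 :: complex)"
        using e(1) by (intro bexI[of _ "of_real (1 + e / 2)"]) (auto simp del: of_real_add)
    qed
  qed (use assms in \<open>auto intro!: holomorphic_intros\<close>)
  then show ?thesis by simp
qed

text \<open>The interval is built into the measure so that general lemmas on Bochner integrals apply
  directly.\<close>

abbreviation ivl :: "real \<Rightarrow> real measure" where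
  "ivl x \<equiv> restrict_space lborel {0<..<x}"

lemma ivl_AE: "AE t in ivl x. 0 < t \<and> t < x"
  by (rule AE_I2) (simp add: space_restrict_space)

lemma integrable_ivl: "integrable (ivl x) f \<longleftrightarrow> set_integrable lborel {0<..<x} f"
  for f :: "real \<Rightarrow> 'a::{banach,second_countable_topology}"
  by (simp add: integrable_restrict_space set_integrable_def)

lemma integral_ivl: "integral\<^sup>L (ivl x) f = set_lebesgue_integral lborel {0<..<x} f"
  for f :: "real \<Rightarrow> 'a::{banach,second_countable_topology}"
  by (simp add: integral_restrict_space set_lebesgue_integral_def)

lemma integrable_Beta_ivl:
  assumes "a > 0" "b > 0"
  shows "integrable (ivl 1) (\<lambda>t. (1 - t) powr (a - 1) * t powr (b - 1) :: real)"
  unfolding integrable_ivl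
  by (rule set_integrable_subset[OF integrable_Beta[of b a, unfolded mult.commute[of "_ powr (b - 1)"]]])
     (use assms in auto)

lemma norm_powr_of_real: "t > 0 \<Longrightarrow> norm (complex_of_real t powr z) = t powr Re z"
  by (simp add: norm_powr_real_powr)

lemma integrable_Beta_complex:
  assumes "Re a > 0" "Re b > 0"
  shows "integrable (ivl 1) (\<lambda>t. complex_of_real (1 - t) powr (a - 1) * of_real t powr (b - 1))"
proof (rule Bochner_Integration.integrable_bound[OF integrable_Beta_ivl])
  show "(\<lambda>t. complex_of_real (1 - t) powr (a - 1) * of_real t powr (b - 1)) \<in> borel_measurable (ivl 1)"
    by (rule measurable_restrict_space1) measurable
  show "AE t in ivl 1. norm (complex_of_real (1 - t) powr (a - 1) * of_real t powr (b - 1))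
      \<le> norm ((1 - t) powr (Re a - 1) * t powr (Re b - 1))"
    using ivl_AE
  proof eventually_elim
    case (elim t)
    then show ?case
      using norm_powr_of_real[of "1 - t" "a - 1"] norm_powr_of_real[of t "b - 1"]
      by (simp add: norm_mult)
  qed
qed (use assms in auto)

lemma exp_abs_ln:
  assumes "0 < t" "t \<le> (1::real)"
  shows "exp (r * \<bar>ln t\<bar>) = t powr - r"
  using assms by (simp add: powr_def)

lemma powr_add_eq_exp:
  assumes "t > (0::real)"
  shows "complex_of_real t powr (z + h) = of_real t powr z * exp (h * of_real (ln t))"
  using assms by (simp add: powr_def exp_add ring_distribs Ln_of_real)

lemma Beta_integral_analytic1:
  assumes "Re a > 0" "Re b > 0"
  shows "(\<lambda>b. \<integral>t. complex_of_real (1 - t) powr (a - 1) * of_real t powr (b - 1) \<partial>ivl 1) analytic_on {b}"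
    (is "?J analytic_on _")
proof -
  let ?g = "\<lambda>t. complex_of_real (1 - t) powr (a - 1) * of_real t powr (b - 1)"
  \<comment> \<open>On \<open>(0, 1)\<close> the factor \<open>exp (r |ln t|)\<close> is
    \<open>t^-r\<close>; half of \<open>Re b\<close> leaves the exponent
    \<open>Re b / 2 - 1\<close>, which is still integrable at 0.\<close>
  define r where "r = Re b / 2"
  have "integrable (ivl 1) (\<lambda>t. norm (?g t) * exp (r * \<bar>ln t\<bar>))"
  proof (rule Bochner_Integration.integrable_bound[OF integrable_Beta_ivl])
    show "AE t in ivl 1. norm (norm (?g t) * exp (r * \<bar>ln t\<bar>)) \<le> norm ((1 - t) powr (Re a - 1) * t powr (r - 1))"
      using ivl_AE
    proof eventually_elim
      case (elim t)
      have "exp (r * \<bar>ln t\<bar>) = t powr - r"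
        using elim by (intro exp_abs_ln) auto
      moreover have "t powr (Re b - 1) * t powr - r = t powr (r - 1)"
        by (simp add: powr_add[symmetric] r_def)
      moreover have "norm (?g t) = (1 - t) powr (Re a - 1) * t powr (Re b - 1)"
        using elim norm_powr_of_real[of "1 - t" "a - 1"] norm_powr_of_real[of t "b - 1"]
        by (simp add: norm_mult)
      ultimately have "norm (?g t) * exp (r * \<bar>ln t\<bar>) = (1 - t) powr (Re a - 1) * t powr (r - 1)"
        by (simp only: mult.assoc)
      then show ?case by simp
    qed
  qed (use assms in \<open>auto simp: r_def intro!: measurable_restrict_space1\<close>)
  then have "(\<lambda>h. \<integral>t. ?g t * exp (h * of_real (ln t)) \<partial>ivl 1) has_fps_expansion
      Abs_fps (\<lambda>k. (\<integral>t. ?g t * of_real (ln t) ^ k \<partial>ivl 1) / fact k)"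
    by (intro integral_exp_has_fps_expansion[of ?g "ivl 1" ln r] measurable_restrict_space1)
       (use assms in \<open>auto simp: r_def\<close>)
  also have "(\<lambda>h. \<integral>t. ?g t * exp (h * of_real (ln t)) \<partial>ivl 1) = (\<lambda>h. ?J (b + h))"
  proof
    fix h
    show "(\<integral>t. ?g t * exp (h * of_real (ln t)) \<partial>ivl 1) = ?J (b + h)"
    proof (rule Bochner_Integration.integral_cong[OF refl])
      fix t assume "t \<in> space (ivl 1)"
      then show "?g t * exp (h * of_real (ln t))
          = complex_of_real (1 - t) powr (a - 1) * of_real t powr (b + h - 1)"
        using powr_add_eq_exp[of t "b - 1" h] by (simp add: space_restrict_space algebra_simps)
    qed
  qed
  finally show ?thesis
    by (rule has_fps_expansion_imp_analytic)
qed

lemma Beta_integral_symmetric: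
  "(\<integral>t. complex_of_real (1 - t) powr (a - 1) * of_real t powr (b - 1) \<partial>ivl 1)
    = (\<integral>t. complex_of_real (1 - t) powr (b - 1) * of_real t powr (a - 1) \<partial>ivl 1)"
proof -
  have "(indicator {0<..<1} (1 + - 1 * t) :: real) = indicator {0<..<1} t" for t :: real
    by (auto simp: indicator_def)
  then show ?thesis
    unfolding integral_ivl set_lebesgue_integral_def
    by (subst lborel_integral_real_affine[of "-1" _ 1]) (simp_all add: mult.commute)
qed

text \<open>Analytic continuation from the real beta integral, one parameter at a time: analyticity
  is shown in the second parameter only, and the reflection \<open>t = 1 - u\<close> exchanges the
  two.\<close>

lemma Beta_integral_complex:
  assumes "Re a > 0" "Re b > 0"
  shows "(\<integral>t. complex_of_real (1 - t) powr (a - 1) * of_real t powr (b - 1) \<partial>ivl 1) = Beta a b"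
proof -
  let ?J = "\<lambda>a b. \<integral>t. complex_of_real (1 - t) powr (a - 1) * of_real t powr (b - 1) \<partial>ivl 1"
  have nonpos: "z \<notin> \<int>\<^sub>\<le>\<^sub>0" if "Re z > 0" for z :: complex
    using that by (auto elim!: nonpos_Ints_cases)
  have hol: "?J a holomorphic_on {b. Re b > 0}" "Beta a holomorphic_on {b. Re b > 0}" if "Re a > 0" for a
  proof -
    have "?J a analytic_on {b. Re b > 0}"
      using Beta_integral_analytic1[OF that] by (subst analytic_on_analytic_at) auto
    then show "?J a holomorphic_on {b. Re b > 0}" by (rule analytic_imp_holomorphic)
    show "Beta a holomorphic_on {b. Re b > 0}"
      by (intro holomorphic_intros) (use nonpos that in auto)
  qed
  have real: "?J (of_real a) (of_real b) = Beta (of_real a) (of_real b)" if "a > 0" "b > 0" for a b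
  proof -
    have "?J (of_real a) (of_real b) = (\<integral>t. complex_of_real ((1 - t) powr (a - 1) * t powr (b - 1)) \<partial>ivl 1)"
    proof (rule Bochner_Integration.integral_cong[OF refl])
      fix t assume "t \<in> space (ivl 1)"
      then have "0 < t" "t < 1" by (auto simp: space_restrict_space)
      then show "complex_of_real (1 - t) powr (of_real a - 1) * of_real t powr (of_real b - 1)
          = complex_of_real ((1 - t) powr (a - 1) * t powr (b - 1))"
        using powr_of_real[of "1 - t" "a - 1"] powr_of_real[of t "b - 1"] by simp
    qed
    also have "\<dots> = complex_of_real (\<integral>t. (1 - t) powr (a - 1) * t powr (b - 1) \<partial>ivl 1)"
      by (rule integral_complex_of_real)
    also have "(\<integral>t. (1 - t) powr (a - 1) * t powr (b - 1) \<partial>ivl 1) = Beta a b"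
    proof -
      have "((\<lambda>t. (1 - t) powr (a - 1) * t powr (b - 1)) has_integral Beta b a) {0<..<1}"
        using has_integral_Beta_real[OF that(2,1)]
        by (simp add: has_integral_Icc_iff_Ioo mult.commute)
      moreover have "((\<lambda>t. (1 - t) powr (a - 1) * t powr (b - 1)) has_integral
          (\<integral>t. (1 - t) powr (a - 1) * t powr (b - 1) \<partial>ivl 1)) {0<..<1}"
        unfolding integral_ivl
        using set_borel_integral_eq_integral[OF integrable_Beta_ivl[OF that, unfolded integrable_ivl]]
        by (simp add: has_integral_iff)
      ultimately have "Beta b a = (\<integral>t. (1 - t) powr (a - 1) * t powr (b - 1) \<partial>ivl 1)"
        by (rule has_integral_unique)
      then show ?thesis by (simp add: Beta_commute[of a])
    qed
    finally show ?thesis by (simp add: Beta_complex_of_real)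
  qed
  have 1: "?J (of_real a) b = Beta (of_real a) b" if "a > 0" "Re b > 0" for a b
    by (rule holomorphic_eq_right_half_plane[of "?J (of_real a)" "Beta (of_real a)"])
       (use hol that real in auto)
  have 2: "?J b a = Beta b a"
  proof (rule holomorphic_eq_right_half_plane[of "?J b" "Beta b"])
    fix x :: real assume "x > 0"
    then show "?J b (of_real x) = Beta b (of_real x)"
      using 1[of x b] assms Beta_integral_symmetric[of "of_real x" b] Beta_commute[of b] by simp
  qed (use hol assms in auto)
  then show ?thesis
    using Beta_integral_symmetric[of a b] Beta_commute[of b a] by simp
qed

text \<open>The substitution \<open>t = x u\<close> reduces both claims to the unit interval. The
  two powers contribute the exponent \<open>\<nu> + s - 2\<close> of \<open>x\<close>, and the
  Jacobian supplies one more.\<close>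

lemma
  assumes "x > 0" "Re \<nu> > 0" "Re s > 0"
  shows RL_powr_integrable:
      "integrable (ivl x) (\<lambda>t. complex_of_real (x - t) powr (\<nu> - 1) * of_real t powr (s - 1))"
    and RL_powr_integral:
      "(\<integral>t. complex_of_real (x - t) powr (\<nu> - 1) * of_real t powr (s - 1) \<partial>ivl x)
        = of_real x powr (\<nu> + s - 1) * Beta \<nu> s"
proof -
  let ?f = "\<lambda>x t. indicator {0<..<x} t *\<^sub>R
    (complex_of_real (x - t) powr (\<nu> - 1) * of_real t powr (s - 1))"
  have scale: "?f x (0 + x * t) = of_real x powr (\<nu> + s - 2) * ?f 1 t" for t
  proof (cases "t \<in> {0<..<1}")
    case True
    have "complex_of_real (x - x * t) powr (\<nu> - 1) = of_real x powr (\<nu> - 1) * of_real (1 - t) powr (\<nu> - 1)"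
      using powr_times_real[of "of_real x" "of_real (1 - t)" "\<nu> - 1"] True assms(1)
      by (simp add: ring_distribs)
    moreover have "complex_of_real (x * t) powr (s - 1) = of_real x powr (s - 1) * of_real t powr (s - 1)"
      using powr_times_real[of "of_real x" "of_real t" "s - 1"] True assms(1) by simp
    moreover have "complex_of_real x powr (\<nu> - 1) * of_real x powr (s - 1) = of_real x powr (\<nu> + s - 2)"
      by (simp add: powr_add[symmetric] algebra_simps)
    ultimately show ?thesis
      using True assms(1) by (simp add: algebra_simps)
  next
    case False
    then have "x * t \<notin> {0<..<x}" using assms(1) by (auto simp: zero_less_mult_iff)
    with False show ?thesis by simp
  qed
  have f1: "integrable lborel (?f 1)"
    using integrable_Beta_complex[OF assms(2,3)] by (simp add: integrable_ivl set_integrable_def)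
  then have "integrable lborel (\<lambda>t. ?f x (0 + x * t))"
    unfolding scale by (rule integrable_mult_right)
  then have "integrable lborel (?f x)"
    by (subst (asm) lborel_integrable_real_affine_iff) (use assms(1) in auto)
  then show "integrable (ivl x) (\<lambda>t. complex_of_real (x - t) powr (\<nu> - 1) * of_real t powr (s - 1))"
    by (simp add: integrable_ivl set_integrable_def)
  have "(\<integral>t. ?f x t \<partial>lborel) = \<bar>x\<bar> *\<^sub>R (\<integral>t. ?f x (0 + x * t) \<partial>lborel)"
    by (rule lborel_integral_real_affine) (use assms(1) in auto)
  also have "\<dots> = of_real x * (of_real x powr (\<nu> + s - 2) * (\<integral>t. ?f 1 t \<partial>lborel))"
    unfolding scale using assms(1) by (simp add: scaleR_conv_of_real)
  also have "(\<integral>t. ?f 1 t \<partial>lborel) = Beta \<nu> s"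
    using Beta_integral_complex[OF assms(2,3)] by (simp add: integral_ivl set_lebesgue_integral_def)
  also have "of_real x * (of_real x powr (\<nu> + s - 2) * Beta \<nu> s) = of_real x powr (\<nu> + s - 1) * Beta \<nu> s"
    using assms(1) powr_add[of "of_real x" 1 "\<nu> + s - 2"] by (simp add: algebra_simps)
  finally show "(\<integral>t. complex_of_real (x - t) powr (\<nu> - 1) * of_real t powr (s - 1) \<partial>ivl x)
        = of_real x powr (\<nu> + s - 1) * Beta \<nu> s"
    by (simp add: integral_ivl set_lebesgue_integral_def)
qed

lemma
  assumes "x > 0" "Re \<nu> > 0" "Re s > 0"
  shows RL_powr_ln_integrable:
      "integrable (ivl x) (\<lambda>t. complex_of_real (x - t) powr (\<nu> - 1) * of_real t powr (s - 1) * of_real (ln t) ^ k)"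
    and RL_powr_ln_integral:
      "(\<lambda>h. of_real x powr (\<nu> + (s + h) - 1) * Beta \<nu> (s + h)) has_fps_expansion
        Abs_fps (\<lambda>k. (\<integral>t. complex_of_real (x - t) powr (\<nu> - 1) * of_real t powr (s - 1)
          * of_real (ln t) ^ k \<partial>ivl x) / fact k)"
proof -
  let ?g = "\<lambda>s t. complex_of_real (x - t) powr (\<nu> - 1) * of_real t powr (s - 1)"
  define r where "r = Re s / 2"
  have r: "r > 0" using assms by (simp add: r_def)
  have int: "integrable (ivl x) (\<lambda>t. norm (?g s t) * exp (r * \<bar>ln t\<bar>))"
  proof (rule Bochner_Integration.integrable_bound)
    \<comment> \<open>Since \<open>x\<close> may exceed 1, \<open>ln t\<close> has no fixed sign.
      The bound \<open>exp (r |ln t|) \<le> t^r + t^-r\<close> shifts \<open>s\<close> by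
      \<open>r\<close> in both directions, and with \<open>r = Re s / 2\<close> both shifts stay in
      the right half-plane.\<close>
    show "integrable (ivl x) (\<lambda>t. norm (?g (s + of_real r) t) + norm (?g (s - of_real r) t))"
      by (intro Bochner_Integration.integrable_add integrable_norm RL_powr_integrable)
         (use assms in \<open>auto simp: r_def\<close>)
    show "AE t in ivl x. norm (norm (?g s t) * exp (r * \<bar>ln t\<bar>))
        \<le> norm (norm (?g (s + of_real r) t) + norm (?g (s - of_real r) t))"
      using ivl_AE
    proof eventually_elim
      case (elim t)
      have "exp (r * \<bar>ln t\<bar>) \<le> t powr r + t powr - r"
        using elim by (auto simp: powr_def abs_if)
      then have "norm (?g s t) * exp (r * \<bar>ln t\<bar>) \<le> norm (?g s t) * (t powr r + t powr - r)"
        by (rule mult_left_mono) simp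
      also have "\<dots> = norm (?g (s + of_real r) t) + norm (?g (s - of_real r) t)"
      proof -
        have "t powr (Re s - 1) * t powr r = t powr (Re s + r - 1)"
          "t powr (Re s - 1) * t powr - r = t powr (Re s - r - 1)"
          by (simp_all add: powr_add[symmetric] algebra_simps)
        then show ?thesis
          using elim by (simp add: norm_mult norm_powr_of_real ring_distribs mult.assoc)
      qed
      finally show ?case by simp
    qed
  qed (use r in \<open>auto intro!: measurable_restrict_space1\<close>)
  have [measurable]: "?g s \<in> borel_measurable (ivl x)" "ln \<in> borel_measurable (ivl x)"
    by (rule measurable_restrict_space1, measurable)+
  show "integrable (ivl x) (\<lambda>t. ?g s t * of_real (ln t) ^ k)"
    by (rule integrable_mult_power[OF _ _ r int]) measurable
  have "(\<lambda>h. \<integral>t. ?g s t * exp (h * of_real (ln t)) \<partial>ivl x) has_fps_expansion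
      Abs_fps (\<lambda>k. (\<integral>t. ?g s t * of_real (ln t) ^ k \<partial>ivl x) / fact k)" (is "_ has_fps_expansion ?F")
    by (rule integral_exp_has_fps_expansion[OF _ _ r int]) measurable
  moreover have "\<forall>\<^sub>F h in nhds 0. (\<integral>t. ?g s t * exp (h * of_real (ln t)) \<partial>ivl x)
      = of_real x powr (\<nu> + (s + h) - 1) * Beta \<nu> (s + h)"
  proof -
    have "\<forall>\<^sub>F h in nhds 0. h \<in> ball 0 (Re s)"
      using assms by (intro eventually_nhds_in_open) auto
    then show ?thesis
    proof eventually_elim
      case (elim h)
      have "\<bar>Re h\<bar> \<le> norm h" by (rule abs_Re_le_cmod)
      then have h: "Re (s + h) > 0" using elim by auto
      have "(\<integral>t. ?g s t * exp (h * of_real (ln t)) \<partial>ivl x) = (\<integral>t. ?g (s + h) t \<partial>ivl x)"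
      proof (rule Bochner_Integration.integral_cong[OF refl])
        fix t assume "t \<in> space (ivl x)"
        then show "?g s t * exp (h * of_real (ln t)) = ?g (s + h) t"
          using powr_add_eq_exp[of t "s - 1" h] by (simp add: space_restrict_space algebra_simps)
      qed
      then show ?case using RL_powr_integral[OF assms(1,2) h] by simp
    qed
  qed
  ultimately show "(\<lambda>h. of_real x powr (\<nu> + (s + h) - 1) * Beta \<nu> (s + h)) has_fps_expansion ?F"
    by (subst (asm) has_fps_expansion_cong) auto
qed

section \<open>Coefficients at non-integrable powers\<close>

lemma gen_eigvec_shift: "gen_eigvec (M + mat c) (l + c) K v \<longleftrightarrow> gen_eigvec M l K v"
  and shift_nilpotent: "M + mat c - mat (l + c) = M - mat l"
proof -
  show "M + mat c - mat (l + c) = M - mat l"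
    by (simp add: vec_eq_iff mat_def)
  then show "gen_eigvec (M + mat c) (l + c) K v \<longleftrightarrow> gen_eigvec M l K v"
    unfolding gen_eigvec_def by (simp only:)
qed

lemma invertible_uminus: "invertible A \<Longrightarrow> invertible (- A)" for A :: "complex^'n^'n"
  unfolding invertible_right_inverse by (metis mm.minus_left mm.minus_right minus_minus)

lemma invertible_uminus_iff: "invertible (- A) \<longleftrightarrow> invertible A" for A :: "complex^'n^'n"
  using invertible_uminus[of A] invertible_uminus[of "- A"] by auto

lemma not_spectrum_iff: "- c \<notin> spectrum M \<longleftrightarrow> invertible (M + mat c)"
  for M :: "complex^'r^'r"
proof -
  have "mat (- c) - M = - (M + mat c)"
    by (simp add: vec_eq_iff mat_def)
  then show ?thesis
    unfolding spectrum_def mem_Collect_eq not_not by (simp only: invertible_uminus_iff)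
qed

lemma spectrum_nonpos_Ints:
  fixes M :: "complex^'r^'r"
  assumes "\<And>k::nat. invertible (M + mat (of_nat k))"
  shows "spectrum M \<inter> \<int>\<^sub>\<le>\<^sub>0 = {}"
  using assms not_spectrum_iff[of "of_nat _" M] by (auto elim!: nonpos_Ints_cases')

text \<open>By \<open>RL_powr_ln_integral\<close> the integrals with powers of \<open>ln t\<close>
  give the Taylor coefficients at \<open>l\<close> of the scalar result. Convergence is a matter of
  \<open>Re l > 0\<close>; the spectrum must avoid the poles of \<open>Beta \<nu>\<close> because
  \<open>mat_fun\<close> looks at every eigenvalue.\<close>

lemma
  fixes M :: "complex^'r^'r"
  assumes x: "x > 0" and nu: "Re \<nu> > 0" and spec: "spectrum M \<inter> \<int>\<^sub>\<le>\<^sub>0 = {}"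
    and v: "gen_eigvec M l K v" and l: "Re l > 0"
  shows RL_powm_integrable:
      "integrable (ivl x) (\<lambda>t. of_real (x - t) powr (\<nu> - 1) *s (powm t (M - mat 1) *v v))"
    and RL_powm_integral:
      "(\<integral>t. of_real (x - t) powr (\<nu> - 1) *s (powm t (M - mat 1) *v v) \<partial>ivl x)
        = mat_fun (\<lambda>z. of_real x powr (\<nu> + z - 1) * Beta \<nu> z) M *v v"
proof -
  let ?N = "M - mat l"
  let ?a = "\<lambda>k t. complex_of_real (x - t) powr (\<nu> - 1) * of_real t powr (l - 1) * of_real (ln t) ^ k"
  let ?S = "\<lambda>t. \<Sum>k<K. (?a k t / fact k) *s (mpow ?N k *v v)"
  have eq: "of_real (x - t) powr (\<nu> - 1) *s (powm t (M - mat 1) *v v) = ?S t" if "t \<in> space (ivl x)" for t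
  proof -
    have M1: "M - mat 1 = M + mat (-1)" by (simp add: vec_eq_iff mat_def)
    have "powm t (M + mat (-1)) *v v = (\<Sum>k<K. (of_real t powr (l + -1) * of_real (ln t) ^ k / fact k) *s
        (mpow (M + mat (-1) - mat (l + -1)) k *v v))"
      using that v by (intro powm_gen_eigvec) (auto simp: space_restrict_space gen_eigvec_shift simp del: add_uminus_conv_diff)
    then show ?thesis
      unfolding M1 shift_nilpotent by (simp add: vec.scale_sum_right mult.assoc)
  qed
  have int: "integrable (ivl x) (\<lambda>t. (?a k t / fact k) *s (mpow ?N k *v v))" for k
    by (intro integrable_bounded_linear[OF bounded_linear_smult_left] Bochner_Integration.integrable_divide
          RL_powr_ln_integrable x nu l)
  then have "integrable (ivl x) ?S"
    by (intro Bochner_Integration.integrable_sum)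
  then show "integrable (ivl x) (\<lambda>t. of_real (x - t) powr (\<nu> - 1) *s (powm t (M - mat 1) *v v))"
    using eq by (subst Bochner_Integration.integrable_cong[OF refl]) auto
  have "(\<integral>t. of_real (x - t) powr (\<nu> - 1) *s (powm t (M - mat 1) *v v) \<partial>ivl x) = integral\<^sup>L (ivl x) ?S"
    using eq by (rule Bochner_Integration.integral_cong[OF refl])
  also have "\<dots> = (\<Sum>k<K. \<integral>t. (?a k t / fact k) *s (mpow ?N k *v v) \<partial>ivl x)"
    by (intro Bochner_Integration.integral_sum int)
  also have "\<dots> = (\<Sum>k<K. ((\<integral>t. ?a k t \<partial>ivl x) / fact k) *s (mpow ?N k *v v))"
  proof (intro sum.cong refl)
    fix k
    have "(\<integral>t. (?a k t / fact k) *s (mpow ?N k *v v) \<partial>ivl x)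
        = (\<integral>t. ?a k t / fact k \<partial>ivl x) *s (mpow ?N k *v v)"
      by (intro integral_bounded_linear[OF bounded_linear_smult_left] Bochner_Integration.integrable_divide
          RL_powr_ln_integrable x nu l)
    then show "(\<integral>t. (?a k t / fact k) *s (mpow ?N k *v v) \<partial>ivl x)
        = ((\<integral>t. ?a k t \<partial>ivl x) / fact k) *s (mpow ?N k *v v)"
      by simp
  qed
  also have "\<dots> = fps_act (Abs_fps (\<lambda>k. (\<integral>t. ?a k t \<partial>ivl x) / fact k)) ?N K v"
    by (simp add: fps_act_def)
  also have "\<dots> = mat_fun (\<lambda>z. of_real x powr (\<nu> + z - 1) * Beta \<nu> z) M *v v"
  proof (rule mat_fun_gen_eigvec'[OF _ v, symmetric])
    have "\<nu> \<notin> \<int>\<^sub>\<le>\<^sub>0" using nu by (auto elim!: nonpos_Ints_cases)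
    then show "(\<lambda>z. of_real x powr (\<nu> + z - 1) * Beta \<nu> z) analytic_on spectrum M"
      using x spec by (intro analytic_intros) auto
  qed (rule RL_powr_ln_integral[OF x nu l])
  finally show "(\<integral>t. of_real (x - t) powr (\<nu> - 1) *s (powm t (M - mat 1) *v v) \<partial>ivl x)
      = mat_fun (\<lambda>z. of_real x powr (\<nu> + z - 1) * Beta \<nu> z) M *v v" .
qed

section \<open>Leading terms of power series at 0 and the divergence of the integral of
  \<open>1 / t\<close>\<close>

lemma powser_coeff_bound:
  fixes a :: "nat \<Rightarrow> 'a::real_normed_vector"
  assumes "summable (\<lambda>n. x ^ n *\<^sub>R a n)" "x > 0"
  obtains B where "B > 0" "\<And>n. norm (a n) \<le> B / x ^ n"
proof -
  obtain B where B: "B > 0" "\<And>n. norm (x ^ n *\<^sub>R a n) \<le> B"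
    using summable_imp_Bseq[OF assms(1)] by (auto simp: Bseq_def)
  then have "norm (a n) \<le> B / x ^ n" for n
    using B(2)[of n] assms(2) by (simp add: field_simps)
  with B(1) show ?thesis by (rule that)
qed

lemma powser_abs_summable:
  fixes a :: "nat \<Rightarrow> 'a::real_normed_vector"
  assumes "summable (\<lambda>n. y ^ n *\<^sub>R a n)" "0 \<le> x" "x < y"
  shows "summable (\<lambda>n. norm (a n) * x ^ n)"
proof -
  obtain B where B: "B > 0" "\<And>n. norm (a n) \<le> B / y ^ n"
    using powser_coeff_bound assms by (metis le_less_trans)
  show ?thesis
  proof (rule summable_comparison_test')
    show "summable (\<lambda>n. B * (x / y) ^ n)"
      using assms by (intro summable_mult summable_geometric) auto
    fix n
    have "norm (a n) * x ^ n \<le> B / y ^ n * x ^ n"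
      using B assms by (intro mult_right_mono) auto
    then show "norm (norm (a n) * x ^ n) \<le> B * (x / y) ^ n"
      using assms by (simp add: power_divide)
  qed
qed

lemma powser_leading_term:
  fixes a :: "nat \<Rightarrow> 'a::banach"
  assumes "summable (\<lambda>m. x ^ m *\<^sub>R a m)" "x > 0" "\<And>m. m < n \<Longrightarrow> a m = 0"
  obtains C where "\<And>t. 0 < t \<Longrightarrow> t \<le> x / 2 \<Longrightarrow>
    norm ((\<Sum>m. t ^ m *\<^sub>R a m) - t ^ n *\<^sub>R a n) \<le> C * t ^ Suc n"
proof -
  obtain B where B: "B > 0" "\<And>n. norm (a n) \<le> B / x ^ n"
    using powser_coeff_bound assms by metis
  show ?thesis
  \<comment> \<open>Beyond order \<open>n\<close> the coefficient bound gives a geometric series of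
    ratio \<open>t / x \<le> 1 / 2\<close>, whose sum accounts for the 2.\<close>
  proof (rule that[of "2 * B / x ^ Suc n"])
    fix t assume t: "0 < t" "t \<le> x / 2"
    have sm: "summable (\<lambda>m. t ^ m *\<^sub>R a m)"
      by (rule summable_norm_cancel)
         (use powser_abs_summable[OF assms(1), of t] t assms(2) in \<open>simp add: mult.commute\<close>)
    have "(\<Sum>m<Suc n. t ^ m *\<^sub>R a m) = t ^ n *\<^sub>R a n"
      by (simp add: assms(3))
    then have "(\<Sum>m. t ^ m *\<^sub>R a m) - t ^ n *\<^sub>R a n = (\<Sum>m. t ^ (m + Suc n) *\<^sub>R a (m + Suc n))"
      using suminf_split_initial_segment[OF sm, of "Suc n"] by simp
    also have "norm \<dots> \<le> (\<Sum>m. t ^ Suc n * (B / x ^ Suc n) * (1 / 2) ^ m)"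
    proof (rule norm_suminf_le)
      fix m
      have "norm (t ^ (m + Suc n) *\<^sub>R a (m + Suc n)) \<le> t ^ (m + Suc n) * (B / x ^ (m + Suc n))"
        unfolding norm_scaleR using t B(2)[of "m + Suc n"] by (intro mult_mono) auto
      also have "\<dots> = t ^ Suc n * (B / x ^ Suc n) * (t / x) ^ m"
        by (simp add: power_add power_divide mult_ac)
      also have "\<dots> \<le> t ^ Suc n * (B / x ^ Suc n) * (1 / 2) ^ m"
        using t B(1) assms(2) by (intro mult_left_mono power_mono) (auto simp: field_simps)
      finally show "norm (t ^ (m + Suc n) *\<^sub>R a (m + Suc n)) \<le> t ^ Suc n * (B / x ^ Suc n) * (1 / 2) ^ m" .
    qed (intro summable_mult summable_geometric, simp)
    also have "\<dots> = 2 * B / x ^ Suc n * t ^ Suc n"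
      by (subst suminf_mult) (auto simp: suminf_geometric)
    finally show "norm ((\<Sum>m. t ^ m *\<^sub>R a m) - t ^ n *\<^sub>R a n) \<le> 2 * B / x ^ Suc n * t ^ Suc n" .
  qed
qed

lemma not_integrable_inverse:
  assumes "e > 0"
  shows "\<not> integrable (ivl e) (\<lambda>t. 1 / t)"
proof
  assume "integrable (ivl e) (\<lambda>t. 1 / t)"
  then have int: "(\<lambda>t. 1 / t) integrable_on {0<..<e}"
    unfolding integrable_ivl by (rule set_borel_integral_eq_integral)
  define I where "I = integral {0<..<e} (\<lambda>t. 1 / t)"
  \<comment> \<open>Chosen so that the integral of \<open>1 / t\<close> over
    \<open>{s..e / 2}\<close> is \<open>|I| + 1\<close>, more than the supposed total
    \<open>I\<close>.\<close>
  define s where "s = e / 2 * exp (- \<bar>I\<bar> - 1)"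
  have "exp (- \<bar>I\<bar> - 1) < 1" by simp
  then have s: "0 < s" "s < e / 2" using assms by (auto simp: s_def)
  have "((\<lambda>t. 1 / t) has_integral (ln (e / 2) - ln s)) {s..e / 2}"
    using s by (intro fundamental_theorem_of_calculus)
      (auto simp: has_real_derivative_iff_has_vector_derivative[symmetric] intro!: derivative_eq_intros)
  then have "ln (e / 2) - ln s \<le> I"
    unfolding I_def
    by (rule has_integral_subset_le[rotated 1, OF _ integrable_integral[OF int]]) (use s assms in auto)
  moreover have "ln s = ln (e / 2) + (- \<bar>I\<bar> - 1)"
    using assms by (simp add: s_def ln_mult ln_div)
  ultimately show False by simp
qed

lemma tendsto_mult_ln_power: "((\<lambda>t::real. t * \<bar>ln t\<bar> ^ k) \<longlongrightarrow> 0) (at_right 0)"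
proof (rule tendsto_sandwich[OF _ _ tendsto_const])
  \<comment> \<open>The constant of \<open>power_le_exp_abs\<close> for rate \<open>1 / 2\<close>;
    the remaining power \<open>t^(1/2)\<close> still tends to 0.\<close>
  let ?C = "fact k / (1 / 2) ^ k :: real"
  show "((\<lambda>t::real. ?C * t powr (1 / 2)) \<longlongrightarrow> 0) (at_right 0)"
    by (rule tendsto_mult_right_zero) real_asymp
  have ev: "\<forall>\<^sub>F t::real in at_right 0. t \<in> {0<..<1}"
    by (rule eventually_at_right_real) simp
  then show "\<forall>\<^sub>F t::real in at_right 0. 0 \<le> t * \<bar>ln t\<bar> ^ k"
    by eventually_elim simp
  show "\<forall>\<^sub>F t::real in at_right 0. t * \<bar>ln t\<bar> ^ k \<le> ?C * t powr (1 / 2)"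
    using ev
  proof eventually_elim
    case (elim t)
    have "t * \<bar>ln t\<bar> ^ k \<le> t * (?C * exp (1 / 2 * \<bar>ln t\<bar>))"
      using elim by (intro mult_left_mono power_le_exp_abs) auto
    also have "exp (1 / 2 * \<bar>ln t\<bar>) = t powr - (1 / 2)"
      using elim by (intro exp_abs_ln) auto
    also have "t * (?C * t powr - (1 / 2)) = ?C * (t powr 1 * t powr - (1 / 2))"
      using elim by simp
    also have "t powr 1 * t powr - (1 / 2) = t powr (1 / 2)"
      by (simp only: powr_add[symmetric]) simp
    finally show ?case .
  qed
qed

lemma summable_matrix_vector: "summable c \<Longrightarrow> summable (\<lambda>n. c n *v v)"
  for c :: "nat \<Rightarrow> complex^'n^'m"
  using bounded_linear.summable[OF mv.bounded_linear_left] .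

lemma suminf_matrix_vector: "summable c \<Longrightarrow> suminf c *v v = (\<Sum>n. c n *v v)"
  for c :: "nat \<Rightarrow> complex^'n^'m"
  using bounded_linear.suminf[OF mv.bounded_linear_left] by metis

lemma norm_vector_smult: "norm (c *s v) = norm c * norm (v :: complex^'n)"
  by (simp add: norm_vec_def L2_set_def norm_mult power_mult_distrib sum_distrib_left[symmetric]
      real_sqrt_mult)

lemma powser_powm_gen_eigvec:
  fixes c :: "nat \<Rightarrow> complex^'r^'r"
  assumes "t > 0" "gen_eigvec M l K v" "summable (\<lambda>n. t ^ n *\<^sub>R c n)"
  shows "((\<Sum>n. t ^ n *\<^sub>R c n) ** powm t (M - mat 1)) *v v
    = (\<Sum>k<K. (of_real t powr (l - 1) * of_real (ln t) ^ k / fact k) *s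
        (\<Sum>n. t ^ n *\<^sub>R (c n *v (mpow (M - mat l) k *v v))))"
proof -
  have M1: "M - mat 1 = M + mat (-1)" by (simp add: vec_eq_iff mat_def)
  have "powm t (M + mat (-1)) *v v = (\<Sum>k<K. (of_real t powr (l + -1) * of_real (ln t) ^ k / fact k) *s
      (mpow (M + mat (-1) - mat (l + -1)) k *v v))"
    using assms by (intro powm_gen_eigvec) (auto simp: gen_eigvec_shift simp del: add_uminus_conv_diff)
  moreover have "(\<Sum>n. t ^ n *\<^sub>R c n) *v w = (\<Sum>n. t ^ n *\<^sub>R (c n *v w))" for w
    using suminf_matrix_vector[OF assms(3)] by (simp add: scaleR_mult_vec)
  ultimately show ?thesis
    unfolding M1 shift_nilpotent matrix_vector_mul_assoc[symmetric]
    by (simp add: mult_vec_sum mult_vec_smult)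
qed

text \<open>If the coefficient did not vanish, \<open>\<parallel>F(t) t\<^sup>M\<^sup>-\<^sup>1 v\<parallel>\<close> would be at least a multiple of \<open>1 / t\<close>
  near \<open>0\<close>. By the induction on \<open>K\<close> the logarithms occur only in terms of higher order.\<close>

lemma powser_coeff_vanish:
  fixes c :: "nat \<Rightarrow> complex^'r^'r"
  assumes d: "d > 0" and sm: "\<And>t. 0 < t \<Longrightarrow> t \<le> d \<Longrightarrow> summable (\<lambda>n. t ^ n *\<^sub>R c n)"
    and int: "integrable (ivl d) (\<lambda>t. (\<Sum>n. t ^ n *\<^sub>R c n) ** powm t (M - mat 1))"
    and "gen_eigvec M l K v" "Re l + real n \<le> 0"
  shows "c n *v v = 0"
  using assms(4,5)
proof (induction K arbitrary: v n)
  case 0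
  then show ?case by (simp add: gen_eigvec_def)
next
  case (Suc K)
  \<comment> \<open>For \<open>k \<ge> 1\<close> the vector \<open>N^k v\<close> is killed by
    \<open>N^K\<close>, so the outer induction removes the logarithmic terms from all non-integrable
    orders.\<close>
  have nil: "c m *v (mpow (M - mat l) k *v v) = 0" if k: "k \<ge> 1" and m: "Re l + real m \<le> 0" for k m
  proof -
    obtain j where j: "k = Suc j" using k by (cases k) auto
    show ?thesis
      unfolding j mpow_Suc_vec
      by (intro Suc.IH gen_eigvec_mpow gen_eigvec_step Suc.prems(1) m)
  qed
  show ?case
    using Suc.prems(2)
  \<comment> \<open>Strong induction on \<open>n\<close> removes the terms of lower order, so that
    order \<open>n\<close> leads the series.\<close>
  proof (induction n rule: less_induct)
    case (less n)
    let ?w = "c n *v v"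
    let ?a = "\<lambda>k m. c m *v (mpow (M - mat l) k *v v)"
    have zero: "?a k m = 0" if "m < n" for k m
      using less that nil[of k m] by (cases "k = 0") auto
    have "\<forall>k. \<exists>C. \<forall>t. 0 < t \<longrightarrow> t \<le> d / 2 \<longrightarrow>
        norm ((\<Sum>m. t ^ m *\<^sub>R ?a k m) - t ^ n *\<^sub>R ?a k n) \<le> C * t ^ Suc n"
    proof
      fix k
      have "summable (\<lambda>m. d ^ m *\<^sub>R ?a k m)"
        using summable_matrix_vector[OF sm[OF d order_refl]] by (simp add: scaleR_mult_vec)
      then show "\<exists>C. \<forall>t. 0 < t \<longrightarrow> t \<le> d / 2 \<longrightarrow>
        norm ((\<Sum>m. t ^ m *\<^sub>R ?a k m) - t ^ n *\<^sub>R ?a k n) \<le> C * t ^ Suc n"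
        by (rule powser_leading_term[OF _ d zero]) blast+
    qed
    then obtain C where C: "\<And>k t. 0 < t \<Longrightarrow> t \<le> d / 2 \<Longrightarrow>
        norm ((\<Sum>m. t ^ m *\<^sub>R ?a k m) - t ^ n *\<^sub>R ?a k n) \<le> C k * t ^ Suc n"
      by (subst (asm) choice_iff) blast
    let ?G = "\<lambda>t. ((\<Sum>m. t ^ m *\<^sub>R c m) ** powm t (M - mat 1)) *v v"
    let ?s = "\<lambda>k t. complex_of_real t powr (l - 1) * of_real (ln t) ^ k / fact k"
    let ?E = "\<lambda>t. \<Sum>k<Suc K. C k / fact k * (t * \<bar>ln t\<bar> ^ k)"
    \<comment> \<open>The term of order \<open>n\<close> without logarithm is split off; everything
      else has order at least \<open>n + 1\<close> up to logarithms and is collected in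
      \<open>?E\<close>, which tends to 0.\<close>
    have lower: "t powr (Re l - 1 + n) * (norm ?w - ?E t) \<le> norm (?G t)" if t: "0 < t" "t \<le> d / 2" for t
    proof -
      have "(\<Sum>k<Suc K. ?s k t *s (t ^ n *\<^sub>R ?a k n)) = ?s 0 t *s (t ^ n *\<^sub>R ?w)"
        by (subst sum.lessThan_Suc_shift) (simp add: nil[OF _ less.prems] del: mpow.simps(2))
      moreover have "?G t = (\<Sum>k<Suc K. ?s k t *s (\<Sum>m. t ^ m *\<^sub>R ?a k m))"
        using t by (intro powser_powm_gen_eigvec Suc.prems sm) auto
      ultimately have "?G t - ?s 0 t *s (t ^ n *\<^sub>R ?w)
          = (\<Sum>k<Suc K. ?s k t *s ((\<Sum>m. t ^ m *\<^sub>R ?a k m) - t ^ n *\<^sub>R ?a k n))"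
        by (simp only: vec.scale_right_diff_distrib sum_subtractf)
      also have "norm \<dots> \<le> (\<Sum>k<Suc K. t powr (Re l - 1) * \<bar>ln t\<bar> ^ k / fact k * (C k * t ^ Suc n))"
      proof (rule sum_norm_le)
        fix k
        have s: "norm (?s k t) = t powr (Re l - 1) * \<bar>ln t\<bar> ^ k / fact k"
          using t by (simp add: norm_mult norm_divide norm_power norm_powr_of_real)
        show "norm (?s k t *s ((\<Sum>m. t ^ m *\<^sub>R ?a k m) - t ^ n *\<^sub>R ?a k n))
            \<le> t powr (Re l - 1) * \<bar>ln t\<bar> ^ k / fact k * (C k * t ^ Suc n)"
          unfolding norm_vector_smult s by (intro mult_left_mono C t) simp
      qed
      also have "\<dots> = t powr (Re l - 1) * t ^ n * ?E t"
        unfolding sum_distrib_left by (intro sum.cong refl) (simp add: field_simps)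
      also have "t powr (Re l - 1) * t ^ n = t powr (Re l - 1 + n)"
        using t by (simp add: powr_add powr_realpow)
      finally have "norm (?G t - ?s 0 t *s (t ^ n *\<^sub>R ?w)) \<le> t powr (Re l - 1 + n) * ?E t" .
      moreover have "norm (?s 0 t *s (t ^ n *\<^sub>R ?w)) = t powr (Re l - 1 + n) * norm ?w"
        using t by (simp add: norm_vector_smult norm_powr_of_real powr_add powr_realpow)
      moreover have "norm (?s 0 t *s (t ^ n *\<^sub>R ?w)) \<le> norm (?G t) + norm (?G t - ?s 0 t *s (t ^ n *\<^sub>R ?w))"
        using norm_triangle_sub[of "?s 0 t *s (t ^ n *\<^sub>R ?w)" "?G t"]
        by (simp only: norm_minus_commute[of "?G t"])
      ultimately show ?thesis unfolding right_diff_distrib by linarith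
    qed
    show "?w = 0"
    proof (rule ccontr)
      assume w: "?w \<noteq> 0"
      have "(?E \<longlongrightarrow> 0) (at_right 0)"
        by (intro tendsto_null_sum tendsto_mult_right_zero tendsto_mult_ln_power)
      then have "\<forall>\<^sub>F t in at_right 0. ?E t < norm ?w / 2"
        by (rule order_tendstoD) (use w in simp)
      then obtain b where b: "b > 0" "\<And>t. 0 < t \<Longrightarrow> t < b \<Longrightarrow> ?E t < norm ?w / 2"
        unfolding eventually_at_right_field by auto
      \<comment> \<open>The bound 1 turns the inequality \<open>Re l - 1 + n \<le> -1\<close> of
        exponents into \<open>1 / t \<le> t powr (Re l - 1 + n)\<close>; the bounds \<open>b\<close>
        and \<open>d / 2\<close> make the estimate of \<open>?E\<close> and \<open>lower\<close>
        available.\<close>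
      define e where "e = min (min b (d / 2)) 1"
      have e: "e > 0" "e \<le> b" "e \<le> d / 2" "e \<le> 1" using b d by (auto simp: e_def)
      have "integrable (ivl d) ?G"
        by (rule integrable_bounded_linear[OF mv.bounded_linear_left int])
      then have intG: "integrable (ivl e) ?G"
        unfolding integrable_ivl by (rule set_integrable_subset) (use e d in auto)
      have "integrable (ivl e) (\<lambda>t. 1 / t)"
      proof (rule Bochner_Integration.integrable_bound)
        show "integrable (ivl e) (\<lambda>t. 2 / norm ?w * norm (?G t))"
          by (intro integrable_mult_right integrable_norm intG)
        show "(\<lambda>t. 1 / t) \<in> borel_measurable (ivl e)"
          by (rule measurable_restrict_space1) measurable
        show "AE t in ivl e. norm (1 / t) \<le> norm (2 / norm ?w * norm (?G t))"
          using ivl_AE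
        proof eventually_elim
          case (elim t)
          have "1 / t = t powr -1"
            using elim by (simp add: powr_minus_divide)
          also have "\<dots> \<le> t powr (Re l - 1 + n)"
            using elim e less.prems by (intro powr_mono') auto
          finally have "1 / t * (norm ?w / 2) \<le> t powr (Re l - 1 + n) * (norm ?w - ?E t)"
            using b(2)[of t] elim e by (intro mult_mono) auto
          also have "\<dots> \<le> norm (?G t)"
            using elim e by (intro lower) auto
          finally show ?case
            using w elim by (simp add: field_simps)
        qed
      qed
      then show False using not_integrable_inverse[OF e(1)] by contradiction
    qed
  qed
qed

section \<open>Power series times matrix powers\<close>

lemma matrix_summable:
  fixes X :: "nat \<Rightarrow> complex^'n^'m"
  assumes "\<And>v. summable (\<lambda>n. X n *v v)"
  shows "summable X"
proof -
  obtain T :: "'n::finite \<Rightarrow> complex^'m \<Rightarrow> complex^'n^'m"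
    where T: "\<And>j. bounded_linear (T j)" "\<And>X. X = (\<Sum>j\<in>UNIV. T j (X *v axis j 1))"
    using matrix_from_columns by blast
  have "summable (\<lambda>n. \<Sum>j\<in>UNIV. T j (X n *v axis j 1))"
    by (intro summable_sum bounded_linear.summable[OF T(1)] assms)
  then show ?thesis by (simp only: T(2)[symmetric])
qed

text \<open>Once \<open>V n\<close> is close to the identity, each further factor enlarges a vector
  at most by \<open>q\<close>; the finitely many earlier products are absorbed in \<open>B\<close>.
  The new factor acts first, so the induction has to range over all \<open>v\<close>. The constant
  \<open>K\<close> bounds the bilinear action of matrices on vectors.\<close>

lemma matrix_product_growth:
  fixes U V :: "nat \<Rightarrow> complex^'r^'r"
  assumes U: "\<And>n. U (Suc n) = U n ** V n" and V: "V \<longlonglongrightarrow> mat 1" and q: "q > 1"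
  obtains B where "B \<ge> 0" "\<And>n v. norm (U n *v v) \<le> B * q ^ n * norm v"
proof -
  obtain K where K: "K > 0"
    "\<And>(a :: complex^'r^'r) b. norm (a *v b) \<le> norm a * norm b * K"
    using mv.pos_bounded by blast
  have "(\<lambda>n. norm (V n - mat 1)) \<longlonglongrightarrow> 0"
    using V by (simp add: tendsto_norm_zero LIM_zero)
  then have "\<forall>\<^sub>F n in sequentially. norm (V n - mat 1) < (q - 1) / K"
    by (rule order_tendstoD) (use q K in simp)
  then obtain N where N: "\<And>n. n \<ge> N \<Longrightarrow> norm (V n - mat 1) < (q - 1) / K"
    by (auto simp: eventually_sequentially)
  have step: "norm (V n *v v) \<le> q * norm v" if "n \<ge> N" for n v
  proof -
    have "V n *v v = v + (V n - mat 1) *v v"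
      by (simp add: matrix_vector_mult_diff_rdistrib)
    then have "norm (V n *v v) \<le> norm v + norm ((V n - mat 1) *v v)"
      by (metis norm_triangle_ineq)
    also have "norm ((V n - mat 1) *v v) \<le> norm (V n - mat 1) * norm v * K"
      by (rule K)
    also have "\<dots> \<le> (q - 1) / K * norm v * K"
      using N[OF that] K by (intro mult_right_mono) auto
    also have "(q - 1) / K * norm v * K = (q - 1) * norm v"
      using K by simp
    finally show ?thesis by (simp add: left_diff_distrib)
  qed
  define B where "B = (\<Sum>m\<le>N. norm (U m)) * K"
  have B: "B \<ge> 0" using K by (simp add: B_def sum_nonneg)
  have le: "norm (U n *v v) \<le> B * q ^ n * norm v" if "n \<le> N" for n v
  proof -
    have "norm (U n *v v) \<le> norm (U n) * norm v * K" by (rule K)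
    also have "\<dots> = norm (U n) * K * norm v" by simp
    also have "\<dots> \<le> B * norm v"
      unfolding B_def using that K
      by (intro mult_right_mono member_le_sum[of n "{..N}" "\<lambda>m. norm (U m)"]) auto
    also have "\<dots> \<le> B * q ^ n * norm v"
      using B q mult_left_mono[of 1 "q ^ n" B] by (intro mult_right_mono) auto
    finally show ?thesis .
  qed
  have "norm (U (N + d) *v v) \<le> B * q ^ (N + d) * norm v" for d v
  proof (induction d arbitrary: v)
    case (Suc d)
    have "U (N + Suc d) *v v = U (N + d) *v (V (N + d) *v v)"
      by (simp add: U matrix_vector_mul_assoc)
    then have "norm (U (N + Suc d) *v v) \<le> B * q ^ (N + d) * norm (V (N + d) *v v)"
      using Suc by simp
    also have "\<dots> \<le> B * q ^ (N + d) * (q * norm v)"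
      using B q by (intro mult_left_mono step) auto
    finally show ?case by (simp add: mult_ac)
  qed (simp add: le)
  then have "norm (U n *v v) \<le> B * q ^ n * norm v" for n v
    using le[of n v] le_Suc_ex[of N n] by (cases "n \<le> N") auto
  with B show ?thesis by (rule that)
qed

text \<open>With \<open>x < y < \<rho>\<close>, growth at rate \<open>q = y / x\<close> changes
  \<open>x^n\<close> into \<open>y^n\<close>, where the series of \<open>c\<close> still converges
  absolutely.\<close>

lemma powser_mult_summable:
  fixes c U V :: "nat \<Rightarrow> complex^'r^'r"
  assumes U: "\<And>n. U (Suc n) = U n ** V n" and V: "V \<longlonglongrightarrow> mat 1"
    and c: "\<And>x. 0 < x \<Longrightarrow> x < \<rho> \<Longrightarrow> summable (\<lambda>n. x ^ n *\<^sub>R c n)" and x: "0 < x" "x < \<rho>"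
  shows "summable (\<lambda>n. x ^ n *\<^sub>R (c n ** U n))"
proof (rule matrix_summable)
  fix v :: "complex^'r"
  define y where "y = (x + \<rho>) / 2"
  have y: "x < y" "y < \<rho>" using x by (auto simp: y_def)
  obtain K where K: "K > 0"
    "\<And>(a :: complex^'r^'r) b. norm (a *v b) \<le> norm a * norm b * K"
    using mv.pos_bounded by blast
  have "y / x > 1" using x y by simp
  with U V obtain B where B: "B \<ge> 0" "\<And>n v. norm (U n *v v) \<le> B * (y / x) ^ n * norm v"
    by (rule matrix_product_growth) blast
  have "summable (\<lambda>n. norm (c n) * y ^ n)"
    by (rule powser_abs_summable[OF c[of "(y + \<rho>) / 2"]]) (use x y in auto)
  then have sm: "summable (\<lambda>n. B * norm v * K * (norm (c n) * y ^ n))"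
    by (rule summable_mult)
  show "summable (\<lambda>n. (x ^ n *\<^sub>R (c n ** U n)) *v v)"
  proof (rule summable_comparison_test'[OF sm])
    fix n
    have "norm ((x ^ n *\<^sub>R (c n ** U n)) *v v) = x ^ n * norm (c n *v (U n *v v))"
      using x by (simp add: scaleR_mult_vec matrix_vector_mul_assoc)
    also have "\<dots> \<le> x ^ n * (norm (c n) * norm (U n *v v) * K)"
      using x by (intro mult_left_mono K) auto
    also have "\<dots> \<le> x ^ n * (norm (c n) * (B * (y / x) ^ n * norm v) * K)"
      using x K(1) B(2) by (intro mult_left_mono mult_right_mono) auto
    also have "\<dots> = B * norm v * K * (norm (c n) * y ^ n)"
      using x by (simp add: power_divide)
    finally show "norm ((x ^ n *\<^sub>R (c n ** U n)) *v v) \<le> B * norm v * K * (norm (c n) * y ^ n)" .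
  qed
qed

lemma matrix_inv_uminus:
  fixes A :: "complex^'n^'n"
  assumes "invertible A"
  shows "matrix_inv (- A) = - matrix_inv A"
proof -
  obtain B where "A ** B = mat 1" using assms unfolding invertible_def by blast
  then show ?thesis
    using matrix_inv_eqI(2)[of A B] matrix_inv_eqI(2)[of "- A" "- B"]
    by (simp add: mm.minus_left mm.minus_right)
qed

text \<open>On a generalised eigenvector the resolvent is a finite sum of negative powers of
  \<open>- c - n - l\<close>, each tending to 0.\<close>

lemma resolvent_tendsto_0:
  fixes M :: "complex^'r^'r"
  assumes "\<And>n::nat. invertible (M + mat (c + of_nat n))"
  shows "(\<lambda>n. matrix_inv (M + mat (c + of_nat n))) \<longlonglongrightarrow> 0"
proof (rule matrix_tendsto)
  fix v
  show "(\<lambda>n. matrix_inv (M + mat (c + of_nat n)) *v v) \<longlonglongrightarrow> 0 *v v"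
  proof (induction v rule: gen_eigvecs_induct[where M = M])
    case (gen_eigvec l K v)
    let ?z = "\<lambda>n. - (c + of_nat n)"
    have lim: "filterlim (\<lambda>n. ?z n - l) at_infinity sequentially"
    proof -
      have "filterlim (\<lambda>n. (- c - l) + - of_nat n) at_infinity sequentially"
        by (rule tendsto_add_filterlim_at_infinity[OF tendsto_const])
           (simp add: filterlim_at_infinity_conv_norm_at_top filterlim_real_sequentially)
      then show ?thesis by (simp add: algebra_simps)
    qed
    have "(\<lambda>n. 1 / (?z n - l) ^ Suc k) \<longlonglongrightarrow> 0" for k
      by (intro tendsto_divide_0[OF tendsto_const Limits.filterlim_power_at_infinity[OF lim]]) simp
    then have "(\<lambda>n. (1 / (?z n - l) ^ Suc k) *s (mpow (M - mat l) k *v v)) \<longlonglongrightarrow> 0 *s (mpow (M - mat l) k *v v)" for k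
      by (rule bounded_linear.tendsto[OF bounded_linear_smult_left])
    then have "(\<lambda>n. - (\<Sum>k<K. (1 / (?z n - l) ^ Suc k) *s (mpow (M - mat l) k *v v))) \<longlonglongrightarrow> - 0"
      by (intro tendsto_minus tendsto_null_sum) simp
    moreover have "matrix_inv (M + mat (c + of_nat n)) *v v
        = - (\<Sum>k<K. (1 / (?z n - l) ^ Suc k) *s (mpow (M - mat l) k *v v))" for n
    proof -
      have neg: "M + mat (c + of_nat n) = - (mat (?z n) - M)"
        by (simp add: vec_eq_iff mat_def)
      have "?z n \<notin> spectrum M"
        using assms not_spectrum_iff by blast
      then have "matrix_inv (mat (?z n) - M) *v v = (\<Sum>k<K. (1 / (?z n - l) ^ Suc k) *s (mpow (M - mat l) k *v v))"
        by (rule resolvent_gen_eigvec[OF gen_eigvec])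
      moreover have "invertible (mat (?z n) - M)"
        using \<open>?z n \<notin> spectrum M\<close> unfolding spectrum_def by blast
      ultimately show ?thesis
        unfolding neg by (simp only: matrix_inv_uminus mv.minus_left)
    qed
    ultimately show ?case by simp
  next
    case (add v w)
    then show ?case
      using tendsto_add[OF add] by (simp add: matrix_vector_right_distrib)
  next
    case (smult c v)
    then show ?case
      using bounded_linear.tendsto[OF bounded_linear_smult_right smult, of c] by (simp add: mult_vec_smult)
  qed simp
qed

lemma pochhammer_analytic [analytic_intros]:
  assumes "f analytic_on S"
  shows "(\<lambda>z. pochhammer (f z) n) analytic_on S"
  by (induction n) (auto simp: pochhammer_Suc intro!: analytic_intros assms)

lemma mpochhammer_eq_mat_fun: "mpochhammer M n = mat_fun (\<lambda>z. pochhammer z n) M"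
proof (induction n)
  case (Suc n)
  have "mat_fun (\<lambda>z. pochhammer z n) M ** mat_fun (\<lambda>z. z + of_nat n) M
      = mat_fun (\<lambda>z. pochhammer z n * (z + of_nat n)) M"
    by (intro mat_fun_mult analytic_intros)
  then show ?case by (simp add: Suc mat_fun_linear pochhammer_Suc)
qed (simp add: mat_fun_const)

text \<open>For invertible symbols this is \<open>(M)_n (M + c)_n^-1\<close>, the matrix that turns
  \<open>(M)_n^-1\<close> into \<open>(M + c)_n^-1\<close>. Written as one function of
  \<open>M\<close>, it can be compared with quotients of Gamma values.\<close>

definition poch_quot :: "complex^'r^'r \<Rightarrow> complex \<Rightarrow> nat \<Rightarrow> complex^'r^'r" where
  "poch_quot M c n = mat_fun (\<lambda>z. pochhammer z n * inverse (pochhammer (z + c) n)) M"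

lemma spectrum_add_nonzero:
  fixes M :: "complex^'r^'r"
  assumes "invertible (M + mat c)" "l \<in> spectrum M"
  shows "l + c \<noteq> 0"
  using assms not_spectrum_iff[of c M] by (metis add_eq_0_iff2)

lemma pochhammer_spectrum_nonzero:
  fixes M :: "complex^'r^'r"
  assumes "\<And>k::nat. invertible (M + mat (c + of_nat k))" "l \<in> spectrum M"
  shows "pochhammer (l + c) n \<noteq> 0"
proof
  assume "pochhammer (l + c) n = 0"
  then obtain k where "l + c = - of_nat k" by (auto simp: pochhammer_eq_0_iff)
  then have "l + (c + of_nat k) = 0" by (simp add: add.assoc[symmetric])
  then show False using spectrum_add_nonzero[OF assms(1,2)] by blast
qed

lemma poch_quot_analytic:
  fixes M :: "complex^'r^'r"
  assumes "\<And>k::nat. invertible (M + mat (c + of_nat k))"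
  shows "(\<lambda>z. pochhammer z n * inverse (pochhammer (z + c) n)) analytic_on spectrum M"
  using pochhammer_spectrum_nonzero[OF assms] by (intro analytic_intros) auto

lemma poch_quot_eq:
  fixes M :: "complex^'r^'r"
  assumes "\<And>k::nat. invertible (M + mat (c + of_nat k))"
  shows "poch_quot M c n = mpochhammer M n ** matrix_inv (mpochhammer (M + mat c) n)"
    and "invertible (mpochhammer (M + mat c) n)"
proof -
  let ?f = "\<lambda>z. pochhammer (z + c) n"
  have eq: "mpochhammer (M + mat c) n = mat_fun ?f M"
    by (simp add: mpochhammer_eq_mat_fun mat_fun_shift)
  have f: "?f analytic_on spectrum M" by (intro analytic_intros)
  have inv: "invertible (mat_fun ?f M)" "matrix_inv (mat_fun ?f M) = mat_fun (\<lambda>z. inverse (?f z)) M"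
    using mat_fun_inverse[OF f] pochhammer_spectrum_nonzero[OF assms] by blast+
  show "invertible (mpochhammer (M + mat c) n)"
    unfolding eq by (rule inv)
  have "poch_quot M c n = mat_fun (\<lambda>z. pochhammer z n) M ** mat_fun (\<lambda>z. inverse (?f z)) M"
    unfolding poch_quot_def
    by (intro mat_fun_mult[symmetric] analytic_intros) (use pochhammer_spectrum_nonzero[OF assms] in auto)
  then show "poch_quot M c n = mpochhammer M n ** matrix_inv (mpochhammer (M + mat c) n)"
    unfolding eq inv(2) mpochhammer_eq_mat_fun[of M] .
qed

text \<open>Consecutive quotients differ by the factor
  \<open>(z + n) / (z + c + n) = 1 - c / (z + c + n)\<close>. Applied to \<open>M\<close> it tends
  to the identity because the resolvent tends to 0, so \<open>powser_mult_summable\<close>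
  applies.\<close>

lemma poch_quot_summable:
  fixes M :: "complex^'r^'r" and a :: "nat \<Rightarrow> complex^'r^'r"
  assumes inv: "\<And>k::nat. invertible (M + mat (c + of_nat k))"
    and a: "\<And>x. 0 < x \<Longrightarrow> x < \<rho> \<Longrightarrow> summable (\<lambda>n. x ^ n *\<^sub>R a n)" and x: "0 < x" "x < \<rho>"
  shows "summable (\<lambda>n. x ^ n *\<^sub>R (a n ** poch_quot M c n))"
proof -
  let ?V = "\<lambda>n. mat_fun (\<lambda>z. (z + of_nat n) * inverse (z + (c + of_nat n))) M"
  have nz: "l + (c + of_nat n) \<noteq> 0" if "l \<in> spectrum M" for l n
    using spectrum_add_nonzero[OF inv that] .
  have an: "(\<lambda>z. inverse (z + (c + of_nat n))) analytic_on spectrum M" for n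
    using nz by (intro analytic_intros) auto
  have "poch_quot M c (Suc n) = poch_quot M c n ** ?V n" for n
  proof -
    have "poch_quot M c n ** ?V n = mat_fun (\<lambda>z. (pochhammer z n * inverse (pochhammer (z + c) n))
        * ((z + of_nat n) * inverse (z + (c + of_nat n)))) M"
      unfolding poch_quot_def by (intro mat_fun_mult poch_quot_analytic inv analytic_on_mult an analytic_intros)
    then show ?thesis
      by (simp add: poch_quot_def pochhammer_Suc mult_ac add_ac)
  qed
  moreover have "?V \<longlonglongrightarrow> mat 1"
  proof -
    have "?V n = mat 1 + mat (- c) ** matrix_inv (M + mat (c + of_nat n))" for n
    proof -
      have "?V n = mat_fun (\<lambda>z. 1 + (- c) * inverse (z + (c + of_nat n))) M"
      proof (rule mat_fun_cong)
        fix l assume l: "l \<in> spectrum M"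
        have "((\<lambda>z. z + (c + of_nat n)) \<longlongrightarrow> l + (c + of_nat n)) (at l)"
          by (intro tendsto_intros)
        then have "\<forall>\<^sub>F z in at l. z + (c + of_nat n) \<noteq> 0"
          by (rule tendsto_imp_eventually_ne) (rule nz[OF l])
        then show "\<forall>\<^sub>F z in at l. (z + of_nat n) * inverse (z + (c + of_nat n))
            = 1 + (- c) * inverse (z + (c + of_nat n))"
          by eventually_elim (simp add: field_simps)
      qed
      also have "\<dots> = mat 1 + mat (- c) ** mat_fun (\<lambda>z. inverse (z + (c + of_nat n))) M"
        by (subst mat_fun_add; (intro analytic_intros an)?)
           (subst mat_fun_mult[symmetric]; (intro analytic_intros an)?; simp add: mat_fun_const)
      also have "mat_fun (\<lambda>z. inverse (z + (c + of_nat n))) M = matrix_inv (M + mat (c + of_nat n))"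
        unfolding mat_fun_linear[symmetric]
        by (rule mat_fun_inverse(2)[symmetric]) (use nz in \<open>auto intro!: analytic_intros\<close>)
      finally show ?thesis .
    qed
    moreover have "(\<lambda>n. mat 1 + mat (- c) ** matrix_inv (M + mat (c + of_nat n))) \<longlonglongrightarrow> mat 1 + mat (- c) ** 0"
      by (intro tendsto_intros mm.tendsto resolvent_tendsto_0 inv)
    ultimately show ?thesis by simp
  qed
  ultimately show ?thesis
    using a x by (rule powser_mult_summable)
qed

section \<open>Differentiation of power series with matrix coefficients\<close>

lemma matrix_from_entries:
  obtains T :: "'m::finite \<Rightarrow> 'n::finite \<Rightarrow> complex \<Rightarrow> complex^'n^'m"
  where "\<And>i j. bounded_linear (T i j)" "\<And>X. X = (\<Sum>i\<in>UNIV. \<Sum>j\<in>UNIV. T i j (vec_nth (vec_nth X i) j))"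
proof
  define T :: "'m \<Rightarrow> 'n \<Rightarrow> complex \<Rightarrow> complex^'n^'m"
    where "T i j z = (\<chi> a b. if a = i then if b = j then z else 0 else 0)" for i j z
  show "bounded_linear (T i j)" for i j
    by (auto intro!: linearI simp: linear_conv_bounded_linear[symmetric] T_def vec_eq_iff)
  show "X = (\<Sum>i\<in>UNIV. \<Sum>j\<in>UNIV. T i j (vec_nth (vec_nth X i) j))" for X
  proof -
    have "(\<Sum>j\<in>UNIV. vec_nth (vec_nth (T i j (vec_nth (vec_nth X i) j)) a) b)
        = (if a = i then vec_nth (vec_nth X a) b else 0)" for i a b
      by (cases "a = i") (simp_all add: T_def)
    then show ?thesis by (simp add: vec_eq_iff)
  qed
qed

text \<open>The series is recorded for \<open>x\<close> times the derivative: this keeps the powers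
  \<open>x^n\<close>, with coefficients multiplied by \<open>n\<close>, and avoids an index
  shift.\<close>

lemma powser_has_vector_derivative_complex:
  fixes a :: "nat \<Rightarrow> complex"
  assumes "\<And>x. 0 < x \<Longrightarrow> x < \<rho> \<Longrightarrow> summable (\<lambda>n. a n * of_real x ^ n)" "0 < x" "x < \<rho>"
  shows "\<exists>d. ((\<lambda>x. \<Sum>n. a n * of_real x ^ n) has_vector_derivative d) (at x) \<and>
    (\<lambda>n. of_nat n * a n * of_real x ^ n) sums (of_real x * d)"
proof -
  define y where "y = (x + \<rho>) / 2"
  have y: "x < y" "y < \<rho>" using assms by (auto simp: y_def)
  have sm: "summable (\<lambda>n. a n * of_real y ^ n)"
    by (rule assms) (use assms y in auto)
  let ?d = "\<Sum>n. diffs a n * of_real x ^ n"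
  have "((\<lambda>x. \<Sum>n. a n * x ^ n) has_field_derivative ?d) (at (of_real x))"
    by (rule termdiffs_strong[OF sm]) (use assms y in auto)
  then have 1: "((\<lambda>x. \<Sum>n. a n * of_real x ^ n) has_vector_derivative ?d) (at x)"
    by (rule has_vector_derivative_real_field)
  have "summable (\<lambda>n. diffs a n * of_real x ^ n)"
    by (rule termdiff_converges[of _ y])
       (use assms y powser_inside[OF sm] in auto)
  then have "(\<lambda>n. of_nat n * a n * of_real x ^ (n - Suc 0)) sums ?d"
    by (rule diffs_equiv)
  then have "(\<lambda>n. of_real x * (of_nat n * a n * of_real x ^ (n - Suc 0))) sums (of_real x * ?d)"
    by (rule sums_mult)
  also have "(\<lambda>n. of_real x * (of_nat n * a n * of_real x ^ (n - Suc 0))) = (\<lambda>n. of_nat n * a n * of_real x ^ n)"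
    by (rule ext, rename_tac n, case_tac n) auto
  finally show ?thesis using 1 by blast
qed

lemma bounded_linear_entry: "bounded_linear (\<lambda>X :: complex^'n^'m. vec_nth (vec_nth X i) j)"
  by (intro bounded_linear_compose[OF bounded_linear_vec_nth bounded_linear_vec_nth])

lemma powser_has_vector_derivative:
  fixes c :: "nat \<Rightarrow> complex^'n^'m"
  assumes "\<And>x. 0 < x \<Longrightarrow> x < \<rho> \<Longrightarrow> summable (\<lambda>n. x ^ n *\<^sub>R c n)" "0 < x" "x < \<rho>"
  shows "\<exists>P. ((\<lambda>x. \<Sum>n. x ^ n *\<^sub>R c n) has_vector_derivative P) (at x) \<and>
    (\<lambda>n. x ^ n *\<^sub>R (real n *\<^sub>R c n)) sums (x *\<^sub>R P)"
proof -
  let ?c = "\<lambda>i j n. vec_nth (vec_nth (c n) i) j"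
  obtain T :: "'m::finite \<Rightarrow> 'n::finite \<Rightarrow> complex \<Rightarrow> complex^'n^'m"
    where T: "\<And>i j. bounded_linear (T i j)" "\<And>X. X = (\<Sum>i\<in>UNIV. \<Sum>j\<in>UNIV. T i j (vec_nth (vec_nth X i) j))"
    using matrix_from_entries by blast
  have entry: "vec_nth (vec_nth (x ^ n *\<^sub>R c n) i) j = ?c i j n * of_real x ^ n" for x n i j
    by (simp add: scaleR_conv_of_real[where 'a=complex] mult.commute)
  have sm: "summable (\<lambda>n. ?c i j n * of_real x ^ n)" if "0 < x" "x < \<rho>" for x i j
    using bounded_linear.summable[OF bounded_linear_entry assms(1)[OF that], of i j] unfolding entry .
  have sum: "vec_nth (vec_nth (\<Sum>n. x ^ n *\<^sub>R c n) i) j = (\<Sum>n. ?c i j n * of_real x ^ n)"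
    if "0 < x" "x < \<rho>" for x i j
    using bounded_linear.suminf[OF bounded_linear_entry assms(1)[OF that], of i j] unfolding entry .
  have "\<forall>i j. \<exists>d. ((\<lambda>x. \<Sum>n. ?c i j n * of_real x ^ n) has_vector_derivative d) (at x) \<and>
      (\<lambda>n. of_nat n * ?c i j n * of_real x ^ n) sums (of_real x * d)"
    by (intro allI powser_has_vector_derivative_complex[where \<rho> = \<rho>] sm assms)
  then obtain d where d: "\<And>i j. ((\<lambda>x. \<Sum>n. ?c i j n * of_real x ^ n) has_vector_derivative d i j) (at x)"
    "\<And>i j. (\<lambda>n. of_nat n * ?c i j n * of_real x ^ n) sums (of_real x * d i j)"
    unfolding choice_iff by blast
  let ?P = "\<Sum>i\<in>UNIV. \<Sum>j\<in>UNIV. T i j (d i j)"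
  have "((\<lambda>x. \<Sum>i\<in>UNIV. \<Sum>j\<in>UNIV. T i j (\<Sum>n. ?c i j n * of_real x ^ n)) has_vector_derivative ?P) (at x)"
    by (intro has_vector_derivative_sum bounded_linear.has_vector_derivative[OF T(1)] d)
  then have "((\<lambda>x. \<Sum>n. x ^ n *\<^sub>R c n) has_vector_derivative ?P) (at x)"
    by (rule has_vector_derivative_transform_within_open[of _ _ _ "{0<..<\<rho>}"])
       (use assms in \<open>auto simp: sum[symmetric] T(2)[symmetric]\<close>)
  moreover have "(\<lambda>n. x ^ n *\<^sub>R (real n *\<^sub>R c n)) sums (x *\<^sub>R ?P)"
  proof -
    have "(\<lambda>n. \<Sum>i\<in>UNIV. \<Sum>j\<in>UNIV. T i j (of_nat n * ?c i j n * of_real x ^ n)) sums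
        (\<Sum>i\<in>UNIV. \<Sum>j\<in>UNIV. T i j (of_real x * d i j))"
      by (intro sums_sum bounded_linear.sums[OF T(1)] d)
    moreover have "of_nat n * ?c i j n * of_real x ^ n = vec_nth (vec_nth (x ^ n *\<^sub>R (real n *\<^sub>R c n)) i) j" for n i j
      by (simp add: scaleR_conv_of_real[where 'a=complex] mult.commute)
    moreover have "T i j (of_real x * d i j) = x *\<^sub>R T i j (d i j)" for i j
      using linear_scale[OF bounded_linear.linear[OF T(1)], of i j x "d i j"]
      by (simp add: scaleR_conv_of_real[where 'a=complex])
    ultimately show ?thesis
      by (simp only: T(2)[symmetric] scaleR_sum_right)
  qed
  ultimately show ?thesis by blast
qed

lemma mat_of_real_mult: "mat (of_real x) ** A = x *\<^sub>R (A :: complex^'r^'r)"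
  by (simp add: matrix_eq matrix_vector_mul_assoc[symmetric] scaleR_mult_vec scaleR_eq_vector_smult)

lemma mat_mult_commute: "A ** mat c = mat c ** (A :: complex^'r^'r)"
  by (simp add: matrix_eq matrix_vector_mul_assoc[symmetric] mult_vec_smult)

lemma powm_rec:
  assumes "x > 0"
  shows "powm x (M :: complex^'r^'r) = x *\<^sub>R powm x (M - mat 1)"
proof -
  have M1: "M - mat 1 = M + mat (-1)" by (simp add: vec_eq_iff mat_def)
  have "mat (of_real x) ** powm x (M - mat 1) = mat_fun (\<lambda>z. of_real x * of_real x powr (z + -1)) M"
    unfolding M1 powm_shift[OF assms]
    by (subst mat_fun_mult[symmetric]) (use assms in \<open>auto intro!: analytic_intros simp: mat_fun_const\<close>)
  also have "(\<lambda>z. of_real x * of_real x powr (z + -1)) = (\<lambda>z. complex_of_real x powr z)"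
    using assms by (auto simp: powr_diff)
  finally show ?thesis
    using assms by (simp add: powm_eq_mat_fun mat_of_real_mult)
qed

text \<open>In the product rule, \<open>F' x^M = (x F') x^(M-1)\<close>, and \<open>x F'\<close> has
  the coefficients \<open>n c n\<close>; together with \<open>F M x^(M-1)\<close> this multiplies
  \<open>c n\<close> by \<open>M + n\<close>.\<close>

lemma powser_powm_has_vector_derivative:
  fixes c :: "nat \<Rightarrow> complex^'r^'r"
  assumes c: "\<And>x. 0 < x \<Longrightarrow> x < \<rho> \<Longrightarrow> summable (\<lambda>n. x ^ n *\<^sub>R c n)" and x: "0 < x" "x < \<rho>"
  shows "summable (\<lambda>n. x ^ n *\<^sub>R (c n ** (M + mat (of_nat n))))"
    and "((\<lambda>x. (\<Sum>n. x ^ n *\<^sub>R c n) ** powm x M) has_vector_derivative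
      (\<Sum>n. x ^ n *\<^sub>R (c n ** (M + mat (of_nat n)))) ** powm x (M - mat 1)) (at x)"
proof -
  let ?F = "\<lambda>x. \<Sum>n. x ^ n *\<^sub>R c n"
  obtain P where P: "(?F has_vector_derivative P) (at x)"
    "(\<lambda>n. x ^ n *\<^sub>R (real n *\<^sub>R c n)) sums (x *\<^sub>R P)"
    using powser_has_vector_derivative[OF assms] by blast
  have "(\<lambda>n. (x ^ n *\<^sub>R c n) ** M) sums (?F x ** M)"
    by (intro bounded_linear.sums[OF mm.bounded_linear_left] summable_sums c x)
  then have "(\<lambda>n. (x ^ n *\<^sub>R c n) ** M + x ^ n *\<^sub>R (real n *\<^sub>R c n)) sums (?F x ** M + x *\<^sub>R P)"
    by (intro sums_add P)
  moreover have "c n ** mat (of_nat n) = real n *\<^sub>R c n" for n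
    using mat_of_real_mult[of "real n" "c n"] by (simp add: mat_mult_commute)
  then have "(x ^ n *\<^sub>R c n) ** M + x ^ n *\<^sub>R (real n *\<^sub>R c n) = x ^ n *\<^sub>R (c n ** (M + mat (of_nat n)))" for n
    by (simp add: mm.add_right mm.scaleR_left scaleR_add_right)
  ultimately have sums: "(\<lambda>n. x ^ n *\<^sub>R (c n ** (M + mat (of_nat n)))) sums (?F x ** M + x *\<^sub>R P)"
    by simp
  then show "summable (\<lambda>n. x ^ n *\<^sub>R (c n ** (M + mat (of_nat n))))"
    by (rule sums_summable)
  have "((\<lambda>x. ?F x ** powm x M) has_vector_derivative
      (?F x ** (M ** powm x (M - mat 1)) + P ** powm x M)) (at x)"
    by (rule mm.has_vector_derivative[OF P(1) powm_has_vector_derivative[OF x(1)]])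
  also have "?F x ** (M ** powm x (M - mat 1)) + P ** powm x M
      = (?F x ** M + x *\<^sub>R P) ** powm x (M - mat 1)"
    unfolding powm_rec[OF x(1), of M]
    by (simp add: mm.add_left mm.scaleR_left mm.scaleR_right matrix_mul_assoc)
  finally show "((\<lambda>x. (\<Sum>n. x ^ n *\<^sub>R c n) ** powm x M) has_vector_derivative
      (\<Sum>n. x ^ n *\<^sub>R (c n ** (M + mat (of_nat n)))) ** powm x (M - mat 1)) (at x)"
    using sums by (simp add: sums_iff)
qed

text \<open>Each derivative lowers the exponent by one and multiplies the \<open>n\<close>-th
  coefficient by the current exponent plus \<open>n\<close>; after \<open>k\<close> steps these
  factors form a falling factorial.\<close>

lemma
  fixes c :: "nat \<Rightarrow> complex^'r^'r" and M :: "complex^'r^'r" and e :: complex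
  defines "b \<equiv> \<lambda>k n. c n ** mat_fun (\<lambda>z. \<Prod>i<k. z + e - of_nat i + of_nat n) M"
  assumes c: "\<And>x. 0 < x \<Longrightarrow> x < \<rho> \<Longrightarrow> summable (\<lambda>n. x ^ n *\<^sub>R c n)"
    and g: "\<And>x. 0 < x \<Longrightarrow> x < \<rho> \<Longrightarrow> g x = (\<Sum>n. x ^ n *\<^sub>R c n) ** powm x (M + mat e)"
    and x: "0 < x" "x < \<rho>"
  shows nth_vderiv_powser_powm:
      "nth_vderiv k g x = (\<Sum>n. x ^ n *\<^sub>R b k n) ** powm x (M + mat (e - of_nat k))"
    and nth_vderiv_powser_powm_differentiable: "nth_vderiv k g differentiable (at x)"
proof -
  let ?h = "\<lambda>k x. (\<Sum>n. x ^ n *\<^sub>R b k n) ** powm x (M + mat (e - of_nat k))"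
  have deriv: "summable (\<lambda>n. x ^ n *\<^sub>R b (Suc k) n) \<and> (?h k has_vector_derivative ?h (Suc k) x) (at x)"
    if sm: "\<And>x. 0 < x \<Longrightarrow> x < \<rho> \<Longrightarrow> summable (\<lambda>n. x ^ n *\<^sub>R b k n)" and x: "0 < x" "x < \<rho>" for k x
  proof -
    have "b k n ** (M + mat (e - of_nat k) + mat (of_nat n)) = b (Suc k) n" for n
    proof -
      have "M + mat (e - of_nat k) + mat (of_nat n) = mat_fun (\<lambda>z. z + (e - of_nat k + of_nat n)) M"
        unfolding mat_fun_linear by (simp add: vec_eq_iff mat_def)
      moreover have "mat_fun (\<lambda>z. \<Prod>i<k. z + e - of_nat i + of_nat n) M ** mat_fun (\<lambda>z. z + (e - of_nat k + of_nat n)) M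
          = mat_fun (\<lambda>z. \<Prod>i<Suc k. z + e - of_nat i + of_nat n) M"
        by (subst mat_fun_mult) (auto intro!: analytic_intros analytic_on_prod simp: algebra_simps)
      ultimately show ?thesis
        unfolding b_def by (simp only: matrix_mul_assoc[symmetric])
    qed
    moreover have "M + mat (e - of_nat k) - mat 1 = M + mat (e - of_nat (Suc k))"
      by (simp add: vec_eq_iff mat_def)
    ultimately show ?thesis
      using powser_powm_has_vector_derivative[OF sm x, of "M + mat (e - of_nat k)"] by (simp only:)
  qed
  have b0: "b 0 n = c n" for n
    by (simp add: b_def mat_fun_const)
  have sm: "summable (\<lambda>n. x ^ n *\<^sub>R b k n)" if "0 < x" "x < \<rho>" for k x
    using that by (induction k arbitrary: x) (use c b0 deriv in auto)
  have eq: "nth_vderiv k g x = ?h k x" if "0 < x" "x < \<rho>" for k x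
    using that
  proof (induction k arbitrary: x)
    case 0
    then show ?case by (simp add: g b0)
  next
    case (Suc k)
    \<comment> \<open>The formula for \<open>nth_vderiv k g\<close> is known on the whole open
      interval, so it may be differentiated.\<close>
    have "(nth_vderiv k g has_vector_derivative ?h (Suc k) x) (at x)"
      by (rule has_vector_derivative_transform_within_open[of "?h k" _ _ "{0<..<\<rho>}"])
         (use Suc deriv[OF sm] in auto)
    then show ?case by (simp add: vector_derivative_at)
  qed
  show "nth_vderiv k g x = ?h k x" by (rule eq[OF x])
  have "(nth_vderiv k g has_vector_derivative ?h (Suc k) x) (at x)"
    by (rule has_vector_derivative_transform_within_open[of "?h k" _ _ "{0<..<\<rho>}"])
       (use x eq deriv[OF sm] in auto)
  then show "nth_vderiv k g differentiable (at x)"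
    by (rule differentiableI_vector)
qed

section \<open>Fractional derivatives\<close>

lemma matrix_left_smult: "mat c ** A = (\<chi> i. c *s vec_nth A i)"
  for A :: "complex^'n^'m"
  by (simp add: vec_eq_iff matrix_matrix_mult_def mat_def if_distrib if_distribR cong: if_cong)

lemma norm_mat_mult: "norm (mat c ** A) = norm c * norm (A :: complex^'n^'m)"
  unfolding matrix_left_smult
  by (simp add: norm_vec_def[of "vec_lambda _"] norm_vec_def[of A] norm_vector_smult L2_set_def
      power_mult_distrib sum_distrib_left[symmetric] real_sqrt_mult)

lemma bounded_linear_mat: "bounded_linear (mat :: complex \<Rightarrow> complex^'n^'n)"
  by (auto intro!: linearI simp: linear_conv_bounded_linear[symmetric] mat_def vec_eq_iff)

lemma measurable_mat_mult:
  fixes R :: "'a \<Rightarrow> complex^'n^'m"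
  assumes "g \<in> borel_measurable N" "R \<in> borel_measurable N"
  shows "(\<lambda>t. mat (g t) ** R t) \<in> borel_measurable N"
  using assms
  by (rule borel_measurable_continuous_Pair)
     (intro mm.continuous_on bounded_linear.continuous_on[OF bounded_linear_mat] continuous_intros)

text \<open>The kernel \<open>(x - t)^(\<nu>-1)\<close> is bounded away from 0 for
  \<open>0 < t < d < x\<close>, so dividing by it keeps integrability. This isolates the behaviour
  at 0 that \<open>powser_coeff_vanish\<close> exploits.\<close>

lemma RL_integrable_imp_integrable_near_0:
  fixes f :: "real \<Rightarrow> complex^'r^'r"
  assumes "RL_integrable \<nu> f x" "0 < d" "d < x"
  shows "integrable (ivl d) f"
proof -
  let ?R = "RL_integrand \<nu> f x"
  \<comment> \<open>The two values bound \<open>(x - t)^(1 - Re \<nu>)\<close> for a nonnegative and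
    for a negative exponent.\<close>
  define C where "C = max (x powr (1 - Re \<nu>)) ((x - d) powr (1 - Re \<nu>))"
  have R: "integrable (ivl d) ?R"
    using assms(2,3) unfolding integrable_ivl
    by (intro set_integrable_subset[OF assms(1)[unfolded RL_integrable_def]]) auto
  have eq: "f t = mat (of_real (x - t) powr (1 - \<nu>)) ** ?R t" if "t \<in> space (ivl d)" for t
  proof -
    have "0 < t" "t < d" using that by (auto simp: space_restrict_space)
    then have "complex_of_real (x - t) powr (1 - \<nu>) * of_real (x - t) powr (\<nu> - 1) = 1"
      using assms powr_add[of "of_real (x - t)" "1 - \<nu>" "\<nu> - 1"] by simp
    then have "mat (of_real (x - t) powr (1 - \<nu>)) ** mat (of_real (x - t) powr (\<nu> - 1)) = (mat 1 :: complex^'r^'r)"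
      by (simp add: matrix_eq matrix_vector_mul_assoc[symmetric])
    then show ?thesis
      by (simp add: RL_integrand_def matrix_mul_assoc)
  qed
  show ?thesis
  proof (rule Bochner_Integration.integrable_bound)
    show "integrable (ivl d) (\<lambda>t. C * norm (?R t))"
      by (intro integrable_mult_right integrable_norm R)
    have "(\<lambda>t. mat (of_real (x - t) powr (1 - \<nu>)) ** ?R t) \<in> borel_measurable (ivl d)"
      by (rule measurable_mat_mult[OF measurable_restrict_space1 borel_measurable_integrable[OF R]]) measurable
    then show "f \<in> borel_measurable (ivl d)"
      using eq by (subst measurable_cong) auto
    show "AE t in ivl d. norm (f t) \<le> norm (C * norm (?R t))"
    proof (rule AE_I2)
      fix t assume t: "t \<in> space (ivl d)"
      then have td: "0 < t" "t < d" by (auto simp: space_restrict_space)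
      have "norm (complex_of_real (x - t) powr (1 - \<nu>)) = (x - t) powr (1 - Re \<nu>)"
        using norm_powr_of_real[of "x - t" "1 - \<nu>"] td assms by simp
      also have "\<dots> \<le> C"
      proof (cases "1 - Re \<nu> \<ge> 0")
        case True
        then have "(x - t) powr (1 - Re \<nu>) \<le> x powr (1 - Re \<nu>)"
          using td assms by (intro powr_mono2) auto
        then show ?thesis by (simp add: C_def)
      next
        case False
        then have "(x - t) powr (1 - Re \<nu>) \<le> (x - d) powr (1 - Re \<nu>)"
          using td assms by (intro powr_mono2') auto
        then show ?thesis by (simp add: C_def)
      qed
      finally have "norm (complex_of_real (x - t) powr (1 - \<nu>)) * norm (?R t) \<le> C * norm (?R t)"
        by (rule mult_right_mono) simp
      then show "norm (f t) \<le> norm (C * norm (?R t))"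
        using eq[OF t] by (simp add: norm_mat_mult)
    qed
  qed
qed

lemma eventually_notin_nonpos_Ints:
  assumes "l \<notin> \<int>\<^sub>\<le>\<^sub>0"
  shows "\<forall>\<^sub>F z in at l. (z::complex) \<notin> \<int>\<^sub>\<le>\<^sub>0"
proof -
  have "\<forall>\<^sub>F z in nhds l. z \<in> - \<int>\<^sub>\<le>\<^sub>0"
    using assms by (intro eventually_nhds_in_open) (auto simp: open_Compl)
  then show ?thesis by (simp add: eventually_at_filter eventually_mono)
qed

lemma eventually_pochhammer_nonzero:
  fixes l c :: complex
  assumes "pochhammer (l + c) n \<noteq> 0"
  shows "\<forall>\<^sub>F z in at l. pochhammer (z + c) n \<noteq> 0"
proof -
  have "isCont (\<lambda>z. pochhammer (z + c) n) l"
    by (intro field_differentiable_imp_continuous_at analytic_on_imp_differentiable_at[of _ "{l}"]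
          analytic_intros) simp
  then show ?thesis
    using assms unfolding isCont_def by (rule tendsto_imp_eventually_ne)
qed

lemma rGamma_shift: "pochhammer z n \<noteq> 0 \<Longrightarrow> rGamma (z + of_nat n) = inverse (pochhammer z n) * rGamma (z :: complex)"
  using pochhammer_rGamma[of z n] by (simp add: field_simps)

lemma Gamma_shift: "z \<notin> \<int>\<^sub>\<le>\<^sub>0 \<Longrightarrow> Gamma (z + of_nat n) = pochhammer z n * Gamma (z :: complex)"
  using pochhammer_Gamma[of z n] by (simp add: Gamma_eq_zero_iff)

text \<open>The matrix power maps the generalised eigenspace into itself.\<close>

lemma powm_vanish:
  fixes a :: "complex^'r^'r"
  assumes "t > 0" "gen_eigvec M l K v" "\<And>w. gen_eigvec M l K w \<Longrightarrow> a *v w = 0"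
  shows "a *v (powm t (M + mat e) *v v) = 0"
proof -
  have "powm t (M + mat e) *v v = (\<Sum>k<K. (of_real t powr (l + e) * of_real (ln t) ^ k / fact k) *s
      (mpow (M - mat l) k *v v))"
    using powm_gen_eigvec[OF assms(1), of "M + mat e" "l + e" K v] assms(2)
    unfolding gen_eigvec_shift shift_nilpotent by simp
  then show ?thesis
    by (simp add: mult_vec_sum mult_vec_smult assms(3) gen_eigvec_mpow assms(2))
qed

section \<open>Fractional integral of a power series times a matrix power\<close>

context
  fixes M :: "complex^'r^'r"
  assumes inv: "\<And>k::nat. invertible (M + mat (of_nat k))"
begin

lemma Gamma_analytic_spectrum: "Gamma analytic_on spectrum M"
  using spectrum_nonpos_Ints[OF inv] by (intro analytic_intros) auto

lemma Beta_analytic_spectrum: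
  assumes "x > 0" "Re \<nu> > 0"
  shows "(\<lambda>z. of_real x powr (\<nu> + (z + of_nat n) - 1) * Beta \<nu> (z + of_nat n)) analytic_on spectrum M"
proof -
  have "\<nu> \<notin> \<int>\<^sub>\<le>\<^sub>0" using assms by (auto elim!: nonpos_Ints_cases)
  moreover have "z + of_nat n \<notin> \<int>\<^sub>\<le>\<^sub>0" if "z \<in> spectrum M" for z
  proof
    assume "z + of_nat n \<in> \<int>\<^sub>\<le>\<^sub>0"
    then obtain k where "z + of_nat n = - of_nat k" by (auto elim!: nonpos_Ints_cases')
    then have "z + of_nat (n + k) = 0" by (simp add: add.assoc[symmetric])
    then show False using spectrum_add_nonzero[OF inv that] by blast
  qed
  ultimately show ?thesis
    using assms by (intro analytic_intros) auto
qed

text \<open>The scalar identity is \<open>B(\<nu>, z + n) = \<Gamma>(\<nu>) (z)_n / (z + \<nu>)_n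
  \<Gamma>(z) / \<Gamma>(z + \<nu>)\<close>. It confines the index \<open>n\<close> to
  \<open>x^n\<close> and \<open>poch_quot\<close>; \<open>inv'\<close> keeps the denominators
  nonzero near the spectrum.\<close>

lemma mat_fun_Beta:
  assumes x: "x > 0" "Re \<nu> > 0" and inv': "\<And>k::nat. invertible (M + mat (\<nu> + of_nat k))"
  shows "mat_fun (\<lambda>z. of_real x powr (\<nu> + (z + of_nat n) - 1) * Beta \<nu> (z + of_nat n)) M
    = mat (Gamma \<nu>) ** (x ^ n *\<^sub>R (poch_quot M \<nu> n ** (mGamma M ** mrGamma (M + mat \<nu>))
        ** powm x (M + mat (\<nu> - 1))))"
proof -
  let ?q = "\<lambda>z. pochhammer z n * inverse (pochhammer (z + \<nu>) n)"
  let ?G = "\<lambda>z. Gamma z * rGamma (z + \<nu>)"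
  let ?p = "\<lambda>z. complex_of_real x powr (z + (\<nu> - 1))"
  have an: "?q analytic_on spectrum M" "?G analytic_on spectrum M" "?p analytic_on spectrum M"
    using poch_quot_analytic[OF inv'] Gamma_analytic_spectrum x by (auto intro!: analytic_intros)
  have "mat_fun (\<lambda>z. of_real x powr (\<nu> + (z + of_nat n) - 1) * Beta \<nu> (z + of_nat n)) M
      = mat_fun (\<lambda>z. (Gamma \<nu> * of_real x ^ n) * (?q z * ?G z * ?p z)) M"
  proof (rule mat_fun_cong)
    fix l assume l: "l \<in> spectrum M"
    have "\<forall>\<^sub>F z in at l. z \<notin> \<int>\<^sub>\<le>\<^sub>0"
      using spectrum_nonpos_Ints[OF inv] l by (intro eventually_notin_nonpos_Ints) auto
    moreover have "\<forall>\<^sub>F z in at l. pochhammer (z + \<nu>) n \<noteq> 0"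
      by (intro eventually_pochhammer_nonzero pochhammer_spectrum_nonzero[OF inv' l])
    ultimately show "\<forall>\<^sub>F z in at l. of_real x powr (\<nu> + (z + of_nat n) - 1) * Beta \<nu> (z + of_nat n)
        = (Gamma \<nu> * of_real x ^ n) * (?q z * ?G z * ?p z)"
    proof eventually_elim
      case (elim z)
      have "Beta \<nu> (z + of_nat n) = Gamma \<nu> * (?q z * ?G z)"
        using rGamma_shift[OF elim(2)] Gamma_shift[OF elim(1), of n]
        by (simp add: Beta_altdef add_ac mult_ac)
      moreover have "of_real x powr (\<nu> + (z + of_nat n) - 1) = of_real x ^ n * ?p z"
        using x powr_add[of "complex_of_real x" "z + (\<nu> - 1)" "of_nat n"]
        by (simp add: powr_nat' algebra_simps)
      ultimately show ?case by simp
    qed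
  qed
  also have "\<dots> = mat (Gamma \<nu> * of_real x ^ n) ** (mat_fun ?q M ** mat_fun ?G M ** mat_fun ?p M)"
    by (simp add: mat_fun_mult an analytic_on_mult mat_fun_const[of _ M, symmetric])
  also have "mat_fun ?G M = mGamma M ** mrGamma (M + mat \<nu>)"
    unfolding mGamma_def mrGamma_def mat_fun_shift
    by (intro mat_fun_mult[symmetric] Gamma_analytic_spectrum analytic_intros)
  also have "mat_fun ?p M = powm x (M + mat (\<nu> - 1))"
    by (simp add: powm_shift x)
  also have "mat (Gamma \<nu> * of_real x ^ n) ** X = mat (Gamma \<nu>) ** (x ^ n *\<^sub>R X)" for X :: "complex^'r^'r"
    by (simp add: matrix_eq matrix_vector_mul_assoc[symmetric] scaleR_mult_vec scaleR_eq_vector_smult)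
  finally show ?thesis by (simp add: poch_quot_def)
qed

text \<open>For \<open>Re l + n > 0\<close> the power is \<open>t^(M + n - 1)\<close>, and the
  earlier integral applies to \<open>M + n\<close>. Otherwise the integrand is 0 by
  \<open>vanish\<close>, and so is the right-hand side, because functions of \<open>M\<close>
  preserve the generalised eigenspace.\<close>

lemma
  fixes a :: "complex^'r^'r"
  assumes x: "x > 0" "Re \<nu> > 0" and v: "gen_eigvec M l K v"
    and vanish: "\<And>w. Re l + real n \<le> 0 \<Longrightarrow> gen_eigvec M l K w \<Longrightarrow> a *v w = 0"
  shows RL_term_integrable: "integrable (ivl x) (\<lambda>t. of_real (x - t) powr (\<nu> - 1) *s
      (t ^ n *\<^sub>R (a *v (powm t (M - mat 1) *v v))))"
    and RL_term_integral: "(\<integral>t. of_real (x - t) powr (\<nu> - 1) *s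
        (t ^ n *\<^sub>R (a *v (powm t (M - mat 1) *v v))) \<partial>ivl x)
      = a *v (mat_fun (\<lambda>z. of_real x powr (\<nu> + (z + of_nat n) - 1) * Beta \<nu> (z + of_nat n)) M *v v)"
proof -
  let ?h = "\<lambda>t. of_real (x - t) powr (\<nu> - 1) *s (t ^ n *\<^sub>R (a *v (powm t (M - mat 1) *v v)))"
  have M1: "M - mat 1 = M + mat (-1)" by (simp add: vec_eq_iff mat_def)
  have "integrable (ivl x) ?h \<and> integral\<^sup>L (ivl x) ?h
      = a *v (mat_fun (\<lambda>z. of_real x powr (\<nu> + (z + of_nat n) - 1) * Beta \<nu> (z + of_nat n)) M *v v)"
  proof (cases "Re l + real n > 0")
    case False
    then have a: "\<And>w. gen_eigvec M l K w \<Longrightarrow> a *v w = 0" using vanish by auto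
    have h: "?h t = 0" if "t \<in> space (ivl x)" for t
      using that powm_vanish[OF _ v a, of t "-1"] unfolding M1 by (simp add: space_restrict_space)
    have "integrable (ivl x) ?h"
      using h by (subst Bochner_Integration.integrable_cong[OF refl, of _ _ "\<lambda>_. 0"]) auto
    moreover have "integral\<^sup>L (ivl x) ?h = 0"
      using h by (subst Bochner_Integration.integral_cong[OF refl, of _ _ "\<lambda>_. 0"]) auto
    moreover have "a *v (mat_fun (\<lambda>z. of_real x powr (\<nu> + (z + of_nat n) - 1) * Beta \<nu> (z + of_nat n)) M *v v) = 0"
      unfolding mat_fun_gen_eigvec[OF Beta_analytic_spectrum[OF x] v]
      by (intro a gen_eigvec_fps_act v)
    ultimately show ?thesis by simp
  next
    case True
    let ?N = "M + mat (of_nat n)"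
    let ?g = "\<lambda>t. of_real (x - t) powr (\<nu> - 1) *s (powm t (?N - mat 1) *v v)"
    have spec: "spectrum ?N \<inter> \<int>\<^sub>\<le>\<^sub>0 = {}"
    proof (rule spectrum_nonpos_Ints)
      fix k :: nat
      have "?N + mat (of_nat k) = M + mat (of_nat (n + k))"
        by (simp add: vec_eq_iff mat_def)
      then show "invertible (?N + mat (of_nat k))"
        using inv by (simp only:)
    qed
    have vN: "gen_eigvec ?N (l + of_nat n) K v"
      using v by (simp only: gen_eigvec_shift)
    have l: "Re (l + of_nat n) > 0" using True by simp
    note int = RL_powm_integrable[OF x spec vN l] and eq = RL_powm_integral[OF x spec vN l]
    have h: "?h t = a *v ?g t" if "t \<in> space (ivl x)" for t
    proof -
      have t: "t > 0" using that by (simp add: space_restrict_space)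
      have "powm t (?N - mat 1) = mat_fun (\<lambda>z. of_real t ^ n * of_real t powr (z + -1)) M"
      proof -
        have "?N - mat 1 = M + mat (of_nat n - 1)" by (simp add: vec_eq_iff mat_def)
        then have "powm t (?N - mat 1) = mat_fun (\<lambda>z. of_real t powr (z + (of_nat n - 1))) M"
          by (simp only: powm_shift[OF t])
        also have "(\<lambda>z. of_real t powr (z + (of_nat n - 1))) = (\<lambda>z. complex_of_real t ^ n * of_real t powr (z + -1))"
        proof
          fix z
          have "of_real t powr (z + (of_nat n - 1)) = complex_of_real t powr (of_nat n + (z + -1))"
            by (simp add: algebra_simps)
          also have "\<dots> = complex_of_real t ^ n * of_real t powr (z + -1)"
            unfolding powr_add using t by (simp add: powr_nat')
          finally show "of_real t powr (z + (of_nat n - 1)) = complex_of_real t ^ n * of_real t powr (z + -1)" .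
        qed
        finally show ?thesis .
      qed
      also have "\<dots> = mat (of_real t ^ n) ** powm t (M - mat 1)"
        unfolding M1 powm_shift[OF t]
        by (subst mat_fun_mult[symmetric]) (use t in \<open>auto intro!: analytic_intros simp: mat_fun_const\<close>)
      finally have "powm t (?N - mat 1) = t ^ n *\<^sub>R powm t (M - mat 1)"
        using mat_of_real_mult[of "t ^ n"] by simp
      then show ?thesis
        by (simp add: scaleR_mult_vec mult_vec_smult matrix_vector_mult_scaleR mv.scaleR_right)
    qed
    have "integrable (ivl x) (\<lambda>t. a *v ?g t)"
      by (intro integrable_bounded_linear[OF mv.bounded_linear_right] int)
    then have "integrable (ivl x) ?h"
      using h by (subst Bochner_Integration.integrable_cong[OF refl]) auto
    moreover have "integral\<^sup>L (ivl x) ?h = (\<integral>t. a *v ?g t \<partial>ivl x)"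
      using h by (rule Bochner_Integration.integral_cong[OF refl])
    moreover have "\<dots> = a *v (integral\<^sup>L (ivl x) ?g)"
      by (rule integral_bounded_linear[OF mv.bounded_linear_right int])
    ultimately show ?thesis
      by (simp only: eq mat_fun_shift)
  qed
  then show "integrable (ivl x) ?h" and "integral\<^sup>L (ivl x) ?h
      = a *v (mat_fun (\<lambda>z. of_real x powr (\<nu> + (z + of_nat n) - 1) * Beta \<nu> (z + of_nat n)) M *v v)"
    by blast+
qed

text \<open>Term-by-term integration with a majorant: from an index \<open>n0\<close> with
  \<open>Re l + n0 > 0\<close> on, the \<open>n\<close>-th term is at most
  \<open>norm (c n) * x^n\<close> times one fixed integrable function. The finitely many earlier
  terms are integrable singly.\<close>

lemma RL_powser_sums:
  fixes c :: "nat \<Rightarrow> complex^'r^'r"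
  assumes nu: "Re \<nu> > 0" and sm: "\<And>x. 0 < x \<Longrightarrow> x < \<rho> \<Longrightarrow> summable (\<lambda>n. x ^ n *\<^sub>R c n)"
    and x: "0 < x" "x < \<rho>"
    and int: "RL_integrable \<nu> (\<lambda>t. (\<Sum>n. t ^ n *\<^sub>R c n) ** powm t (M - mat 1)) x"
    and v: "gen_eigvec M l K v"
  shows "(\<lambda>n. c n *v (mat_fun (\<lambda>z. of_real x powr (\<nu> + (z + of_nat n) - 1) * Beta \<nu> (z + of_nat n)) M *v v))
    sums (set_lebesgue_integral lborel {0<..<x}
      (RL_integrand \<nu> (\<lambda>t. (\<Sum>n. t ^ n *\<^sub>R c n) ** powm t (M - mat 1)) x) *v v)"
proof -
  let ?p = "\<lambda>t. complex_of_real (x - t) powr (\<nu> - 1)"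
  let ?w = "\<lambda>t. powm t (M - mat 1) *v v"
  let ?h = "\<lambda>n t. ?p t *s (t ^ n *\<^sub>R (c n *v ?w t))"
  let ?f = "\<lambda>t. (\<Sum>n. t ^ n *\<^sub>R c n) ** powm t (M - mat 1)"
  \<comment> \<open>Stopping short of the endpoint \<open>x\<close> allows the kernel to be
    removed.\<close>
  have "integrable (ivl (x / 2)) ?f"
    by (rule RL_integrable_imp_integrable_near_0[OF int]) (use x in auto)
  then have vanish: "c n *v w = 0" if "Re l + real n \<le> 0" "gen_eigvec M l K w" for n w
    using powser_coeff_vanish[of "x / 2" c M l K w n] that sm x by auto
  note trm = RL_term_integrable[OF x(1) nu v vanish] RL_term_integral[OF x(1) nu v vanish]
  have cx: "summable (\<lambda>n. norm (c n) * x ^ n)"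
    by (rule powser_abs_summable[OF sm[of "(x + \<rho>) / 2"]]) (use x in auto)
  obtain B where B: "B > 0" "\<And>(a :: complex^'r^'r) b. norm (a *v b) \<le> norm a * norm b * B"
    using mv.pos_bounded by blast
  obtain n0 where "- Re l < real n0"
    using reals_Archimedean2 by blast
  then have n0: "Re l + real n0 > 0" by simp
  \<comment> \<open>The term of index \<open>n0\<close> with the identity as coefficient, integrable
    whatever \<open>c\<close> is.\<close>
  let ?u = "\<lambda>t. ?p t *s (t ^ n0 *\<^sub>R (mat 1 *v ?w t))"
  have u: "integrable (ivl x) (\<lambda>t. norm (?u t))"
    by (intro integrable_norm RL_term_integrable[OF x(1) nu v]) (use n0 in auto)
  have bound: "norm (?h n t) \<le> norm (c n) * x ^ n * (B / x ^ n0 * norm (?u t))"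
    if n0_le: "n \<ge> n0" and ts: "t \<in> space (ivl x)" for n t
  proof -
    have t: "0 < t" "t < x" using ts by (auto simp: space_restrict_space)
    obtain d where n: "n = n0 + d" using le_Suc_ex[OF n0_le] by blast
    have "norm (?h n t) \<le> norm (?p t) * (t ^ n * (norm (c n) * norm (?w t) * B))"
      unfolding norm_vector_smult norm_scaleR using t by (intro mult_mono mult_left_mono B(2)) auto
    also have "t ^ n \<le> t ^ n0 * x ^ d"
      unfolding n power_add using t by (intro mult_left_mono power_mono) auto
    then have "norm (?p t) * (t ^ n * (norm (c n) * norm (?w t) * B))
        \<le> norm (?p t) * (t ^ n0 * x ^ d * (norm (c n) * norm (?w t) * B))"
      using B(1) by (intro mult_left_mono mult_right_mono) auto
    also have "\<dots> = norm (c n) * x ^ n * (B / x ^ n0 * norm (?u t))"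
      using t x by (simp add: norm_vector_smult n power_add)
    finally show ?thesis .
  qed
  have "(\<lambda>n. integral\<^sup>L (ivl x) (?h n)) sums (\<integral>t. (\<Sum>n. ?h n t) \<partial>ivl x)"
  proof (rule sums_integral)
    show "integrable (ivl x) (?h n)" for n by (rule trm)
    show "AE t in ivl x. summable (\<lambda>n. norm (?h n t))"
    proof (rule AE_I2)
      fix t assume t: "t \<in> space (ivl x)"
      show "summable (\<lambda>n. norm (?h n t))"
      proof (rule summable_comparison_test'[OF summable_mult2[OF cx], of n0])
        fix n assume "n0 \<le> n"
        from bound[OF this t]
        show "norm (norm (?h n t)) \<le> norm (c n) * x ^ n * (B / x ^ n0 * norm (?u t))"
          by (simp only: real_norm_def abs_norm_cancel)
      qed
    qed
    show "summable (\<lambda>n. \<integral>t. norm (?h n t) \<partial>ivl x)"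
    proof (rule summable_comparison_test'[OF summable_mult2[OF cx], of n0])
      fix n assume n: "n \<ge> n0"
      have "(\<integral>t. norm (?h n t) \<partial>ivl x) \<le> (\<integral>t. norm (c n) * x ^ n * (B / x ^ n0 * norm (?u t)) \<partial>ivl x)"
        using bound[OF n] by (intro integral_mono integrable_norm trm integrable_mult_right u) auto
      also have "\<dots> = norm (c n) * x ^ n * (\<integral>t. B / x ^ n0 * norm (?u t) \<partial>ivl x)"
        by simp
      finally show "norm (\<integral>t. norm (?h n t) \<partial>ivl x) \<le> norm (c n) * x ^ n * (\<integral>t. B / x ^ n0 * norm (?u t) \<partial>ivl x)"
        by (simp add: integral_nonneg_AE)
    qed
  qed
  also have "(\<integral>t. (\<Sum>n. ?h n t) \<partial>ivl x) = (\<integral>t. RL_integrand \<nu> ?f x t *v v \<partial>ivl x)"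
  proof (rule Bochner_Integration.integral_cong[OF refl])
    fix t assume "t \<in> space (ivl x)"
    then have t: "0 < t" "t < \<rho>" using x by (auto simp: space_restrict_space)
    have "(\<lambda>n. t ^ n *\<^sub>R (c n *v ?w t)) sums (\<Sum>n. t ^ n *\<^sub>R (c n *v ?w t))"
      using summable_matrix_vector[OF sm[OF t], of "?w t"] by (intro summable_sums) (simp add: scaleR_mult_vec)
    then have "(\<lambda>n. ?h n t) sums (?p t *s (\<Sum>n. t ^ n *\<^sub>R (c n *v ?w t)))"
      by (rule bounded_linear.sums[OF bounded_linear_smult_right])
    also have "(\<Sum>n. t ^ n *\<^sub>R (c n *v ?w t)) = ?f t *v v"
      using suminf_matrix_vector[OF sm[OF t], of "?w t"]
      by (simp add: matrix_vector_mul_assoc[symmetric] scaleR_mult_vec)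
    finally show "(\<Sum>n. ?h n t) = RL_integrand \<nu> ?f x t *v v"
      by (simp add: sums_iff RL_integrand_def matrix_vector_mul_assoc[symmetric])
  qed
  also have "\<dots> = integral\<^sup>L (ivl x) (RL_integrand \<nu> ?f x) *v v"
    using int unfolding RL_integrable_def integrable_ivl[symmetric]
    by (rule integral_bounded_linear[OF mv.bounded_linear_left])
  finally show ?thesis
    by (simp only: trm(2)) (simp only: integral_ivl)
qed

lemma RL_integral_powser_powm:
  fixes c :: "nat \<Rightarrow> complex^'r^'r"
  assumes nu: "Re \<nu> > 0" and inv': "\<And>k::nat. invertible (M + mat (\<nu> + of_nat k))"
    and sm: "\<And>x. 0 < x \<Longrightarrow> x < \<rho> \<Longrightarrow> summable (\<lambda>n. x ^ n *\<^sub>R c n)" and x: "0 < x" "x < \<rho>"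
    and int: "RL_integrable \<nu> (\<lambda>t. (\<Sum>n. t ^ n *\<^sub>R c n) ** powm t (M - mat 1)) x"
  shows "RL_integral \<nu> (\<lambda>t. (\<Sum>n. t ^ n *\<^sub>R c n) ** powm t (M - mat 1)) x
    = (\<Sum>n. x ^ n *\<^sub>R (c n ** poch_quot M \<nu> n ** (mGamma M ** mrGamma (M + mat \<nu>))))
      ** powm x (M + mat (\<nu> - 1))" (is "RL_integral \<nu> ?f x = suminf ?s ** ?P")
proof (rule matrix_eq_gen_eigvecs[of M])
  fix l K v assume v: "gen_eigvec M l K v"
  have G: "Gamma \<nu> \<noteq> 0" using nu by (auto simp: Gamma_eq_zero_iff elim!: nonpos_Ints_cases)
  have "(\<lambda>n. (1 / Gamma \<nu>) *s (c n *v (mat_fun (\<lambda>z. of_real x powr (\<nu> + (z + of_nat n) - 1) * Beta \<nu> (z + of_nat n)) M *v v)))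
      sums ((1 / Gamma \<nu>) *s (set_lebesgue_integral lborel {0<..<x} (RL_integrand \<nu> ?f x) *v v))"
    by (intro bounded_linear.sums[OF bounded_linear_smult_right] RL_powser_sums[OF nu sm x int v])
  moreover have "(1 / Gamma \<nu>) *s (c n *v (mat_fun (\<lambda>z. of_real x powr (\<nu> + (z + of_nat n) - 1) * Beta \<nu> (z + of_nat n)) M *v v))
      = ?s n *v (?P *v v)" for n
    unfolding mat_fun_Beta[OF x(1) nu inv']
    by (simp add: matrix_vector_mul_assoc[symmetric] mult_vec_smult scaleR_eq_vector_smult scaleR_mult_vec G)
  ultimately have "(\<lambda>n. ?s n *v (?P *v v)) sums (RL_integral \<nu> ?f x *v v)"
    by (simp add: RL_integral_def matrix_vector_mul_assoc[symmetric])
  \<comment> \<open>The matrix series itself has to converge before \<open>?P v\<close> can be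
    pulled out of the sum.\<close>
  moreover have "summable (\<lambda>n. (x ^ n *\<^sub>R (c n ** poch_quot M \<nu> n)) ** (mGamma M ** mrGamma (M + mat \<nu>)))"
    by (intro bounded_linear.summable[OF mm.bounded_linear_left] poch_quot_summable[OF inv' sm x])
  then have "summable ?s"
    by (simp add: mm.scaleR_left)
  ultimately show "RL_integral \<nu> ?f x *v v = (suminf ?s ** ?P) *v v"
    using suminf_matrix_vector[of ?s "?P *v v"]
    by (simp only: matrix_vector_mul_assoc[symmetric] sums_iff)
qed

end

section \<open>Commuting parameters and the change of one of them\<close>

lemma mpochhammer_commute:
  fixes X Y :: "complex^'r^'r"
  assumes "X ** Y = Y ** X"
  shows "X ** mpochhammer Y n = mpochhammer Y n ** X"
proof (induction n)
  case (Suc n)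
  have "X ** mpochhammer Y (Suc n) = mpochhammer Y n ** (X ** (Y + mat (of_nat n)))"
    by (simp add: matrix_mul_assoc Suc)
  also have "X ** (Y + mat (of_nat n)) = (Y + mat (of_nat n)) ** X"
    by (simp add: mm.add_left mm.add_right assms mat_mult_commute)
  finally show ?case by (simp add: matrix_mul_assoc)
qed simp

lemma matrix_inv_commute:
  fixes X Y :: "complex^'r^'r"
  assumes "X ** Y = Y ** X" "invertible Y"
  shows "X ** matrix_inv Y = matrix_inv Y ** X"
proof -
  obtain Z where Z: "Y ** Z = mat 1" "Z ** Y = mat 1"
    using assms(2) unfolding invertible_def by blast
  have "X ** Z = Z ** (Y ** X) ** Z"
    by (simp add: matrix_mul_assoc Z)
  also have "\<dots> = Z ** X"
    by (simp add: assms(1)[symmetric] matrix_mul_assoc[symmetric] Z)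
  finally show ?thesis by (simp add: matrix_inv_eqI(2)[OF Z(1)])
qed

lemma matrix_mult_commute:
  fixes X Y Z :: "complex^'r^'r"
  assumes "X ** Y = Y ** X" "X ** Z = Z ** X"
  shows "X ** (Y ** Z) = Y ** Z ** X"
proof -
  have "X ** (Y ** Z) = Y ** (X ** Z)"
    by (simp only: matrix_mul_assoc assms(1))
  then show ?thesis by (simp only: assms(2) matrix_mul_assoc)
qed

text \<open>The factor inserted at position \<open>j\<close> travels to the right end past the later
  factors, all of which commute with \<open>Q\<close>.\<close>

lemma mprod_list_update:
  assumes "\<And>X. X \<in> set Xs \<Longrightarrow> X ** Q = Q ** X" "j < length Xs"
  shows "mprod_list (Xs[j := Xs ! j ** Q]) = mprod_list Xs ** Q"
  using assms
proof (induction Xs arbitrary: j)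
  case (Cons X Xs)
  have comm: "Q ** mprod_list Xs = mprod_list Xs ** Q"
    using Cons.prems(1)
  proof (induction Xs)
    case (Cons Y Ys)
    then have IH: "Q ** mprod_list Ys = mprod_list Ys ** Q" and Y: "Y ** Q = Q ** Y" by auto
    have "Q ** (Y ** mprod_list Ys) = Y ** (Q ** mprod_list Ys)"
      unfolding matrix_mul_assoc Y ..
    then show ?case by (simp only: mprod_list.simps IH matrix_mul_assoc)
  qed simp
  show ?case
  proof (cases j)
    case 0
    then show ?thesis by (simp add: matrix_mul_assoc[symmetric] comm)
  next
    case (Suc i)
    then show ?thesis using Cons by (simp add: matrix_mul_assoc[symmetric])
  qed
qed simp

text \<open>Writing \<open>(D + c)_n^-1 = (D)_n^-1 (D)_n (D + c)_n^-1\<close> inserts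
  \<open>poch_quot\<close> at position \<open>j\<close>. That factor is a function of the
  \<open>j\<close>-th parameter, so it commutes with the other inverse symbols because the
  parameters commute.\<close>

lemma mprod_list_inv_mpochhammer_update:
  fixes Ds :: "(complex^'r^'r) list"
  assumes comm: "\<forall>D\<in>set Ds. \<forall>D'\<in>set Ds. D ** D' = D' ** D" and j: "j < length Ds"
    and inv: "\<And>D k. D \<in> set Ds \<Longrightarrow> invertible (D + mat (of_nat k))"
    and inv': "\<And>k. invertible (Ds ! j + mat (c + of_nat k))"
  shows "mprod_list (map (\<lambda>D. matrix_inv (mpochhammer D n)) (Ds[j := Ds ! j + mat c]))
    = mprod_list (map (\<lambda>D. matrix_inv (mpochhammer D n)) Ds) ** poch_quot (Ds ! j) c n"
proof -
  let ?D = "Ds ! j" and ?i = "\<lambda>D. matrix_inv (mpochhammer D n)"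
  have D: "?D \<in> set Ds" using j by simp
  have pinv: "invertible (mpochhammer E n)" if "E \<in> set Ds" for E
    using poch_quot_eq(2)[of E 0 n] inv[OF that] by simp
  note quot = poch_quot_eq[OF inv']
  have "?i ?D ** mpochhammer ?D n = mat 1"
    using pinv[OF D] unfolding invertible_def by (metis matrix_inv_eqI(2))
  then have upd: "?i (?D + mat c) = ?i ?D ** poch_quot ?D c n"
    by (simp add: quot(1) matrix_mul_assoc)
  have "?i E ** poch_quot ?D c n = poch_quot ?D c n ** ?i E" if E: "E \<in> set Ds" for E
  proof -
    have "E ** ?D = ?D ** E" using comm E D by blast
    moreover from this have "E ** (?D + mat c) = (?D + mat c) ** E"
      by (simp add: mm.add_left mm.add_right mat_mult_commute)
    ultimately have "E ** poch_quot ?D c n = poch_quot ?D c n ** E"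
      unfolding quot(1)
      by (intro matrix_mult_commute mpochhammer_commute matrix_inv_commute quot(2))
    then have "poch_quot ?D c n ** E = E ** poch_quot ?D c n" by simp
    then show ?thesis
      by (intro matrix_inv_commute[symmetric] mpochhammer_commute pinv E)
  qed
  then have "mprod_list ((map ?i Ds)[j := map ?i Ds ! j ** poch_quot ?D c n])
      = mprod_list (map ?i Ds) ** poch_quot ?D c n"
    using j by (intro mprod_list_update) auto
  then show ?thesis
    using j by (simp add: map_update upd)
qed

lemma prod_shift_eq_pochhammer:
  "(\<Prod>i<m. w + of_nat m - 1 - of_nat i) = pochhammer w m" for w :: complex
proof -
  have "(\<Prod>i<m. w + of_nat m - 1 - of_nat i) = (\<Prod>i<m. w + of_nat (m - Suc i))"
    by (intro prod.cong) (auto simp: of_nat_diff)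
  also have "\<dots> = (\<Prod>i<m. w + of_nat i)"
    by (rule prod.nat_diff_reindex)
  finally show ?thesis by (simp add: pochhammer_prod atLeast0LessThan)
qed

text \<open>Differentiating \<open>m\<close> times turns \<open>1 / \<Gamma>(z + \<nu> + n)\<close>, \<open>\<nu> = m - \<mu>\<close>, into \<open>1 / \<Gamma>(z - \<mu> + n)\<close>.\<close>

lemma poch_quot_deriv:
  fixes M :: "complex^'r^'r" and \<mu> :: complex and m :: nat
  defines "\<nu> \<equiv> of_nat m - \<mu>"
  assumes inv: "\<And>k::nat. invertible (M + mat (of_nat k))"
    and inv': "\<And>k::nat. invertible (M + mat (- \<mu> + of_nat k))"
  shows "poch_quot M \<nu> n ** (mGamma M ** mrGamma (M + mat \<nu>))
      ** mat_fun (\<lambda>z. \<Prod>i<m. z + (\<nu> - 1) - of_nat i + of_nat n) M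
    = poch_quot M (- \<mu>) n ** (mGamma M ** mrGamma (M + mat (- \<mu>)))"
proof -
  let ?P = "\<lambda>z. \<Prod>i<m. z + (\<nu> - 1) - of_nat i + of_nat n"
  let ?q = "\<lambda>c z. pochhammer z n * inverse (pochhammer (z + c) n)"
  have inv\<nu>: "invertible (M + mat (\<nu> + of_nat k))" for k
    using inv'[of "m + k"] by (simp add: \<nu>_def algebra_simps)
  have GG: "mGamma M ** mrGamma (M + mat c) = mat_fun (\<lambda>z. Gamma z * rGamma (z + c)) M" for c
    unfolding mGamma_def mrGamma_def mat_fun_shift
    by (intro mat_fun_mult Gamma_analytic_spectrum[OF inv] analytic_intros)
  have an: "?q \<nu> analytic_on spectrum M" "?q (- \<mu>) analytic_on spectrum M"
    "?P analytic_on spectrum M" "(\<lambda>z. Gamma z * rGamma (z + c)) analytic_on spectrum M" for c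
    using poch_quot_analytic[OF inv\<nu>] poch_quot_analytic[OF inv'] Gamma_analytic_spectrum[OF inv]
    by (auto intro!: analytic_intros analytic_on_prod)
  have "mat_fun (\<lambda>z. ?q \<nu> z * (Gamma z * rGamma (z + \<nu>)) * ?P z) M
      = mat_fun (\<lambda>z. ?q (- \<mu>) z * (Gamma z * rGamma (z + - \<mu>))) M"
  proof (rule mat_fun_cong)
    fix l assume l: "l \<in> spectrum M"
    have "\<forall>\<^sub>F z in at l. pochhammer (z + \<nu>) n \<noteq> 0" "\<forall>\<^sub>F z in at l. pochhammer (z + - \<mu>) n \<noteq> 0"
      using eventually_pochhammer_nonzero pochhammer_spectrum_nonzero[OF inv\<nu> l]
        pochhammer_spectrum_nonzero[OF inv' l] by blast+
    then show "\<forall>\<^sub>F z in at l. ?q \<nu> z * (Gamma z * rGamma (z + \<nu>)) * ?P z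
        = ?q (- \<mu>) z * (Gamma z * rGamma (z + - \<mu>))"
    proof eventually_elim
      case (elim z)
      \<comment> \<open>The product runs down from \<open>?w + m - 1\<close> to \<open>?w\<close>,
        so it is \<open>(?w)_m\<close>. The relation
        \<open>(w)_m / \<Gamma>(w + m) = 1 / \<Gamma>(w)\<close> between entire functions then needs
        no exception at the poles of \<Gamma>.\<close>
      let ?w = "z + - \<mu> + of_nat n"
      have "?P z = (\<Prod>i<m. ?w + of_nat m - 1 - of_nat i)"
        by (intro prod.cong) (auto simp: \<nu>_def algebra_simps)
      then have P: "?P z = pochhammer ?w m"
        by (simp only: prod_shift_eq_pochhammer)
      have "inverse (pochhammer (z + \<nu>) n) * rGamma (z + \<nu>) * ?P z = rGamma (?w + of_nat m) * pochhammer ?w m"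
        unfolding P rGamma_shift[OF elim(1), symmetric] by (simp add: \<nu>_def algebra_simps)
      also have "\<dots> = rGamma ?w"
        using pochhammer_rGamma[of ?w m] by (simp add: mult.commute)
      also have "\<dots> = inverse (pochhammer (z + - \<mu>) n) * rGamma (z + - \<mu>)"
        by (rule rGamma_shift[OF elim(2)])
      finally have "pochhammer z n * Gamma z * (inverse (pochhammer (z + \<nu>) n) * rGamma (z + \<nu>) * ?P z)
          = pochhammer z n * Gamma z * (inverse (pochhammer (z + - \<mu>) n) * rGamma (z + - \<mu>))"
        by (simp only:)
      then show ?case by (simp only: mult_ac)
    qed
  qed
  then show ?thesis
    by (simp only: poch_quot_def GG mat_fun_mult an analytic_on_mult)
qed

text \<open>Convergence and integrability are assumed on a whole interval
  \<open>(0, \<rho>)\<close>: the fractional integral at \<open>x\<close> involves all of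
  \<open>(0, x)\<close>, and the derivatives at \<open>z\<close> involve a neighbourhood of
  \<open>z\<close>. Infinite sums and derivatives are total in HOL, so the conclusion states the
  convergence of the new series and the existence of the derivative besides the identity of
  values.\<close>

theorem theorem6p3:
  fixes A B :: "complex^'r^'r"
    and Cs Ds :: "(complex^'r^'r) list"
    and \<mu> :: complex
    and j :: nat
    and z \<rho> :: real
  assumes comm: "\<forall>D\<in>set Ds. \<forall>D'\<in>set Ds. D ** D' = D' ** D"
    and mu: "Re \<mu> > 0"
    and j: "j < length Ds"
    and inv_left: "\<forall>D\<in>set Ds. \<forall>k::nat. invertible (D + mat (of_nat k))"
    and inv_right: "\<forall>D\<in>set (Ds[j := Ds ! j - mat \<mu>]). \<forall>k::nat. invertible (D + mat (of_nat k))"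
    and z: "0 < z" "z < \<rho>"
    and conv: "\<forall>x\<in>{0<..<\<rho>}. pRq_converges Cs Ds A B (of_real x)"
    and int: "\<forall>x\<in>{0<..<\<rho>}. RL_integrable (of_nat (RL_order \<mu>) - \<mu>)
                (\<lambda>t. pRq Cs Ds A B (of_real t) ** powm t (Ds ! j - mat 1)) x"
  shows "pRq_converges Cs (Ds[j := Ds ! j - mat \<mu>]) A B (of_real z)
     \<and> RL_differentiable \<mu> (\<lambda>t. pRq Cs Ds A B (of_real t) ** powm t (Ds ! j - mat 1)) z
     \<and> RL_deriv \<mu> (\<lambda>t. pRq Cs Ds A B (of_real t) ** powm t (Ds ! j - mat 1)) z
         = pRq Cs (Ds[j := Ds ! j - mat \<mu>]) A B (of_real z)
             ** powm z (Ds ! j - mat (\<mu> + 1))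
             ** mGamma (Ds ! j) ** mrGamma (Ds ! j - mat \<mu>)"
proof -
  define D where "D = Ds ! j"
  define m where "m = RL_order \<mu>"
  define \<nu> where "\<nu> = of_nat m - \<mu>"
  \<comment> \<open>The floor of \<open>Re \<mu>\<close> plus 1 exceeds \<open>Re \<mu>\<close>, and
    \<open>Re \<mu> > 0\<close> makes the conversion to \<open>nat\<close> harmless.\<close>
  have nu: "Re \<nu> > 0"
    using mu unfolding \<nu>_def m_def RL_order_def by (simp add: of_nat_nat)
  have Dmu: "D - mat \<mu> = D + mat (- \<mu>)" by (simp add: vec_eq_iff mat_def)
  have inv: "invertible (D + mat (of_nat k))" for k
    using inv_left j by (simp add: D_def)
  have inv': "invertible (D + mat (- \<mu> + of_nat k))" for k
  proof -
    have "D - mat \<mu> \<in> set (Ds[j := Ds ! j - mat \<mu>])"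
      using j by (simp add: D_def set_update_memI)
    moreover have "D + mat (- \<mu> + of_nat k) = D - mat \<mu> + mat (of_nat k)"
      by (simp add: vec_eq_iff mat_def)
    ultimately show ?thesis using inv_right by (simp only:)
  qed
  \<comment> \<open>Since \<open>\<nu> + k = - \<mu> + (m + k)\<close>, this is the condition on
    \<open>D - \<mu>\<close> at a later index.\<close>
  have inv\<nu>: "invertible (D + mat (\<nu> + of_nat k))" for k
    using inv'[of "m + k"] by (simp add: \<nu>_def algebra_simps)
  \<comment> \<open>The scalar \<open>1 / n!\<close> is moved into the coefficient, which leaves a
    power series in a real variable.\<close>
  define c where "c n = (1 / fact n) *\<^sub>R (mrGamma (real n *\<^sub>R A + B)
     ** mprod_list (map (\<lambda>C. mpochhammer C n) Cs)
     ** mprod_list (map (\<lambda>D. matrix_inv (mpochhammer D n)) Ds))" for n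
  have scale: "X ** mat (of_real x ^ n / fact n) = x ^ n *\<^sub>R ((1 / fact n) *\<^sub>R X)" for X :: "complex^'r^'r" and x n
    using mat_of_real_mult[of "x ^ n / fact n" X] by (simp add: mat_mult_commute)
  have left: "pRq_term Cs Ds A B (of_real x) n = x ^ n *\<^sub>R c n" for x n
    unfolding pRq_term_def c_def scale ..
  have right: "pRq_term Cs (Ds[j := Ds ! j - mat \<mu>]) A B (of_real x) n
      = x ^ n *\<^sub>R (c n ** poch_quot D (- \<mu>) n)" for x n
  proof -
    have "mprod_list (map (\<lambda>D. matrix_inv (mpochhammer D n)) (Ds[j := Ds ! j - mat \<mu>]))
        = mprod_list (map (\<lambda>D. matrix_inv (mpochhammer D n)) Ds) ** poch_quot D (- \<mu>) n"
      using mprod_list_inv_mpochhammer_update[OF comm j, of "- \<mu>" n] inv_left inv'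
      unfolding D_def[symmetric] Dmu by blast
    then show ?thesis
      unfolding pRq_term_def c_def scale by (simp only: mm.scaleR_left matrix_mul_assoc)
  qed
  have sm: "summable (\<lambda>n. x ^ n *\<^sub>R c n)" if "0 < x" "x < \<rho>" for x
    using conv that by (simp add: pRq_converges_def left[abs_def])
  let ?f = "\<lambda>t. (\<Sum>n. t ^ n *\<^sub>R c n) ** powm t (D - mat 1)"
  have f: "(\<lambda>t. pRq Cs Ds A B (of_real t) ** powm t (Ds ! j - mat 1)) = ?f"
    by (simp add: pRq_def left[abs_def] D_def)
  have int: "RL_integrable \<nu> ?f x" if "0 < x" "x < \<rho>" for x
    using int that unfolding f by (simp add: \<nu>_def m_def)
  define b where "b n = c n ** poch_quot D \<nu> n ** (mGamma D ** mrGamma (D + mat \<nu>))" for n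
  have g: "RL_integral \<nu> ?f x = (\<Sum>n. x ^ n *\<^sub>R b n) ** powm x (D + mat (\<nu> - 1))" if "0 < x" "x < \<rho>" for x
    unfolding b_def by (rule RL_integral_powser_powm[OF inv nu inv\<nu> sm that int[OF that]])
  have smb: "summable (\<lambda>n. x ^ n *\<^sub>R b n)" if "0 < x" "x < \<rho>" for x
    using bounded_linear.summable[OF mm.bounded_linear_left poch_quot_summable[OF inv\<nu> sm that]]
    by (simp add: b_def mm.scaleR_left)
  have sm': "summable (\<lambda>n. z ^ n *\<^sub>R (c n ** poch_quot D (- \<mu>) n))"
    by (rule poch_quot_summable[OF inv' sm z])
  have "RL_differentiable \<mu> ?f z"
    unfolding RL_differentiable_def m_def[symmetric] \<nu>_def[symmetric]
  proof -
    have "\<forall>\<^sub>F y in nhds z. y \<in> {0<..<\<rho>}"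
      using z by (intro eventually_nhds_in_open) auto
    then show "\<forall>\<^sub>F y in nhds z. RL_integrable \<nu> ?f y \<and>
        (\<forall>k<m. nth_vderiv k (RL_integral \<nu> ?f) differentiable at y)"
      by eventually_elim (use int nth_vderiv_powser_powm_differentiable[OF smb g] in auto)
  qed
  moreover have "RL_deriv \<mu> ?f z
      = (\<Sum>n. z ^ n *\<^sub>R (c n ** poch_quot D (- \<mu>) n)) ** powm z (D - mat (\<mu> + 1))
        ** mGamma D ** mrGamma (D - mat \<mu>)"
  proof -
    let ?G = "mGamma D ** mrGamma (D + mat (- \<mu>))"
    have bn: "b n ** mat_fun (\<lambda>z. \<Prod>i<m. z + (\<nu> - 1) - of_nat i + of_nat n) D
        = c n ** poch_quot D (- \<mu>) n ** ?G" for n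
      using poch_quot_deriv[OF inv inv', of m n]
      unfolding b_def \<nu>_def by (simp only: matrix_mul_assoc[symmetric])
    have "RL_deriv \<mu> ?f z = nth_vderiv m (RL_integral \<nu> ?f) z"
      by (simp add: RL_deriv_def \<nu>_def m_def)
    also have "\<dots> = (\<Sum>n. z ^ n *\<^sub>R (b n ** mat_fun (\<lambda>z. \<Prod>i<m. z + (\<nu> - 1) - of_nat i + of_nat n) D))
        ** powm z (D + mat (\<nu> - 1 - of_nat m))"
      by (rule nth_vderiv_powser_powm[where c = b and M = D and e = "\<nu> - 1" and \<rho> = \<rho>])
         (fact smb g z)+
    also have "(\<Sum>n. z ^ n *\<^sub>R (b n ** mat_fun (\<lambda>z. \<Prod>i<m. z + (\<nu> - 1) - of_nat i + of_nat n) D))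
        = (\<Sum>n. z ^ n *\<^sub>R (c n ** poch_quot D (- \<mu>) n)) ** ?G"
      using bounded_linear.suminf[OF mm.bounded_linear_left sm', of ?G] by (simp only: bn mm.scaleR_left)
    also have "\<nu> - 1 - of_nat m = - (\<mu> + 1)"
      by (simp add: \<nu>_def)
    also have "D + mat (- (\<mu> + 1)) = D - mat (\<mu> + 1)"
      by (simp add: vec_eq_iff mat_def)
    finally have "RL_deriv \<mu> ?f z = (\<Sum>n. z ^ n *\<^sub>R (c n ** poch_quot D (- \<mu>) n))
        ** (?G ** powm z (D - mat (\<mu> + 1)))"
      by (simp only: matrix_mul_assoc)
    \<comment> \<open>The computation leaves the Gamma factors to the left of the power of
      \<open>z\<close>, the claim has them on the right; both are functions of
      \<open>D\<close>.\<close>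
    also have "?G ** powm z (D - mat (\<mu> + 1)) = powm z (D - mat (\<mu> + 1)) ** ?G"
    proof -
      have p: "D - mat (\<mu> + 1) = D + mat (- (\<mu> + 1))"
        by (simp add: vec_eq_iff mat_def)
      have G: "?G = mat_fun (\<lambda>z. Gamma z * rGamma (z + - \<mu>)) D"
        unfolding mGamma_def mrGamma_def mat_fun_shift
        by (intro mat_fun_mult Gamma_analytic_spectrum[OF inv] analytic_intros)
      show ?thesis
        unfolding p G powm_shift[OF z(1)]
        by (intro mat_fun_commute analytic_on_mult Gamma_analytic_spectrum[OF inv] analytic_intros z)
    qed
    finally show ?thesis by (simp only: matrix_mul_assoc Dmu)
  qed
  ultimately show ?thesis
    unfolding f using sm' by (simp add: pRq_converges_def pRq_def right[abs_def] D_def)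
qed

end
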